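(* Let $n\ge 1$, let $B_n$ be the Artin braid group on $n$ strands (the braid group of the type $A_{n-1}$ Coxeter system), and let $\mathcal C$ be a category. To give a strict action of $B_n$ on $\mathcal C$ is the same data as to give an action on $\mathcal C$ of the invertible braid cobordism category on $n$ strands, i.e. a monoidal functor from that category to $\mathrm{Aut}(\mathcal C)$.
   Context: Strict actions. For a group $G$, $\Omega G$ is the monoidal category with object set $G$, only identity morphisms, and tensor product given by multiplication. $\mathrm{Aut}(\mathcal C)$ is the monoidal category of autoequivalences of $\mathcal C$ and invertible natural transformations, with tensor product given by composition. A strict action of $G$ on $\mathcal C$ is a monoidal functor $\Omega G\to\mathrm{Aut}(\mathcal C)$. Invertible braid cobordism category (Carter-Saito presentation, invertible part). Objects: words in $\sigma_1^{\pm1},\dots,\sigma_{n-1}^{\pm1}$, with tensor product given by concatenation and unit the empty word $\mathbf 1$. Morphisms are movies, i.e. composites of the following elementary moves applied to consecutive subwords of a word: (i) creation and cancellation $\mathbf 1\rightleftarrows\sigma_i\sigma_i^{-1}$ and $\mathbf 1\rightleftarrows\sigma_i^{-1}\sigma_i$; (ii) distant exchanges $\sigma_i\sigma_j\to\sigma_j\sigma_i$ for $|i-j|\ge2$; (iii) Reidemeister III moves $\sigma_i\sigma_j\sigma_i\to\sigma_j\sigma_i\sigma_j$ for $|i-j|=1$ (the versions of (ii) and (iii) involving inverse letters being those obtained from these by bending strands with the moves (i)). The non-invertible elementary movies (creation or cancellation of a single letter $\sigma_i^{\pm1}$) are not included. Moves on disjoint subwords commute. Movies are considered modulo the invertible movie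 moves: (a) creations and cancellations are mutually inverse; $\sigma_i\sigma_j\to\sigma_j\sigma_i\to\sigma_i\sigma_j$ is the identity for $|i-j|\ge 2$; $\sigma_i\sigma_j\sigma_i\to\sigma_j\sigma_i\sigma_j\to\sigma_i\sigma_j\sigma_i$ is the identity for $|i-j|=1$; (b) the zigzag identities for the moves (i), and the cyclicity of the moves (ii) and (iii) with respect to them (the two mates of each such move, obtained by bending strands to the left or to the right, agree); (c) for each three-element set $I$ of generator indices, the Zamolodzhikov relation of the corresponding type ($A_1\times A_1\times A_1$, $A_1\times A_2$ or $A_3$): consider the graph of reduced expressions of the longest element $w_I$ of the parabolic subgroup $W_I$ of the symmetric group, with edges the moves (ii), (iii); say that a move applied to $a\cdot(\sigma_i\sigma_j\cdots)\cdot b$ crosses the coset $yW_{\{i,j\}}$ with $y$ the element expressed by $a$; the relation says that the composite along a closed path crossing each coset $yW_J\subset W_I$ with $J\subset I$, $|J|=2$, exactly once is the identity. *)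

theory Defs
  imports "HOL-Algebra.Sym_Groups"
begin

section \<open>Categories, functors and equivalences\<close>

record ('o, 'm) cat =
  Obj :: "'o set"
  Arr :: "'m set"
  Dom :: "'m \<Rightarrow> 'o"
  Cod :: "'m \<Rightarrow> 'o"
  Ide :: "'o \<Rightarrow> 'm"
  Cmp :: "'m \<Rightarrow> 'm \<Rightarrow> 'm" (infixr "\<cdot>\<index>" 60)

definition Hom :: "('o, 'm, 'z) cat_scheme \<Rightarrow> 'o \<Rightarrow> 'o \<Rightarrow> 'm set" where
  "Hom C X Y = {f \<in> Arr C. Dom C f = X \<and> Cod C f = Y}"

locale category =
  fixes C :: "('o, 'm, 'z) cat_scheme" (structure)
  assumes dom_in: "f \<in> Arr C \<Longrightarrow> Dom C f \<in> Obj C"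
    and cod_in: "f \<in> Arr C \<Longrightarrow> Cod C f \<in> Obj C"
    and ide_in: "X \<in> Obj C \<Longrightarrow> Ide C X \<in> Hom C X X"
    and comp_in: "\<lbrakk>f \<in> Hom C X Y; g \<in> Hom C Y Z\<rbrakk> \<Longrightarrow> g \<cdot> f \<in> Hom C X Z"
    and ide_left: "f \<in> Hom C X Y \<Longrightarrow> Ide C Y \<cdot> f = f"
    and ide_right: "f \<in> Hom C X Y \<Longrightarrow> f \<cdot> Ide C X = f"
    and comp_assoc: "\<lbrakk>f \<in> Hom C W X; g \<in> Hom C X Y; h \<in> Hom C Y Z\<rbrakk>
      \<Longrightarrow> (h \<cdot> g) \<cdot> f = h \<cdot> (g \<cdot> f)"

definition iso_arrow :: "('o, 'm, 'z) cat_scheme \<Rightarrow> 'm \<Rightarrow> bool" where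
  "iso_arrow C f \<longleftrightarrow> f \<in> Arr C \<and> (\<exists>g \<in> Hom C (Cod C f) (Dom C f).
     g \<cdot>\<^bsub>C\<^esub> f = Ide C (Dom C f) \<and> f \<cdot>\<^bsub>C\<^esub> g = Ide C (Cod C f))"

text \<open>Functors and transformations are functions on whole types; they are required to be
  \<^const>\<open>undefined\<close> off their domain, so that equality of functors and of transformations is the
  mathematical one.\<close>

record ('o, 'm, 'p, 'k) ftor =
  FOb :: "'o \<Rightarrow> 'p"
  FAr :: "'m \<Rightarrow> 'k"

definition is_functor ::
  "('o, 'm, 'z) cat_scheme \<Rightarrow> ('p, 'k, 'y) cat_scheme \<Rightarrow> ('o, 'm, 'p, 'k, 'x) ftor_scheme \<Rightarrow> bool" where
  "is_functor C D F \<longleftrightarrow>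
     FOb F \<in> Obj C \<rightarrow>\<^sub>E Obj D \<and> FAr F \<in> Arr C \<rightarrow>\<^sub>E Arr D \<and>
     (\<forall>f \<in> Arr C. Dom D (FAr F f) = FOb F (Dom C f) \<and> Cod D (FAr F f) = FOb F (Cod C f)) \<and>
     (\<forall>X \<in> Obj C. FAr F (Ide C X) = Ide D (FOb F X)) \<and>
     (\<forall>f \<in> Arr C. \<forall>g \<in> Arr C. Dom C g = Cod C f \<longrightarrow>
        FAr F (g \<cdot>\<^bsub>C\<^esub> f) = FAr F g \<cdot>\<^bsub>D\<^esub> FAr F f)"

definition id_functor :: "('o, 'm, 'z) cat_scheme \<Rightarrow> ('o, 'm, 'o, 'm) ftor" where
  "id_functor C = \<lparr>FOb = (\<lambda>X \<in> Obj C. X), FAr = (\<lambda>f \<in> Arr C. f)\<rparr>"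

definition comp_functor :: "('o, 'm, 'z) cat_scheme \<Rightarrow> ('p, 'k, 'q, 'l, 'y) ftor_scheme
    \<Rightarrow> ('o, 'm, 'p, 'k, 'x) ftor_scheme \<Rightarrow> ('o, 'm, 'q, 'l) ftor" where
  "comp_functor C G F =
     \<lparr>FOb = (\<lambda>X \<in> Obj C. FOb G (FOb F X)), FAr = (\<lambda>f \<in> Arr C. FAr G (FAr F f))\<rparr>"

record ('f, 'o, 'k) trafo =
  Src :: 'f
  Tgt :: 'f
  Comp :: "'o \<Rightarrow> 'k"

definition natural ::
  "('o, 'm, 'z) cat_scheme \<Rightarrow> ('p, 'k, 'y) cat_scheme
    \<Rightarrow> (('o, 'm, 'p, 'k, 'x) ftor_scheme, 'o, 'k) trafo \<Rightarrow> bool" where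
  "natural C D \<theta> \<longleftrightarrow>
     is_functor C D (Src \<theta>) \<and> is_functor C D (Tgt \<theta>) \<and>
     Comp \<theta> \<in> extensional (Obj C) \<and>
     (\<forall>X \<in> Obj C. Comp \<theta> X \<in> Hom D (FOb (Src \<theta>) X) (FOb (Tgt \<theta>) X)) \<and>
     (\<forall>f \<in> Arr C. Comp \<theta> (Cod C f) \<cdot>\<^bsub>D\<^esub> FAr (Src \<theta>) f = FAr (Tgt \<theta>) f \<cdot>\<^bsub>D\<^esub> Comp \<theta> (Dom C f))"

definition natural_iso ::
  "('o, 'm, 'z) cat_scheme \<Rightarrow> ('p, 'k, 'y) cat_scheme
    \<Rightarrow> (('o, 'm, 'p, 'k, 'x) ftor_scheme, 'o, 'k) trafo \<Rightarrow> bool" where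
  "natural_iso C D \<theta> \<longleftrightarrow> natural C D \<theta> \<and> (\<forall>X \<in> Obj C. iso_arrow D (Comp \<theta> X))"

definition isomorphic_functors ::
  "('o, 'm, 'z) cat_scheme \<Rightarrow> ('p, 'k, 'y) cat_scheme
    \<Rightarrow> ('o, 'm, 'p, 'k) ftor \<Rightarrow> ('o, 'm, 'p, 'k) ftor \<Rightarrow> bool" where
  "isomorphic_functors C D F G \<longleftrightarrow> (\<exists>\<theta>. natural_iso C D \<theta> \<and> Src \<theta> = F \<and> Tgt \<theta> = G)"

definition equivalence_of_cats ::
  "('o, 'm, 'z) cat_scheme \<Rightarrow> ('p, 'k, 'y) cat_scheme \<Rightarrow> ('o, 'm, 'p, 'k) ftor \<Rightarrow> bool" where
  "equivalence_of_cats C D F \<longleftrightarrow> category C \<and> category D \<and> is_functor C D F \<and>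
     (\<exists>G :: ('p, 'k, 'o, 'm) ftor. is_functor D C G \<and>
        isomorphic_functors C C (comp_functor C G F) (id_functor C) \<and>
        isomorphic_functors D D (comp_functor D F G) (id_functor D))"

definition id_trafo :: "('o, 'm, 'z) cat_scheme \<Rightarrow> ('p, 'k, 'y) cat_scheme
    \<Rightarrow> ('o, 'm, 'p, 'k, 'x) ftor_scheme \<Rightarrow> (('o, 'm, 'p, 'k, 'x) ftor_scheme, 'o, 'k) trafo" where
  "id_trafo C D F = \<lparr>Src = F, Tgt = F, Comp = (\<lambda>X \<in> Obj C. Ide D (FOb F X))\<rparr>"

definition vertical_comp :: "('o, 'm, 'z) cat_scheme \<Rightarrow> ('p, 'k, 'y) cat_scheme
    \<Rightarrow> ('f, 'o, 'k) trafo \<Rightarrow> ('f, 'o, 'k) trafo \<Rightarrow> ('f, 'o, 'k) trafo" where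
  "vertical_comp C D \<beta> \<alpha> =
     \<lparr>Src = Src \<alpha>, Tgt = Tgt \<beta>, Comp = (\<lambda>X \<in> Obj C. Comp \<beta> X \<cdot>\<^bsub>D\<^esub> Comp \<alpha> X)\<rparr>"


section \<open>Strict monoidal categories and monoidal functors\<close>

text \<open>The monoidal categories at hand are all strictly associative and unital, so their
  associators and unitors are identities and are omitted. Monoidal functors between them are
  nevertheless not assumed to be strict.\<close>

record ('o, 'm) moncat = "('o, 'm) cat" +
  TOb :: "'o \<Rightarrow> 'o \<Rightarrow> 'o" (infixr "\<odot>\<index>" 65)
  TAr :: "'m \<Rightarrow> 'm \<Rightarrow> 'm" (infixr "\<star>\<index>" 65)
  Unit :: 'o

locale strict_monoidal = category M
  for M :: "('o, 'm, 'z) moncat_scheme" (structure) +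
  assumes unit_in: "Unit M \<in> Obj M"
    and tensor_ob_in: "\<lbrakk>X \<in> Obj M; Y \<in> Obj M\<rbrakk> \<Longrightarrow> X \<odot> Y \<in> Obj M"
    and tensor_in: "\<lbrakk>f \<in> Hom M X X'; g \<in> Hom M Y Y'\<rbrakk> \<Longrightarrow> f \<star> g \<in> Hom M (X \<odot> Y) (X' \<odot> Y')"
    and tensor_ide: "\<lbrakk>X \<in> Obj M; Y \<in> Obj M\<rbrakk> \<Longrightarrow> Ide M X \<star> Ide M Y = Ide M (X \<odot> Y)"
    and interchange: "\<lbrakk>f \<in> Hom M X X'; f' \<in> Hom M X' X''; g \<in> Hom M Y Y'; g' \<in> Hom M Y' Y''\<rbrakk>
      \<Longrightarrow> (f' \<cdot> f) \<star> (g' \<cdot> g) = (f' \<star> g') \<cdot> (f \<star> g)"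
    and tensor_ob_assoc: "\<lbrakk>X \<in> Obj M; Y \<in> Obj M; Z \<in> Obj M\<rbrakk> \<Longrightarrow> (X \<odot> Y) \<odot> Z = X \<odot> (Y \<odot> Z)"
    and tensor_assoc: "\<lbrakk>f \<in> Arr M; g \<in> Arr M; h \<in> Arr M\<rbrakk> \<Longrightarrow> (f \<star> g) \<star> h = f \<star> (g \<star> h)"
    and tensor_ob_unit: "X \<in> Obj M \<Longrightarrow> Unit M \<odot> X = X \<and> X \<odot> Unit M = X"
    and tensor_unit: "f \<in> Arr M \<Longrightarrow> Ide M (Unit M) \<star> f = f \<and> f \<star> Ide M (Unit M) = f"

record ('o, 'm, 'p, 'k) mftor = "('o, 'm, 'p, 'k) ftor" +
  Mu :: "'o \<times> 'o \<Rightarrow> 'k"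
  Eps :: 'k

definition monoidal_functor :: "('o, 'm, 'z) moncat_scheme \<Rightarrow> ('p, 'k, 'y) moncat_scheme
    \<Rightarrow> ('o, 'm, 'p, 'k) mftor \<Rightarrow> bool" where
  "monoidal_functor M N F \<longleftrightarrow> is_functor M N F \<and>
     Mu F \<in> extensional (Obj M \<times> Obj M) \<and>
     (\<forall>X \<in> Obj M. \<forall>Y \<in> Obj M.
        Mu F (X, Y) \<in> Hom N (FOb F X \<odot>\<^bsub>N\<^esub> FOb F Y) (FOb F (X \<odot>\<^bsub>M\<^esub> Y)) \<and> iso_arrow N (Mu F (X, Y))) \<and>
     Eps F \<in> Hom N (Unit N) (FOb F (Unit M)) \<and> iso_arrow N (Eps F) \<and>
     (\<forall>f \<in> Arr M. \<forall>g \<in> Arr M.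
        FAr F (f \<star>\<^bsub>M\<^esub> g) \<cdot>\<^bsub>N\<^esub> Mu F (Dom M f, Dom M g)
          = Mu F (Cod M f, Cod M g) \<cdot>\<^bsub>N\<^esub> (FAr F f \<star>\<^bsub>N\<^esub> FAr F g)) \<and>
     (\<forall>X \<in> Obj M. \<forall>Y \<in> Obj M. \<forall>Z \<in> Obj M.
        Mu F (X \<odot>\<^bsub>M\<^esub> Y, Z) \<cdot>\<^bsub>N\<^esub> (Mu F (X, Y) \<star>\<^bsub>N\<^esub> Ide N (FOb F Z))
          = Mu F (X, Y \<odot>\<^bsub>M\<^esub> Z) \<cdot>\<^bsub>N\<^esub> (Ide N (FOb F X) \<star>\<^bsub>N\<^esub> Mu F (Y, Z))) \<and>
     (\<forall>X \<in> Obj M.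
        Mu F (Unit M, X) \<cdot>\<^bsub>N\<^esub> (Eps F \<star>\<^bsub>N\<^esub> Ide N (FOb F X)) = Ide N (FOb F X) \<and>
        Mu F (X, Unit M) \<cdot>\<^bsub>N\<^esub> (Ide N (FOb F X) \<star>\<^bsub>N\<^esub> Eps F) = Ide N (FOb F X))"

definition monoidal_trafo :: "('o, 'm, 'z) moncat_scheme \<Rightarrow> ('p, 'k, 'y) moncat_scheme
    \<Rightarrow> (('o, 'm, 'p, 'k) mftor, 'o, 'k) trafo \<Rightarrow> bool" where
  "monoidal_trafo M N \<theta> \<longleftrightarrow>
     monoidal_functor M N (Src \<theta>) \<and> monoidal_functor M N (Tgt \<theta>) \<and> natural M N \<theta> \<and>
     (\<forall>X \<in> Obj M. \<forall>Y \<in> Obj M.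
        Comp \<theta> (X \<odot>\<^bsub>M\<^esub> Y) \<cdot>\<^bsub>N\<^esub> Mu (Src \<theta>) (X, Y)
          = Mu (Tgt \<theta>) (X, Y) \<cdot>\<^bsub>N\<^esub> (Comp \<theta> X \<star>\<^bsub>N\<^esub> Comp \<theta> Y)) \<and>
     Comp \<theta> (Unit M) \<cdot>\<^bsub>N\<^esub> Eps (Src \<theta>) = Eps (Tgt \<theta>)"

definition monoidal_functors :: "('o, 'm, 'z) moncat_scheme \<Rightarrow> ('p, 'k, 'y) moncat_scheme
    \<Rightarrow> (('o, 'm, 'p, 'k) mftor, (('o, 'm, 'p, 'k) mftor, 'o, 'k) trafo) cat" where
  "monoidal_functors M N =
     \<lparr>Obj = {F. monoidal_functor M N F}, Arr = {\<theta>. monoidal_trafo M N \<theta>},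
      Dom = Src, Cod = Tgt, Ide = id_trafo M N, Cmp = vertical_comp M N\<rparr>"

definition comp_mftor :: "('o, 'm, 'z) moncat_scheme \<Rightarrow> ('q, 'l, 'x) moncat_scheme
    \<Rightarrow> ('p, 'k, 'q, 'l) mftor \<Rightarrow> ('o, 'm, 'p, 'k) mftor \<Rightarrow> ('o, 'm, 'q, 'l) mftor" where
  "comp_mftor L N F P =
     \<lparr>FOb = (\<lambda>X \<in> Obj L. FOb F (FOb P X)), FAr = (\<lambda>f \<in> Arr L. FAr F (FAr P f)),
      Mu = (\<lambda>(X, Y) \<in> Obj L \<times> Obj L. FAr F (Mu P (X, Y)) \<cdot>\<^bsub>N\<^esub> Mu F (FOb P X, FOb P Y)),
      Eps = FAr F (Eps P) \<cdot>\<^bsub>N\<^esub> Eps F\<rparr>"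

text \<open>Restriction of monoidal functors \<^term>\<open>M\<close> to \<^term>\<open>N\<close> along \<^term>\<open>P\<close>, a monoidal functor
  from \<^term>\<open>L\<close> to \<^term>\<open>M\<close>.\<close>

definition restriction :: "('o, 'm, 'z) moncat_scheme \<Rightarrow> ('p, 'k, 'y) moncat_scheme
    \<Rightarrow> ('q, 'l, 'x) moncat_scheme \<Rightarrow> ('o, 'm, 'p, 'k) mftor
    \<Rightarrow> (('p, 'k, 'q, 'l) mftor, (('p, 'k, 'q, 'l) mftor, 'p, 'l) trafo,
        ('o, 'm, 'q, 'l) mftor, (('o, 'm, 'q, 'l) mftor, 'o, 'l) trafo) ftor" where
  "restriction L M N P =
     \<lparr>FOb = (\<lambda>F \<in> Obj (monoidal_functors M N). comp_mftor L N F P),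
      FAr = (\<lambda>\<theta> \<in> Arr (monoidal_functors M N).
        \<lparr>Src = comp_mftor L N (Src \<theta>) P, Tgt = comp_mftor L N (Tgt \<theta>) P,
         Comp = (\<lambda>X \<in> Obj L. Comp \<theta> (FOb P X))\<rparr>)\<rparr>"


section \<open>Actions on categories\<close>

definition Aut :: "('o, 'm) cat \<Rightarrow>
    (('o, 'm, 'o, 'm) ftor, (('o, 'm, 'o, 'm) ftor, 'o, 'm) trafo) moncat" where
  "Aut C =
     \<lparr>Obj = {F. equivalence_of_cats C C F},
      Arr = {\<theta>. natural_iso C C \<theta> \<and> equivalence_of_cats C C (Src \<theta>) \<and> equivalence_of_cats C C (Tgt \<theta>)},
      Dom = Src, Cod = Tgt, Ide = id_trafo C C, Cmp = vertical_comp C C,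
      TOb = (\<lambda>G F. comp_functor C G F),
      TAr = (\<lambda>\<beta> \<alpha>. \<lparr>Src = comp_functor C (Src \<beta>) (Src \<alpha>), Tgt = comp_functor C (Tgt \<beta>) (Tgt \<alpha>),
         Comp = (\<lambda>X \<in> Obj C. Comp \<beta> (FOb (Tgt \<alpha>) X) \<cdot>\<^bsub>C\<^esub> FAr (Src \<beta>) (Comp \<alpha> X))\<rparr>),
      Unit = id_functor C\<rparr>"

text \<open>The arrow \<^term>\<open>g\<close> of \<open>Omega G\<close> is the identity of the object \<^term>\<open>g\<close>.\<close>

definition Omega :: "('g, 'z) monoid_scheme \<Rightarrow> ('g, 'g) moncat" where
  "Omega G =
     \<lparr>Obj = carrier G, Arr = carrier G, Dom = (\<lambda>g. g), Cod = (\<lambda>g. g), Ide = (\<lambda>g. g),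
      Cmp = (\<lambda>h g. g), TOb = mult G, TAr = mult G, Unit = one G\<rparr>"

text \<open>The category of actions of a monoidal category on \<^term>\<open>C\<close>; its morphisms are the monoidal
  natural transformations.\<close>

abbreviation actions :: "('p, 'k, 'z) moncat_scheme \<Rightarrow> ('o, 'm) cat
    \<Rightarrow> (('p, 'k, ('o, 'm, 'o, 'm) ftor, (('o, 'm, 'o, 'm) ftor, 'o, 'm) trafo) mftor,
        (('p, 'k, ('o, 'm, 'o, 'm) ftor, (('o, 'm, 'o, 'm) ftor, 'o, 'm) trafo) mftor,
         'p, (('o, 'm, 'o, 'm) ftor, 'o, 'm) trafo) trafo) cat" where
  "actions M C \<equiv> monoidal_functors M (Aut C)"

abbreviation strict_actions :: "('g, 'z) monoid_scheme \<Rightarrow> ('o, 'm) cat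
    \<Rightarrow> (('g, 'g, ('o, 'm, 'o, 'm) ftor, (('o, 'm, 'o, 'm) ftor, 'o, 'm) trafo) mftor,
        (('g, 'g, ('o, 'm, 'o, 'm) ftor, (('o, 'm, 'o, 'm) ftor, 'o, 'm) trafo) mftor,
         'g, (('o, 'm, 'o, 'm) ftor, 'o, 'm) trafo) trafo) cat" where
  "strict_actions G C \<equiv> actions (Omega G) C"


section \<open>Braid words and the Artin braid group\<close>

text \<open>\<open>Pos i\<close> and \<open>Neg i\<close> are the letters $\sigma_i$ and $\sigma_i^{-1}$.\<close>

datatype letter = Pos nat | Neg nat

type_synonym word = "letter list"

fun index :: "letter \<Rightarrow> nat" where
  "index (Pos i) = i"
| "index (Neg i) = i"

fun bar :: "letter \<Rightarrow> letter" where
  "bar (Pos i) = Neg i"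
| "bar (Neg i) = Pos i"

definition bar_word :: "word \<Rightarrow> word" where
  "bar_word w = rev (map bar w)"

definition letters :: "nat \<Rightarrow> letter set" where
  "letters n = {x. index x \<in> {1..<n}}"

definition distant :: "nat \<Rightarrow> nat \<Rightarrow> bool" where
  "distant i j \<longleftrightarrow> \<bar>int i - int j\<bar> \<ge> 2"

definition adjacent :: "nat \<Rightarrow> nat \<Rightarrow> bool" where
  "adjacent i j \<longleftrightarrow> \<bar>int i - int j\<bar> = 1"

inductive braid_equiv :: "nat \<Rightarrow> word \<Rightarrow> word \<Rightarrow> bool" for n where
  refl: "w \<in> lists (letters n) \<Longrightarrow> braid_equiv n w w"
| sym: "braid_equiv n v w \<Longrightarrow> braid_equiv n w v"
| trans: "\<lbrakk>braid_equiv n u v; braid_equiv n v w\<rbrakk> \<Longrightarrow> braid_equiv n u w"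
| inverse: "\<lbrakk>a \<in> lists (letters n); b \<in> lists (letters n); x \<in> letters n\<rbrakk>
    \<Longrightarrow> braid_equiv n (a @ [x, bar x] @ b) (a @ b)"
| commutation: "\<lbrakk>a \<in> lists (letters n); b \<in> lists (letters n); i \<in> {1..<n}; j \<in> {1..<n}; distant i j\<rbrakk>
    \<Longrightarrow> braid_equiv n (a @ [Pos i, Pos j] @ b) (a @ [Pos j, Pos i] @ b)"
| braid: "\<lbrakk>a \<in> lists (letters n); b \<in> lists (letters n); i \<in> {1..<n}; j \<in> {1..<n}; adjacent i j\<rbrakk>
    \<Longrightarrow> braid_equiv n (a @ [Pos i, Pos j, Pos i] @ b) (a @ [Pos j, Pos i, Pos j] @ b)"

definition braid_class :: "nat \<Rightarrow> word \<Rightarrow> word set" where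
  "braid_class n w = {v. braid_equiv n w v}"

definition braid_group :: "nat \<Rightarrow> word set monoid" where
  "braid_group n =
     \<lparr>carrier = braid_class n ` lists (letters n),
      mult = (\<lambda>A B. \<Union>a \<in> A. \<Union>b \<in> B. braid_class n (a @ b)),
      one = braid_class n []\<rparr>"


section \<open>Movies\<close>

datatype move =
    Create letter
  | Cancel letter
  | Exch nat nat
  | RIII nat nat

fun move_src :: "move \<Rightarrow> word" where
  "move_src (Create x) = []"
| "move_src (Cancel x) = [x, bar x]"
| "move_src (Exch i j) = [Pos i, Pos j]"
| "move_src (RIII i j) = [Pos i, Pos j, Pos i]"

fun move_tgt :: "move \<Rightarrow> word" where
  "move_tgt (Create x) = [x, bar x]"
| "move_tgt (Cancel x) = []"
| "move_tgt (Exch i j) = [Pos j, Pos i]"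
| "move_tgt (RIII i j) = [Pos j, Pos i, Pos j]"

fun valid_move :: "nat \<Rightarrow> move \<Rightarrow> bool" where
  "valid_move n (Create x) \<longleftrightarrow> x \<in> letters n"
| "valid_move n (Cancel x) \<longleftrightarrow> x \<in> letters n"
| "valid_move n (Exch i j) \<longleftrightarrow> i \<in> {1..<n} \<and> j \<in> {1..<n} \<and> distant i j"
| "valid_move n (RIII i j) \<longleftrightarrow> i \<in> {1..<n} \<and> j \<in> {1..<n} \<and> adjacent i j"

fun braid_move :: "move \<Rightarrow> bool" where
  "braid_move (Create x) \<longleftrightarrow> False"
| "braid_move (Cancel x) \<longleftrightarrow> False"
| "braid_move (Exch i j) \<longleftrightarrow> True"
| "braid_move (RIII i j) \<longleftrightarrow> True"

text \<open>The step \<open>(a, m, b)\<close> applies the move \<open>m\<close> between the words \<open>a\<close> and \<open>b\<close>.\<close>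

type_synonym step = "word \<times> move \<times> word"

text \<open>\<open>movie n u p v\<close>: the list of steps \<open>p\<close>, in order of application, is a movie
  from \<open>u\<close> to \<open>v\<close>.\<close>

fun movie :: "nat \<Rightarrow> word \<Rightarrow> step list \<Rightarrow> word \<Rightarrow> bool" where
  "movie n u [] v \<longleftrightarrow> u \<in> lists (letters n) \<and> v = u"
| "movie n u ((a, m, b) # p) v \<longleftrightarrow>
     a \<in> lists (letters n) \<and> b \<in> lists (letters n) \<and> valid_move n m \<and>
     u = a @ move_src m @ b \<and> movie n (a @ move_tgt m @ b) p v"

definition whisker :: "word \<Rightarrow> step list \<Rightarrow> word \<Rightarrow> step list" where
  "whisker a p b = map (\<lambda>(c, m, d). (a @ c, m, d @ b)) p"

text \<open>Nested creations from the empty word to \<open>u @ bar_word u\<close>, and nested cancellations back.\<close>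

fun creations :: "word \<Rightarrow> step list" where
  "creations [] = []"
| "creations (x # u) = ([], Create x, []) # whisker [x] (creations u) [bar x]"

fun cancellations :: "word \<Rightarrow> step list" where
  "cancellations [] = []"
| "cancellations (x # u) = whisker [x] (cancellations u) [bar x] @ [([], Cancel x, [])]"

text \<open>The two mates of a move from \<open>u\<close> to \<open>v\<close>, as movies from \<open>bar_word v\<close> to \<open>bar_word u\<close>.\<close>

definition right_mate :: "move \<Rightarrow> step list" where
  "right_mate m = (let u' = bar_word (move_src m); v' = bar_word (move_tgt m) in
     whisker v' (creations (move_src m)) [] @ [(v', m, u')] @ whisker [] (cancellations v') u')"

definition left_mate :: "move \<Rightarrow> step list" where
  "left_mate m = (let u' = bar_word (move_src m); v' = bar_word (move_tgt m) in
     whisker [] (creations u') v' @ [(u', m, v')] @ whisker u' (cancellations (move_tgt m)) [])"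


section \<open>Zamolodzhikov loops\<close>

definition simple_refl :: "nat \<Rightarrow> nat \<Rightarrow> nat" where
  "simple_refl i = transpose i (Suc i)"

definition perm_of_word :: "word \<Rightarrow> nat \<Rightarrow> nat" where
  "perm_of_word w = foldr (\<lambda>x f. simple_refl (index x) \<circ> f) w id"

definition parabolic :: "nat \<Rightarrow> nat set \<Rightarrow> (nat \<Rightarrow> nat) set" where
  "parabolic n J = generate (sym_group n) (simple_refl ` J)"

text \<open>Positive words, which stand for words in the simple reflections.\<close>

definition expression :: "nat \<Rightarrow> word \<Rightarrow> (nat \<Rightarrow> nat) \<Rightarrow> bool" where
  "expression n u w \<longleftrightarrow> u \<in> lists (Pos ` {1..<n}) \<and> perm_of_word u = w"

definition coxeter_length :: "nat \<Rightarrow> (nat \<Rightarrow> nat) \<Rightarrow> nat" where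
  "coxeter_length n w = (LEAST k. \<exists>u. expression n u w \<and> length u = k)"

definition reduced_expression :: "nat \<Rightarrow> word \<Rightarrow> (nat \<Rightarrow> nat) \<Rightarrow> bool" where
  "reduced_expression n u w \<longleftrightarrow> expression n u w \<and> length u = coxeter_length n w"

definition longest :: "nat \<Rightarrow> nat set \<Rightarrow> (nat \<Rightarrow> nat) \<Rightarrow> bool" where
  "longest n I w \<longleftrightarrow> w \<in> parabolic n I \<and>
     (\<forall>v \<in> parabolic n I. coxeter_length n v \<le> coxeter_length n w)"

text \<open>The coset crossed by a step; only meaningful for the braid moves.\<close>

fun crossed_coset :: "nat \<Rightarrow> step \<Rightarrow> (nat \<Rightarrow> nat) set" where
  "crossed_coset n (a, Exch i j, b) = perm_of_word a <#\<^bsub>sym_group n\<^esub> parabolic n {i, j}"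
| "crossed_coset n (a, RIII i j, b) = perm_of_word a <#\<^bsub>sym_group n\<^esub> parabolic n {i, j}"
| "crossed_coset n (a, m, b) = {}"

definition rank2_cosets :: "nat \<Rightarrow> nat set \<Rightarrow> (nat \<Rightarrow> nat) set set" where
  "rank2_cosets n I =
     {y <#\<^bsub>sym_group n\<^esub> parabolic n J | y J. y \<in> parabolic n I \<and> J \<subseteq> I \<and> card J = 2}"

definition zamolodzhikov_loop :: "nat \<Rightarrow> nat set \<Rightarrow> step list \<Rightarrow> bool" where
  "zamolodzhikov_loop n I p \<longleftrightarrow>
     (\<exists>w u. longest n I w \<and> reduced_expression n u w \<and> movie n u p u) \<and>
     (\<forall>(a, m, b) \<in> set p. braid_move m) \<and>
     (\<forall>K \<in> rank2_cosets n I. count_list (map (crossed_coset n) p) K = 1)"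


section \<open>The invertible braid cobordism category\<close>

inductive movie_move :: "nat \<Rightarrow> step list \<Rightarrow> step list \<Rightarrow> bool" for n where
  disjoint: "movie_move n
      [([], m, c @ move_src m'), (move_tgt m @ c, m', [])]
      [(move_src m @ c, m', []), ([], m, c @ move_tgt m')]"
| create_cancel: "movie_move n [([], Create x, []), ([], Cancel x, [])] []"
| cancel_create: "movie_move n [([], Cancel x, []), ([], Create x, [])] []"
| exch_exch: "movie_move n [([], Exch i j, []), ([], Exch j i, [])] []"
| RIII_RIII: "movie_move n [([], RIII i j, []), ([], RIII j i, [])] []"
| zigzag_left: "movie_move n [([], Create x, [x]), ([x], Cancel (bar x), [])] []"
| zigzag_right: "movie_move n [([x], Create (bar x), []), ([], Cancel x, [x])] []"
| cyclicity: "braid_move m \<Longrightarrow> movie_move n (left_mate m) (right_mate m)"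
| zamolodzhikov: "\<lbrakk>I \<subseteq> {1..<n}; card I = 3; zamolodzhikov_loop n I p\<rbrakk> \<Longrightarrow> movie_move n p []"

text \<open>Equality of movies from \<open>u\<close> to \<open>v\<close>. Since both sides of each step are required to be movies,
  an empty side of a movie move stands for the identity movie of the right word.\<close>

inductive movie_equiv :: "nat \<Rightarrow> word \<Rightarrow> word \<Rightarrow> step list \<Rightarrow> step list \<Rightarrow> bool" for n u v where
  refl: "movie n u p v \<Longrightarrow> movie_equiv n u v p p"
| sym: "movie_equiv n u v p q \<Longrightarrow> movie_equiv n u v q p"
| trans: "\<lbrakk>movie_equiv n u v p q; movie_equiv n u v q r\<rbrakk> \<Longrightarrow> movie_equiv n u v p r"
| move: "\<lbrakk>movie_move n r r'; movie n u (p @ whisker a r b @ q) v; movie n u (p @ whisker a r' b @ q) v\<rbrakk>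
    \<Longrightarrow> movie_equiv n u v (p @ whisker a r b @ q) (p @ whisker a r' b @ q)"

text \<open>An arrow from \<open>u\<close> to \<open>v\<close> is a triple consisting of \<open>u\<close>, a class of movies, and \<open>v\<close>.\<close>

type_synonym cobordism = "word \<times> step list set \<times> word"

definition movie_class :: "nat \<Rightarrow> word \<Rightarrow> step list \<Rightarrow> word \<Rightarrow> cobordism" where
  "movie_class n u p v = (u, {q. movie_equiv n u v p q}, v)"

definition braid_cob :: "nat \<Rightarrow> (word, cobordism) moncat" where
  "braid_cob n =
     \<lparr>Obj = lists (letters n),
      Arr = {movie_class n u p v | u p v. movie n u p v},
      Dom = (\<lambda>(u, P, v). u), Cod = (\<lambda>(u, P, v). v),
      Ide = (\<lambda>u. movie_class n u [] u),
      Cmp = (\<lambda>(v', Q, w) (u, P, v).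
        (u, {r. \<exists>p \<in> P. \<exists>q \<in> Q. movie_equiv n u w (p @ q) r}, w)),
      TOb = (@),
      TAr = (\<lambda>(u, P, u') (v, Q, v').
        (u @ v, {r. \<exists>p \<in> P. \<exists>q \<in> Q.
           movie_equiv n (u @ v) (u' @ v') (whisker [] p v @ whisker u' q []) r}, u' @ v')),
      Unit = []\<rparr>"

text \<open>The canonical strict monoidal functor, sending a word to the braid it expresses.\<close>

definition projection :: "nat \<Rightarrow> (word, cobordism, word set, word set) mftor" where
  "projection n =
     \<lparr>FOb = (\<lambda>w \<in> Obj (braid_cob n). braid_class n w),
      FAr = (\<lambda>f \<in> Arr (braid_cob n). braid_class n (Dom (braid_cob n) f)),
      Mu = (\<lambda>(u, v) \<in> Obj (braid_cob n) \<times> Obj (braid_cob n). braid_class n (u @ v)),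
      Eps = braid_class n []\<rparr>"

end

theory Submission
  imports Defs
begin

text \<open>
  The projection from the braid cobordism category to \<open>Omega B\<close>, with \<open>B\<close> the braid group, is an
  equivalence of monoidal categories, and this is why the two kinds of actions agree. Every braid is
  expressed by a word, two words are joined by a movie exactly when they express the same braid
  (\<open>braid_equiv_iff_movie\<close>), and any two movies with the same source and target are equal
  (\<open>coherence\<close>). Choosing a word for every braid gives a monoidal quasi-inverse \<open>lift\<close>. Restriction
  along a monoidal functor is functorial (\<open>functor_restriction\<close>), restriction along \<open>lift\<close> is inverse to
  restriction along the projection up to the canonical movies from a word to the chosen word of its
  braid (\<open>restriction_equivalence\<close>), and the target \<^term>\<open>Aut C\<close> of an action is a strict monoidal
  category (\<open>strict_monoidal_Aut\<close>).

  The heart of the matter is coherence. It is proved first for positive words and movies made of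
  distant exchanges and Reidemeister III moves. By Garside's lemma a positive word divisible on the
  left by \<open>\<sigma>\<^sub>i\<close> and \<open>\<sigma>\<^sub>j\<close> is divisible by their least common multiple, so that every movie from \<open>\<sigma>\<^sub>iA\<close> to \<open>\<sigma>\<^sub>jB\<close> may
  be compared with a standard one: rewrite \<open>A\<close>, replace the first letter by a single move, rewrite the
  rest. By induction on the length of words, standard movies with given ends are equal
  (\<open>std_unique\<close>). They compose to standard movies: if three letters divide a word, then
  so does the longest element of the parabolic subgroup that they generate, and the Zamolodzhikov loop
  through its reduced expressions, which passes through the three first letters once each, says that
  three standard movies around a triangle compose to the identity (\<open>triangle_loop\<close>). For this the
  loops have to be exhibited; the coset \<open>yW\<^sub>J\<close> crossed by a step omits one index \<open>k\<close> and is determined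
  by \<open>k\<close> and the image of \<open>{..k}\<close> under \<open>y\<close> (\<open>coset_eq_iff\<close>), which makes the crossings countable.

  To pass from positive words to all words, let words act partially on positive words from the left,
  where \<open>\<sigma>\<^sub>i\<^sup>-\<^sup>1\<close> is defined on the multiples of \<open>\<sigma>\<^sub>i\<close> and removes this letter. The action of \<open>w\<close> on \<open>V\<close> comes
  with a movie from \<open>wV\<close> to a positive word (\<open>canon\<close>), and by positive coherence these movies are
  compatible with every move (\<open>canon_step\<close>). The full twist is central and divisible by every letter,
  so that a high power \<open>V\<close> of it lies in the domain of all words that occur in two given parallel
  movies \<open>p\<close> and \<open>q\<close>. Therefore \<open>pV\<close> and \<open>qV\<close> are equal, and \<open>V\<close> may be cancelled because words are
  invertible objects.
\<close>

section \<open>Divisibility in positive braid monoids\<close>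

lemma distant_sym: "distant i j \<Longrightarrow> distant j i"
  by (auto simp: distant_def)

lemma adjacent_sym: "adjacent i j \<Longrightarrow> adjacent j i"
  by (auto simp: adjacent_def)

lemma distant_irrefl [simp]: "\<not> distant i i"
  by (auto simp: distant_def)

lemma adjacent_irrefl [simp]: "\<not> adjacent i i"
  by (auto simp: adjacent_def)

lemma adjacent_not_distant: "adjacent i j \<Longrightarrow> \<not> distant i j"
  by (auto simp: distant_def adjacent_def)

lemma adjacent_if_not_distant: "i \<noteq> j \<Longrightarrow> \<not> distant i j \<Longrightarrow> adjacent i j"
  by (auto simp: distant_def adjacent_def)

text \<open>Positive words are lists of indices without an upper bound. The relations preserve the set of
  letters, so that no bound on the number of strands has to be carried along.\<close>

inductive artin_step :: "nat list \<Rightarrow> nat list \<Rightarrow> bool" where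
  comm: "distant i j \<Longrightarrow> artin_step (i # j # A) (j # i # A)"
| braid: "adjacent i j \<Longrightarrow> artin_step (i # j # i # A) (j # i # j # A)"
| cons: "artin_step A B \<Longrightarrow> artin_step (x # A) (x # B)"

definition artin :: "nat list \<Rightarrow> nat list \<Rightarrow> bool" (infix "\<approx>" 50) where
  "artin = artin_step\<^sup>*\<^sup>*"

lemma artin_step_sym: "artin_step A B \<Longrightarrow> artin_step B A"
  by (induction rule: artin_step.induct) (auto intro: artin_step.intros distant_sym adjacent_sym)

lemma artin_refl [simp, intro]: "A \<approx> A"
  by (simp add: artin_def)

lemma artin_sym: "A \<approx> B \<Longrightarrow> B \<approx> A"
  unfolding artin_def by (rule sympD [OF symp_rtranclp]) (auto intro: sympI artin_step_sym)

lemma artin_trans [trans]: "A \<approx> B \<Longrightarrow> B \<approx> C \<Longrightarrow> A \<approx> C"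
  by (simp add: artin_def)

lemma artin_cons: "A \<approx> B \<Longrightarrow> x # A \<approx> x # B"
  unfolding artin_def by (induction rule: rtranclp_induct) (auto intro: artin_step.cons rtranclp.rtrancl_into_rtrancl)

lemma artin_prepend: "A \<approx> B \<Longrightarrow> C @ A \<approx> C @ B"
  by (induction C) (auto intro: artin_cons)

lemma artin_step_append: "artin_step A B \<Longrightarrow> artin_step (A @ C) (B @ C)"
  by (induction rule: artin_step.induct) (auto intro: artin_step.intros)

lemma artin_append1: "A \<approx> B \<Longrightarrow> A @ C \<approx> B @ C"
  unfolding artin_def by (induction rule: rtranclp_induct) (auto intro: artin_step_append rtranclp.rtrancl_into_rtrancl)

lemma artin_cons_trans: "A \<approx> x # B \<Longrightarrow> B \<approx> C \<Longrightarrow> A \<approx> x # C"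
  by (rule artin_trans [OF _ artin_cons])

lemma artin_cons2_trans: "A \<approx> x # y # B \<Longrightarrow> B \<approx> C \<Longrightarrow> A \<approx> x # y # C"
  by (rule artin_trans [OF _ artin_cons [OF artin_cons]])

lemma artin_comm: "distant i j \<Longrightarrow> i # j # A \<approx> j # i # A"
  by (auto simp: artin_def intro: artin_step.comm)

lemma artin_braid: "adjacent i j \<Longrightarrow> i # j # i # A \<approx> j # i # j # A"
  by (auto simp: artin_def intro: artin_step.braid)

lemma artin_step_length: "artin_step A B \<Longrightarrow> length A = length B \<and> set A = set B"
  by (induction rule: artin_step.induct) auto

lemma artin_length: "A \<approx> B \<Longrightarrow> length A = length B"
  unfolding artin_def by (induction rule: rtranclp_induct) (auto dest: artin_step_length)

lemma artin_set: "A \<approx> B \<Longrightarrow> set A = set B"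
  unfolding artin_def by (induction rule: rtranclp_induct) (auto dest: artin_step_length)

text \<open>The right complement: \<open>i # res i j\<close> is the least common multiple of the letters \<open>i\<close> and \<open>j\<close>, written
  with \<open>i\<close> in front.\<close>

definition res :: "nat \<Rightarrow> nat \<Rightarrow> nat list" where
  "res i j = (if i = j then [] else if distant i j then [j] else [j, i])"

lemma res_same [simp]: "res i i = []"
  by (simp add: res_def)

lemma res_distant: "distant i j \<Longrightarrow> res i j = [j] \<and> res j i = [i]"
  by (auto simp: res_def distant_sym)

lemma res_adjacent: "adjacent i j \<Longrightarrow> res i j = [j, i] \<and> res j i = [i, j]"
  using adjacent_not_distant adjacent_sym by (auto simp: res_def)

definition lcm_factor :: "nat \<Rightarrow> nat list \<Rightarrow> nat \<Rightarrow> nat list \<Rightarrow> bool" where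
  "lcm_factor i A j B \<longleftrightarrow> (\<exists>C. A \<approx> res i j @ C \<and> B \<approx> res j i @ C)"

lemma lcm_factor_sym: "lcm_factor i A j B \<Longrightarrow> lcm_factor j B i A"
  by (auto simp: lcm_factor_def)

lemma lcm_factor_same: "lcm_factor i A i B \<longleftrightarrow> A \<approx> B"
  by (auto simp: lcm_factor_def intro: artin_trans artin_sym)

definition garside_at :: "nat \<Rightarrow> bool" where
  "garside_at l \<longleftrightarrow> (\<forall>i A j B. length A < l \<longrightarrow> i # A \<approx> j # B \<longrightarrow> lcm_factor i A j B)"

context
  fixes l assumes g: "garside_at l"
begin

lemma ga: "i # A \<approx> j # B \<Longrightarrow> length A < l \<Longrightarrow> lcm_factor i A j B"
  using g unfolding garside_at_def by blast

lemma ga_cancel: "i # A \<approx> i # B \<Longrightarrow> length A < l \<Longrightarrow> A \<approx> B"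
  using ga lcm_factor_same by blast

lemma ga_distant: "i # A \<approx> j # B \<Longrightarrow> distant i j \<Longrightarrow> length A < l \<Longrightarrow> \<exists>C. A \<approx> j # C \<and> B \<approx> i # C"
  using ga [of i A j B] by (simp add: lcm_factor_def res_distant)

lemma ga_adjacent: "i # A \<approx> j # B \<Longrightarrow> adjacent i j \<Longrightarrow> length A < l \<Longrightarrow> \<exists>C. A \<approx> j # i # C \<and> B \<approx> i # j # C"
  using ga [of i A j B] by (simp add: lcm_factor_def res_adjacent)

lemma ga_cancel_list: "X @ A \<approx> X @ B \<Longrightarrow> length (X @ A) \<le> l \<Longrightarrow> A \<approx> B"
  by (induction X) (auto dest: ga_cancel)

text \<open>In the following lemmas a word \<open>B\<close> has two factorizations. They are what remains, after removal of a
  letter \<open>j\<close>, of the divisibility of \<open>j # B\<close> by the least common multiples of \<open>j\<close> with \<open>i\<close> and of \<open>j\<close>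
  with \<open>k\<close>. Repeated use of Garside's lemma for shorter words shows that \<open>j # B\<close> is divisible by the
  least common multiple of all three letters. There is one lemma for each position of \<open>j\<close> in each
  Coxeter graph on three vertices, up to exchanging \<open>i\<close> and \<open>k\<close>.\<close>

lemma cube_distant:
  assumes "B \<approx> i # C" "B \<approx> k # E" "distant i k" "length B \<le> l"
  shows "\<exists>F. C \<approx> k # F \<and> E \<approx> i # F"
proof -
  have "i # C \<approx> k # E" by (rule artin_trans [OF artin_sym [OF assms(1)] assms(2)])
  moreover have "length C < l" using artin_length [OF assms(1)] assms(4) by simp
  ultimately show ?thesis using ga_distant assms(3) by blast
qed

lemma cube_adjacent:
  assumes "B \<approx> i # C" "B \<approx> k # E" "adjacent i k" "length B \<le> l"
  shows "\<exists>F. C \<approx> k # i # F \<and> E \<approx> i # k # F"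
proof -
  have "i # C \<approx> k # E" by (rule artin_trans [OF artin_sym [OF assms(1)] assms(2)])
  moreover have "length C < l" using artin_length [OF assms(1)] assms(4) by simp
  ultimately show ?thesis using ga_adjacent assms(3) by blast
qed

lemma cube_prism:
  assumes "B \<approx> i # j # C" "B \<approx> k # E" "adjacent i j" "distant i k" "distant j k" "length B \<le> l"
  shows "\<exists>F. C \<approx> k # F \<and> E \<approx> i # j # F"
proof -
  obtain G where G: "j # C \<approx> k # G" "E \<approx> i # G" using cube_distant [OF assms(1,2,4,6)] by blast
  have "length C < l" using artin_length [OF assms(1)] assms(6) by simp
  then obtain F where F: "C \<approx> k # F" "G \<approx> j # F" using ga_distant [OF G(1) assms(5)] by blast
  show ?thesis using F(1) artin_cons_trans [OF G(2) F(2)] by blast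
qed

lemma cube_path_middle:
  assumes "B \<approx> i # j # C" "B \<approx> k # j # E" "adjacent i j" "adjacent j k" "distant i k" "length B \<le> l"
  shows "\<exists>F. C \<approx> k # j # i # F \<and> E \<approx> i # j # k # F"
proof -
  have l: "Suc (Suc (length C)) \<le> l" "Suc (Suc (length E)) \<le> l" using artin_length [OF assms(1)] artin_length [OF assms(2)] assms(6) by auto
  obtain G where G: "j # C \<approx> k # G" "j # E \<approx> i # G" using cube_distant [OF assms(1,2,5,6)] by blast
  obtain H where H: "C \<approx> k # j # H" "G \<approx> j # k # H" using ga_adjacent [OF G(1) assms(4)] l by auto
  obtain K where K: "E \<approx> i # j # K" "G \<approx> j # i # K" using ga_adjacent [OF G(2)] assms(3) adjacent_sym l by fastforce
  have *: "length C = length H + 2" using artin_length [OF H(1)] by simp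
  have "j # k # H \<approx> j # i # K" by (rule artin_trans [OF artin_sym [OF H(2)] K(2)])
  then have "k # H \<approx> i # K" by (rule ga_cancel) (use * l in auto)
  then obtain F where F: "H \<approx> i # F" "K \<approx> k # F" using ga_distant [of k H i K] assms(5) distant_sym * l by auto
  show ?thesis using artin_cons2_trans [OF H(1) F(1)] artin_cons2_trans [OF K(1) F(2)] by blast
qed

lemma cube_path_end:
  assumes "B \<approx> i # j # C" "B \<approx> k # E" "adjacent i j" "adjacent i k" "distant j k" "length B \<le> l"
  shows "\<exists>F. C \<approx> k # i # j # F \<and> E \<approx> i # j # k # i # F"
proof -
  have l: "Suc (Suc (length C)) \<le> l" "Suc (length E) \<le> l" using artin_length [OF assms(1)] artin_length [OF assms(2)] assms(6) by auto
  obtain G where G: "j # C \<approx> k # i # G" "E \<approx> i # k # G" using cube_adjacent [OF assms(1,2,4,6)] by blast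
  obtain H where H: "C \<approx> k # H" "i # G \<approx> j # H" using ga_distant [OF G(1) assms(5)] l by auto
  have *: "length G = length H" "length C = Suc (length H)" using artin_length [OF H(1)] artin_length [OF H(2)] by auto
  obtain K where K: "G \<approx> j # i # K" "H \<approx> i # j # K" using ga_adjacent [OF H(2) assms(3)] * l by auto
  have "E \<approx> i # k # j # i # K" using artin_cons2_trans [OF G(2) K(1)] .
  also have "i # k # j # i # K \<approx> i # j # k # i # K" by (intro artin_cons artin_comm distant_sym [OF assms(5)])
  finally show ?thesis using artin_cons_trans [OF H(1) K(2)] by blast
qed

end

lemma lcm_factor_distantI: "distant i j \<Longrightarrow> A \<approx> j # C \<Longrightarrow> B \<approx> i # C \<Longrightarrow> lcm_factor i A j B"
  by (auto simp: lcm_factor_def res_distant)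

lemma lcm_factor_adjacentI: "adjacent i j \<Longrightarrow> A \<approx> j # i # C \<Longrightarrow> B \<approx> i # j # C \<Longrightarrow> lcm_factor i A j B"
  by (auto simp: lcm_factor_def res_adjacent)

lemma lcm_factor_cong: "lcm_factor i A j B \<Longrightarrow> A \<approx> A' \<Longrightarrow> B \<approx> B' \<Longrightarrow> lcm_factor i A' j B'"
  unfolding lcm_factor_def using artin_trans [OF artin_sym] by blast

text \<open>The word in the middle is a multiple of the least common multiple of \<open>i\<close>, \<open>j\<close> and \<open>k\<close>, by the cube
  lemmas. The rest of the proof rewrites this multiple so that the least common multiple of \<open>i\<close> and \<open>k\<close>
  comes first. The last hypothesis leaves one case of each pair that is exchanged by reading the
  chain backwards.\<close>

lemma lcm_factor_trans_distinct:
  assumes g: "garside_at l" and lB: "length B \<le> l" and AB: "lcm_factor i A j B" and BD: "lcm_factor j B k D"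
    and distinct: "i \<noteq> j" "j \<noteq> k" "i \<noteq> k" and wlog: "adjacent i j \<or> \<not> adjacent j k"
  shows "lcm_factor i A k D"
proof -
  obtain C where C: "A \<approx> res i j @ C" "B \<approx> res j i @ C" using AB by (auto simp: lcm_factor_def)
  obtain E where E: "B \<approx> res j k @ E" "D \<approx> res k j @ E" using BD by (auto simp: lcm_factor_def)
  have "\<not> (adjacent i j \<and> adjacent j k \<and> adjacent i k)"
    by (auto simp: adjacent_def)
  then consider "distant i j" "distant j k" "distant i k" | "distant i j" "distant j k" "adjacent i k"
    | "adjacent i j" "distant j k" "distant i k" | "adjacent i j" "adjacent j k" "distant i k"
    | "adjacent i j" "distant j k" "adjacent i k"
    using wlog distinct adjacent_if_not_distant by metis
  then show ?thesis
  proof cases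
    case 1
    note [simp] = 1 [THEN res_distant, THEN conjunct1] 1 [THEN res_distant, THEN conjunct2]
    obtain F where F: "C \<approx> k # F" "E \<approx> i # F" using cube_distant [OF g, of B i C k E] C E 1 lB by auto
    have "A \<approx> j # k # F" by (rule artin_cons_trans [OF _ F(1)]) (use C in simp)
    also have "j # k # F \<approx> k # j # F" by (intro artin_comm 1)
    finally have A: "A \<approx> k # j # F" .
    have "D \<approx> j # i # F" by (rule artin_cons_trans [OF _ F(2)]) (use E in simp)
    also have "j # i # F \<approx> i # j # F" by (intro artin_comm 1(1) [THEN distant_sym])
    finally show ?thesis by (rule lcm_factor_distantI [OF 1(3) A])
  next
    case 2
    note [simp] = 2(1,2) [THEN res_distant, THEN conjunct1] 2(1,2) [THEN res_distant, THEN conjunct2]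
    obtain F where F: "C \<approx> k # i # F" "E \<approx> i # k # F" using cube_adjacent [OF g, of B i C k E] C E 2 lB by auto
    have "A \<approx> j # k # i # F" by (rule artin_cons_trans [OF _ F(1)]) (use C in simp)
    also have "\<dots> \<approx> k # j # i # F" by (intro artin_comm 2)
    also have "\<dots> \<approx> k # i # j # F" by (intro artin_cons artin_comm 2(1) [THEN distant_sym])
    finally have A: "A \<approx> k # i # j # F" .
    have "D \<approx> j # i # k # F" by (rule artin_cons_trans [OF _ F(2)]) (use E in simp)
    also have "\<dots> \<approx> i # j # k # F" by (intro artin_comm 2(1) [THEN distant_sym])
    also have "\<dots> \<approx> i # k # j # F" by (intro artin_cons artin_comm 2)
    finally show ?thesis by (rule lcm_factor_adjacentI [OF 2(3) A])
  next
    case 3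
    note [simp] = 3(2,3) [THEN res_distant, THEN conjunct1] 3(2,3) [THEN res_distant, THEN conjunct2]
      3(1) [THEN res_adjacent, THEN conjunct1] 3(1) [THEN res_adjacent, THEN conjunct2]
    obtain F where F: "C \<approx> k # F" "E \<approx> i # j # F" using cube_prism [OF g, of B i j C k E] C E 3 lB by auto
    have "A \<approx> j # i # k # F" by (rule artin_cons2_trans [OF _ F(1)]) (use C in simp)
    also have "\<dots> \<approx> j # k # i # F" by (intro artin_cons artin_comm 3)
    also have "\<dots> \<approx> k # j # i # F" by (intro artin_comm 3)
    finally have A: "A \<approx> k # j # i # F" .
    have "D \<approx> j # i # j # F" by (rule artin_cons_trans [OF _ F(2)]) (use E in simp)
    also have "\<dots> \<approx> i # j # i # F" by (intro artin_braid 3(1) [THEN adjacent_sym])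
    finally show ?thesis by (rule lcm_factor_distantI [OF 3(3) A])
  next
    case 4
    note [simp] = 4(1,2) [THEN res_adjacent, THEN conjunct1] 4(1,2) [THEN res_adjacent, THEN conjunct2]
    obtain F where F: "C \<approx> k # j # i # F" "E \<approx> i # j # k # F" using cube_path_middle [OF g, of B i j C k E] C E 4 lB by auto
    have "A \<approx> j # i # k # j # i # F" by (rule artin_cons2_trans [OF _ F(1)]) (use C in simp)
    also have "\<dots> \<approx> j # k # i # j # i # F" by (intro artin_cons artin_comm 4)
    also have "\<dots> \<approx> j # k # j # i # j # F" by (intro artin_cons artin_braid 4)
    also have "\<dots> \<approx> k # j # k # i # j # F" by (intro artin_braid 4)
    finally have A: "A \<approx> k # j # k # i # j # F" .
    have "D \<approx> j # k # i # j # k # F" by (rule artin_cons2_trans [OF _ F(2)]) (use E in simp)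
    also have "\<dots> \<approx> j # i # k # j # k # F" by (intro artin_cons artin_comm 4(3) [THEN distant_sym])
    also have "\<dots> \<approx> j # i # j # k # j # F" by (intro artin_cons artin_braid 4(2) [THEN adjacent_sym])
    also have "\<dots> \<approx> i # j # i # k # j # F" by (intro artin_braid 4(1) [THEN adjacent_sym])
    also have "\<dots> \<approx> i # j # k # i # j # F" by (intro artin_cons artin_comm 4)
    finally show ?thesis by (rule lcm_factor_distantI [OF 4(3) A])
  next
    case 5
    note [simp] = 5(2) [THEN res_distant, THEN conjunct1] 5(2) [THEN res_distant, THEN conjunct2]
      5(1,3) [THEN res_adjacent, THEN conjunct1] 5(1,3) [THEN res_adjacent, THEN conjunct2]
    obtain F where F: "C \<approx> k # i # j # F" "E \<approx> i # j # k # i # F" using cube_path_end [OF g, of B i j C k E] C E 5 lB by auto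
    have "A \<approx> j # i # k # i # j # F" by (rule artin_cons2_trans [OF _ F(1)]) (use C in simp)
    also have "\<dots> \<approx> j # k # i # k # j # F" by (intro artin_cons artin_braid 5)
    also have "\<dots> \<approx> k # j # i # k # j # F" by (intro artin_comm 5)
    also have "\<dots> \<approx> k # j # i # j # k # F" by (intro artin_cons artin_comm 5(2) [THEN distant_sym])
    also have "\<dots> \<approx> k # i # j # i # k # F" by (intro artin_cons artin_braid 5(1) [THEN adjacent_sym])
    finally have A: "A \<approx> k # i # j # i # k # F" .
    have "D \<approx> j # i # j # k # i # F" by (rule artin_cons_trans [OF _ F(2)]) (use E in simp)
    also have "\<dots> \<approx> i # j # i # k # i # F" by (intro artin_braid 5(1) [THEN adjacent_sym])
    also have "\<dots> \<approx> i # j # k # i # k # F" by (intro artin_cons artin_braid 5)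
    also have "\<dots> \<approx> i # k # j # i # k # F" by (intro artin_cons artin_comm 5)
    finally show ?thesis by (rule lcm_factor_adjacentI [OF 5(3) A])
  qed
qed

lemma lcm_factor_trans:
  assumes g: "garside_at l" and lB: "length B \<le> l" and AB: "lcm_factor i A j B" and BD: "lcm_factor j B k D"
  shows "lcm_factor i A k D"
proof -
  consider "i = j" | "j = k" | "i = k" "i \<noteq> j" | "i \<noteq> j" "j \<noteq> k" "i \<noteq> k" by blast
  then show ?thesis
  proof cases
    case 1
    then show ?thesis using AB BD lcm_factor_same lcm_factor_cong artin_sym by blast
  next
    case 2
    then show ?thesis using AB BD lcm_factor_same lcm_factor_cong by blast
  next
    case 3
    obtain C where C: "A \<approx> res i j @ C" "B \<approx> res j i @ C" using AB by (auto simp: lcm_factor_def)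
    obtain E where E: "B \<approx> res j i @ E" "D \<approx> res i j @ E" using BD 3 by (auto simp: lcm_factor_def)
    have "C \<approx> E"
      by (rule ga_cancel_list [OF g artin_trans [OF artin_sym [OF C(2)] E(1)]]) (use artin_length [OF C(2)] lB in simp)
    then have "A \<approx> D" using C(1) E(2) by (meson artin_prepend artin_sym artin_trans)
    then show ?thesis using 3 lcm_factor_same by simp
  next
    case 4
    show ?thesis
    proof (cases "adjacent i j \<or> \<not> adjacent j k")
      case True
      then show ?thesis using lcm_factor_trans_distinct [OF g lB AB BD] 4 by blast
    next
      case False
      then have "lcm_factor k D i A"
        using lcm_factor_trans_distinct [OF g lB BD [THEN lcm_factor_sym] AB [THEN lcm_factor_sym]] 4 adjacent_sym by blast
      then show ?thesis by (rule lcm_factor_sym)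
    qed
  qed
qed

lemma lcm_factor_step: "artin_step (i # A) (j # B) \<Longrightarrow> lcm_factor i A j B"
proof (erule artin_step.cases)
  fix A' B' x assume "i # A = x # A'" "j # B = x # B'" "artin_step A' B'"
  then show ?thesis by (auto simp: lcm_factor_same artin_def)
next
  fix i' j' A' assume "i # A = i' # j' # A'" "j # B = j' # i' # A'" "distant i' j'"
  then show ?thesis using lcm_factor_distantI by blast
next
  fix i' j' A' assume "i # A = i' # j' # i' # A'" "j # B = j' # i' # j' # A'" "adjacent i' j'"
  then show ?thesis using lcm_factor_adjacentI by blast
qed

text \<open>A single step is covered by the definition of the relations, and the composition of two changes of the
  first letter uses words of smaller length only.\<close>

lemma garside_at: "garside_at l"
proof (induction l)
  case 0
  show ?case by (simp add: garside_at_def)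
next
  case (Suc l)
  have *: "length A = l \<Longrightarrow> \<forall>j B. w = j # B \<longrightarrow> lcm_factor i A j B" if "i # A \<approx> w" for i A w
    using that unfolding artin_def
  proof (induction rule: rtranclp_induct)
    case base
    then show ?case by (auto simp: lcm_factor_same)
  next
    case (step v w)
    show ?case
    proof (intro allI impI)
      fix k D assume w: "w = k # D"
      have len: "length v = Suc l" using step artin_length [of "i # A" v] by (simp add: artin_def)
      then obtain j B where v: "v = j # B" by (cases v) auto
      show "lcm_factor i A k D"
        by (rule lcm_factor_trans [OF Suc.IH, of B _ _ j]) (use step v w len lcm_factor_step in auto)
    qed
  qed
  show ?case unfolding garside_at_def
  proof (intro allI impI)
    fix i A j B assume l: "length A < Suc l" and eq: "i # A \<approx> j # B"
    show "lcm_factor i A j B"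
      using l * [OF eq] ga [OF Suc.IH eq] by (cases "length A = l") auto
  qed
qed

text \<open>Any two divisors \<open>i\<close> and \<open>j\<close> of a word are part of its divisor \<open>i # res i j\<close>; for \<open>i = j\<close> this is left
  cancellation. The proof runs along a chain of elementary steps, in which the first letter changes
  only where a defining relation is applied at the front, and composes the changes by transitivity.\<close>

theorem garside: "i # A \<approx> j # B \<Longrightarrow> \<exists>C. A \<approx> res i j @ C \<and> B \<approx> res j i @ C"
  using ga [OF garside_at _ lessI] unfolding lcm_factor_def .

lemma artin_cancel: "i # A \<approx> i # B \<Longrightarrow> A \<approx> B"
  by (rule ga_cancel [OF garside_at _ lessI])

lemma artin_cancel_list: "X @ A \<approx> X @ B \<Longrightarrow> A \<approx> B"
  by (induction X) (auto dest: artin_cancel)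

text \<open>A word divisible by three letters is divisible by the longest element of the parabolic subgroup
  that they generate. The three cases are those of the types \<open>A\<^sub>1 \<times> A\<^sub>1 \<times> A\<^sub>1\<close>, \<open>A\<^sub>1 \<times> A\<^sub>2\<close> and \<open>A\<^sub>3\<close>.\<close>

lemma cube_word:
  assumes "i # A \<approx> j # B" "j # B \<approx> k # D" "distant i j" "distant j k" "distant i k"
  shows "\<exists>F. i # A \<approx> [i, j, k] @ F"
proof -
  obtain C where C: "A \<approx> j # C" "B \<approx> i # C"
    using garside [OF assms(1)] res_distant [OF assms(3)] by auto
  obtain E where E: "B \<approx> k # E" "D \<approx> j # E"
    using garside [OF assms(2)] res_distant [OF assms(4)] by auto
  obtain F where "C \<approx> k # F" using cube_distant [OF garside_at C(2) E(1) assms(5) order.refl] by blast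
  then show ?thesis using artin_cons [OF artin_cons_trans [OF C(1)], where x = i] by auto
qed

lemma prism_word:
  assumes "i # A \<approx> j # B" "j # B \<approx> k # D" "adjacent i j" "distant j k" "distant i k"
  shows "\<exists>F. i # A \<approx> [i, j, i, k] @ F"
proof -
  have "i # A \<approx> k # D" by (rule artin_trans [OF assms(1,2)])
  then obtain E where E: "A \<approx> k # E"
    using garside [of i A k D] res_distant [OF assms(5)] by auto
  obtain C where C: "A \<approx> j # i # C"
    using garside [OF assms(1)] res_adjacent [OF assms(3)] by auto
  obtain F where "C \<approx> k # F"
    using cube_prism [OF garside_at C E adjacent_sym [OF assms(3)] assms(4,5) order.refl] by blast
  then show ?thesis using artin_cons [OF artin_cons2_trans [OF C], where x = i] by auto
qed

lemma permutohedron_word: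
  assumes "i # A \<approx> j # B" "j # B \<approx> k # D" "adjacent i j" "adjacent j k" "distant i k"
  shows "\<exists>F. i # A \<approx> [i, j, i, k, j, i] @ F"
proof -
  obtain C where C: "A \<approx> j # i # C" "B \<approx> i # j # C"
    using garside [OF assms(1)] res_adjacent [OF assms(3)] by auto
  obtain E where E: "B \<approx> k # j # E" "D \<approx> j # k # E"
    using garside [OF assms(2)] res_adjacent [OF assms(4)] by auto
  obtain F where "C \<approx> k # j # i # F"
    using cube_path_middle [OF garside_at C(2) E(1) assms(3,4,5) order.refl] by blast
  then show ?thesis using artin_cons [OF artin_cons2_trans [OF C(1)], where x = i] by auto
qed

text \<open>A Coxeter element of the braid group on \<open>m + 1\<close> strands; moving a letter across it raises the index
  by one.\<close>

fun descending :: "nat \<Rightarrow> nat list" where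
  "descending 0 = []"
| "descending (Suc m) = Suc m # descending m"

lemma set_descending: "set (descending m) = {1..m}"
  by (induction m) auto

lemma descending_commute: "Suc m < i \<Longrightarrow> i # descending m @ A \<approx> descending m @ i # A"
proof (induction m)
  case (Suc m)
  have "i # descending (Suc m) @ A \<approx> Suc m # i # descending m @ A"
    using Suc.prems by (auto intro!: artin_comm simp: distant_def)
  also have "\<dots> \<approx> Suc m # descending m @ i # A"
    using Suc by (auto intro: artin_cons)
  finally show ?case by simp
qed auto

lemma descending_shift: "1 \<le> i \<Longrightarrow> i < m \<Longrightarrow> i # descending m @ A \<approx> descending m @ Suc i # A"
proof (induction m)
  case (Suc m)
  show ?case
  proof (cases "i = m")
    case False
    then have "i # descending (Suc m) @ A \<approx> Suc m # i # descending m @ A"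
      using Suc.prems by (auto intro!: artin_comm simp: distant_def)
    also have "\<dots> \<approx> Suc m # descending m @ Suc i # A"
      using Suc False by (auto intro: artin_cons)
    finally show ?thesis by simp
  next
    case True
    then obtain k where m: "m = Suc k" using Suc.prems by (cases m) auto
    have "m # descending (Suc m) @ A \<approx> Suc m # m # Suc m # descending k @ A"
      by (auto simp: m adjacent_def intro: artin_braid)
    also have "\<dots> \<approx> Suc m # m # descending k @ Suc m # A"
      by (intro artin_cons descending_commute) (simp add: m)
    finally show ?thesis using True by (simp add: m)
  qed
qed auto

lemma descending_shift_list:
  "\<forall>i \<in> set X. 1 \<le> i \<and> i < m \<Longrightarrow> X @ descending m @ A \<approx> descending m @ map Suc X @ A"
proof (induction X)
  case (Cons i X)
  have "(i # X) @ descending m @ A \<approx> i # descending m @ map Suc X @ A"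
    using Cons by (auto intro: artin_cons)
  also have "\<dots> \<approx> descending m @ Suc i # map Suc X @ A"
    using Cons.prems by (intro descending_shift) auto
  finally show ?case by simp
qed auto

lemma map_Suc_descending: "map Suc (descending m) @ [1] = descending (Suc m)"
  by (induction m) auto

text \<open>The largest letter cannot be raised further. It passes through two copies of the Coxeter element
  and comes out as the smallest letter: the letters of the first copy after its first one, moved through
  the second copy, form together with a final \<open>1\<close> another copy.\<close>

lemma descending_twice: "Suc m # descending (Suc m) @ descending (Suc m) @ A \<approx> descending (Suc m) @ descending (Suc m) @ 1 # A"
proof -
  have "descending m @ descending (Suc m) @ 1 # A \<approx> descending (Suc m) @ map Suc (descending m) @ 1 # A"
    by (rule descending_shift_list) (auto simp: set_descending)
  also have "\<dots> = descending (Suc m) @ descending (Suc m) @ A"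
    using map_Suc_descending [of m] by (metis append_Cons append_Nil append_assoc)
  finally show ?thesis by (auto intro: artin_cons artin_sym)
qed

primrec iterate :: "nat \<Rightarrow> nat list \<Rightarrow> nat list" where
  "iterate 0 D = []"
| "iterate (Suc k) D = D @ iterate k D"

lemma iterate_add: "iterate (j + k) D = iterate j D @ iterate k D"
  by (induction j) auto

lemma set_iterate: "set (iterate k D) \<subseteq> set D"
  by (induction k) auto

lemma iterate_descending_shift: "1 \<le> i \<Longrightarrow> i + k \<le> m \<Longrightarrow> i # iterate k (descending m) @ A \<approx> iterate k (descending m) @ (i + k) # A"
proof (induction k arbitrary: i)
  case (Suc k)
  have "i # iterate (Suc k) (descending m) @ A \<approx> descending m @ Suc i # iterate k (descending m) @ A"
    using descending_shift [of i m "iterate k (descending m) @ A"] Suc.prems by simp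
  also have "\<dots> \<approx> descending m @ iterate k (descending m) @ (Suc i + k) # A"
    using Suc.IH [of "Suc i"] Suc.prems by (intro artin_prepend) simp
  finally show ?case by simp
qed auto

definition full_twist :: "nat \<Rightarrow> nat list" where
  "full_twist m = iterate (Suc m) (descending m)"

lemma set_full_twist: "set (full_twist m) \<subseteq> {1..m}"
  unfolding full_twist_def using set_iterate set_descending by blast

text \<open>A letter \<open>i\<close> is raised to \<open>m\<close> by \<open>m - i\<close> copies of the Coxeter element, becomes \<open>1\<close> after two more, and
  is raised to \<open>i\<close> again by \<open>i - 1\<close> copies. These are \<open>m + 1\<close> copies altogether.\<close>

lemma full_twist_central: "i \<in> {1..m} \<Longrightarrow> i # full_twist m @ A \<approx> full_twist m @ i # A"
proof -
  assume i: "i \<in> {1..m}"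
  define D where "D = descending m"
  have eq: "full_twist m = iterate (m - i) D @ D @ D @ iterate (i - 1) D"
  proof -
    have "Suc m = (m - i) + Suc (Suc (i - 1))" using i by auto
    then show ?thesis unfolding full_twist_def D_def [symmetric] by (simp only: iterate_add iterate.simps)
  qed
  have "i # full_twist m @ A \<approx> iterate (m - i) D @ m # D @ D @ iterate (i - 1) D @ A"
    using iterate_descending_shift [of i "m - i" m "D @ D @ iterate (i - 1) D @ A"] i by (simp add: eq D_def)
  also have "\<dots> \<approx> iterate (m - i) D @ D @ D @ 1 # iterate (i - 1) D @ A"
    using descending_twice [of "m - 1" "iterate (i - 1) D @ A"] i
    by (cases m) (auto simp: D_def simp del: descending.simps intro!: artin_prepend)
  also have "\<dots> \<approx> iterate (m - i) D @ D @ D @ iterate (i - 1) D @ i # A"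
    using iterate_descending_shift [of 1 "i - 1" m A] i by (intro artin_prepend) (auto simp: D_def)
  finally show ?thesis by (simp add: eq)
qed

lemma full_twist_central_list: "set X \<subseteq> {1..m} \<Longrightarrow> X @ full_twist m @ A \<approx> full_twist m @ X @ A"
proof (induction X)
  case (Cons i X)
  have "(i # X) @ full_twist m @ A \<approx> i # full_twist m @ X @ A"
    using Cons by (auto intro: artin_cons)
  also have "\<dots> \<approx> full_twist m @ i # X @ A"
    using Cons.prems by (intro full_twist_central) auto
  finally show ?case by simp
qed auto

text \<open>The Coxeter element starts with \<open>m\<close>. Read from right to left, the first \<open>m - i\<close> copies turn
  this letter of the next copy into an \<open>i\<close> at the front.\<close>

lemma full_twist_divisible: "i \<in> {1..m} \<Longrightarrow> \<exists>Z. set Z \<subseteq> {1..m} \<and> full_twist m \<approx> i # Z"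
proof -
  assume i: "i \<in> {1..m}"
  define D where "D = descending m"
  have D: "D = m # descending (m - 1)" using i by (cases m) (auto simp: D_def)
  have eq: "full_twist m = iterate (m - i) D @ m # descending (m - 1) @ iterate i D"
    using iterate_add [of "m - i" "Suc i" D] i D by (simp add: full_twist_def D_def)
  also have "\<dots> \<approx> i # iterate (m - i) D @ descending (m - 1) @ iterate i D"
    using iterate_descending_shift [of i "m - i" m "descending (m - 1) @ iterate i D"] i
    by (auto simp: D_def intro: artin_sym)
  finally show ?thesis
    using set_full_twist [of m] by (metis artin_set set_subset_Cons subset_trans)
qed

section \<open>Calculus of movies\<close>

abbreviation words :: "nat \<Rightarrow> word set" where
  "words n \<equiv> lists (letters n)"

lemma index_bar [simp]: "index (bar x) = index x"
  by (cases x) auto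

lemma movie_ends: "movie n u p v \<Longrightarrow> u \<in> words n \<and> v \<in> words n"
proof (induction n u p v rule: movie.induct)
  case (2 n u a m b p v)
  then show ?case by (cases m) (auto simp: letters_def split: letter.splits)
qed auto

lemma bar_bar [simp]: "bar (bar x) = x"
  by (cases x) auto

lemma bar_letters [simp]: "bar x \<in> letters n \<longleftrightarrow> x \<in> letters n"
  by (cases x) (auto simp: letters_def)

lemma movie_append: "movie n u (p @ q) w \<longleftrightarrow> (\<exists>v. movie n u p v \<and> movie n v q w)"
  by (induction n u p w rule: movie.induct) (auto dest: movie_ends)

lemma movie_unique_end: "movie n u p v \<Longrightarrow> movie n u p v' \<Longrightarrow> v = v'"
  by (induction n u p v rule: movie.induct) auto

lemma whisker_append [simp]: "whisker a (p @ q) b = whisker a p b @ whisker a q b"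
  by (simp add: whisker_def)

lemma whisker_Nil [simp]: "whisker a [] b = []"
  by (simp add: whisker_def)

lemma whisker_Cons [simp]: "whisker a ((c, m, d) # p) b = (a @ c, m, d @ b) # whisker a p b"
  by (simp add: whisker_def)

lemma whisker_whisker [simp]: "whisker a (whisker c p d) b = whisker (a @ c) p (d @ b)"
  by (auto simp: whisker_def)

lemma whisker_empty [simp]: "whisker [] p [] = p"
  by (induction p) (auto simp: whisker_def)

lemma movie_whisker: "movie n u p v \<Longrightarrow> a \<in> words n \<Longrightarrow> b \<in> words n \<Longrightarrow> movie n (a @ u @ b) (whisker a p b) (a @ v @ b)"
  by (induction n u p v rule: movie.induct) auto

lemmas movie_whisker_left = movie_whisker [where b = "[]", simplified]
  and movie_whisker_right = movie_whisker [where a = "[]", simplified]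

lemma movie_step: "movie n (a @ move_src m @ b) [(a, m, b)] (a @ move_tgt m @ b)
   \<longleftrightarrow> a \<in> words n \<and> b \<in> words n \<and> valid_move n m"
proof -
  have "valid_move n m \<Longrightarrow> move_tgt m \<in> words n"
    by (cases m) (auto simp: letters_def)
  then show ?thesis by auto
qed

lemma equiv_movie: "movie_equiv n u v p q \<Longrightarrow> movie n u p v \<and> movie n u q v"
  by (induction rule: movie_equiv.induct) auto

lemma equiv_append1: "movie_equiv n v w p q \<Longrightarrow> movie n u r v \<Longrightarrow> movie_equiv n u w (r @ p) (r @ q)"
proof (induction rule: movie_equiv.induct)
  case (move r0 r' p a b q)
  have "movie_equiv n u w ((r @ p) @ whisker a r0 b @ q) ((r @ p) @ whisker a r' b @ q)"
    by (rule movie_equiv.move) (use move in \<open>auto simp: movie_append\<close>)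
  then show ?case by simp
next
  case (refl p)
  then show ?case by (auto simp: movie_append intro!: movie_equiv.refl)
qed (auto intro: movie_equiv.sym movie_equiv.trans)

lemma equiv_append2: "movie_equiv n u v p q \<Longrightarrow> movie n v r w \<Longrightarrow> movie_equiv n u w (p @ r) (q @ r)"
proof (induction rule: movie_equiv.induct)
  case (move r0 r' p a b q)
  have "movie_equiv n u w (p @ whisker a r0 b @ (q @ r)) (p @ whisker a r' b @ (q @ r))"
    by (rule movie_equiv.move) (use move in \<open>auto simp: movie_append\<close>)
  then show ?case by simp
next
  case (refl p)
  then show ?case by (auto simp: movie_append intro!: movie_equiv.refl)
qed (auto intro: movie_equiv.sym movie_equiv.trans)

lemma equiv_whisker:
  assumes "movie_equiv n u v p q" "a \<in> words n" "b \<in> words n"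
  shows "movie_equiv n (a @ u @ b) (a @ v @ b) (whisker a p b) (whisker a q b)"
  using assms
proof (induction rule: movie_equiv.induct)
  case (move r r' p c d q)
  have "movie_equiv n (a @ u @ b) (a @ v @ b)
    (whisker a p b @ whisker (a @ c) r (d @ b) @ whisker a q b)
    (whisker a p b @ whisker (a @ c) r' (d @ b) @ whisker a q b)"
    by (rule movie_equiv.move [OF move(1)])
       (use move(2-5) movie_whisker [OF move(2)] movie_whisker [OF move(3)] in auto)
  then show ?case by simp
qed (auto intro: movie_equiv.refl movie_equiv.sym movie_equiv.trans movie_whisker)

lemma equiv_moveI:
  assumes "movie_move n r r'" "movie n u (whisker a r b) v" "movie n u (whisker a r' b) v"
  shows "movie_equiv n u v (whisker a r b) (whisker a r' b)"
  using movie_equiv.move [of n r r' u "[]" a b "[]" v] assms by simp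

lemma equiv_conj:
  assumes "movie_equiv n u v p p'" "movie_equiv n u v p q" "movie_equiv n u v q q'"
  shows "movie_equiv n u v p' q'"
  by (rule movie_equiv.trans [OF movie_equiv.sym [OF assms(1)] movie_equiv.trans [OF assms(2,3)]])

fun inv_move :: "move \<Rightarrow> move" where
  "inv_move (Create x) = Cancel x"
| "inv_move (Cancel x) = Create x"
| "inv_move (Exch i j) = Exch j i"
| "inv_move (RIII i j) = RIII j i"

lemma inv_move_simps [simp]:
  "move_src (inv_move m) = move_tgt m" "move_tgt (inv_move m) = move_src m"
  "inv_move (inv_move m) = m" "braid_move (inv_move m) = braid_move m"
  "valid_move n (inv_move m) = valid_move n m"
  by (cases m; auto intro: distant_sym adjacent_sym)+

definition inv_movie :: "step list \<Rightarrow> step list" where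
  "inv_movie p = rev (map (\<lambda>(a, m, b). (a, inv_move m, b)) p)"

lemma inv_movie_simps [simp]:
  "inv_movie [] = []" "inv_movie ((a, m, b) # p) = inv_movie p @ [(a, inv_move m, b)]"
  "inv_movie (p @ q) = inv_movie q @ inv_movie p"
  by (auto simp: inv_movie_def)

lemma inv_movie_inv_movie [simp]: "inv_movie (inv_movie p) = p"
  by (induction p) auto

lemma inv_movie_whisker: "inv_movie (whisker a p b) = whisker a (inv_movie p) b"
  by (induction p) auto

lemma movie_inv: "movie n u p v \<Longrightarrow> movie n v (inv_movie p) u"
proof (induction n u p v rule: movie.induct)
  case (2 n u a m b p v)
  then have "movie n v (inv_movie p) (a @ move_tgt m @ b)" "u = a @ move_src m @ b" by auto
  moreover have "movie n (a @ move_tgt m @ b) [(a, inv_move m, b)] (a @ move_src m @ b)"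
    using movie_step [of n a "inv_move m" b] 2 by simp
  ultimately show ?case by (auto simp: movie_append simp del: movie.simps(2))
qed auto

lemma move_inverse: "movie_move n [([], m, []), ([], inv_move m, [])] []"
  by (cases m) (auto intro: movie_move.intros)

lemma equiv_inv_right: "movie n u p v \<Longrightarrow> movie_equiv n u u (p @ inv_movie p) []"
proof (induction n u p v rule: movie.induct)
  case (2 n u a m b p v)
  let ?s = "[(a, m, b)]" and ?s' = "[(a, inv_move m, b)]" and ?w = "a @ move_tgt m @ b"
  have w: "a \<in> words n" "b \<in> words n" "valid_move n m" and u: "u = a @ move_src m @ b" and p: "movie n ?w p v"
    using 2 by auto
  have s: "movie n u ?s ?w" "movie n ?w ?s' u"
    using movie_step [of n a m b] movie_step [of n a "inv_move m" b] w u by auto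
  have "movie_equiv n ?w ?w (p @ inv_movie p) []"
    using 2 p by blast
  then have "movie_equiv n u u (?s @ (p @ inv_movie p) @ ?s') (?s @ [] @ ?s')"
    by (intro equiv_append1 [OF equiv_append2]) (use s in auto)
  moreover have "movie_equiv n u u (?s @ [] @ ?s') []"
    using equiv_moveI [OF move_inverse [of n m], of u a b u] s movie_append [of n u ?s ?s' u] movie_ends [OF s(1)]
    by auto
  ultimately show ?case by (auto intro: movie_equiv.trans)
qed (auto intro: movie_equiv.refl)

lemma equiv_inv_left: "movie n u p v \<Longrightarrow> movie_equiv n v v (inv_movie p @ p) []"
  using equiv_inv_right [OF movie_inv] by fastforce

lemma equiv_cancel_left:
  assumes "movie_equiv n u w (r @ p) (r @ q)" "movie n u r v"
  shows "movie_equiv n v w p q"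
proof -
  have 1: "movie n v p w" "movie n v q w"
    using equiv_movie [OF assms(1)] assms(2) by (auto simp: movie_append dest: movie_unique_end)
  have 2: "movie_equiv n v w ((inv_movie r @ r) @ p') p'" if "movie n v p' w" for p'
    using equiv_append2 [OF equiv_inv_left [OF assms(2)] that] by simp
  have "movie_equiv n v w ((inv_movie r @ r) @ p) ((inv_movie r @ r) @ q)"
    using equiv_append1 [OF assms(1) movie_inv [OF assms(2)]] by simp
  then show ?thesis by (rule equiv_conj [OF 2 [OF 1(1)] _ 2 [OF 1(2)]])
qed

lemma equiv_cancel_right:
  assumes "movie_equiv n u w (p @ r) (q @ r)" "movie n v r w"
    "movie n u p v" "movie n u q v"
  shows "movie_equiv n u v p q"
proof -
  have 2: "movie_equiv n u v (p' @ (r @ inv_movie r)) p'" if "movie n u p' v" for p'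
    using equiv_append1 [OF equiv_inv_right [OF assms(2)] that] by simp
  have "movie_equiv n u v (p @ r @ inv_movie r) (q @ r @ inv_movie r)"
    using equiv_append2 [OF assms(1) movie_inv [OF assms(2)]] by simp
  then show ?thesis by (intro equiv_conj [OF 2 [OF assms(3)] _ 2 [OF assms(4)]]) simp
qed

lemma equiv_inv:
  assumes "movie_equiv n u v p q"
  shows "movie_equiv n v u (inv_movie p) (inv_movie q)"
proof -
  have p: "movie n u p v" and q: "movie n u q v" using equiv_movie [OF assms] by auto
  have "movie_equiv n u u (p @ inv_movie p) (q @ inv_movie q)"
    by (rule movie_equiv.trans [OF equiv_inv_right [OF p] movie_equiv.sym [OF equiv_inv_right [OF q]]])
  moreover have "movie_equiv n u u (q @ inv_movie q) (p @ inv_movie q)"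
    by (rule equiv_append2 [OF movie_equiv.sym [OF assms] movie_inv [OF q]])
  ultimately show ?thesis by (rule equiv_cancel_left [OF movie_equiv.trans p])
qed

lemma interchange_steps:
  assumes "a \<in> words n" "b \<in> words n" "c \<in> words n" "d \<in> words n" "valid_move n m" "valid_move n m'"
  shows "movie_equiv n (a @ move_src m @ b @ c @ move_src m' @ d) (a @ move_tgt m @ b @ c @ move_tgt m' @ d)
    [(a, m, b @ c @ move_src m' @ d), (a @ move_tgt m @ b @ c, m', d)]
    [(a @ move_src m @ b @ c, m', d), (a, m, b @ c @ move_tgt m' @ d)]"
proof -
  have "move_src m \<in> words n" "move_tgt m \<in> words n" "move_src m' \<in> words n" "move_tgt m' \<in> words n"
    using assms(5,6) by (cases m; cases m'; auto simp: letters_def)+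
  then show ?thesis
    using equiv_moveI [OF movie_move.disjoint [of n m "b @ c" m'], of
        "a @ move_src m @ b @ c @ move_src m' @ d" a d "a @ move_tgt m @ b @ c @ move_tgt m' @ d"] assms
    by auto
qed

lemma interchange_step_movie:
  assumes "movie n v q v'" "a \<in> words n" "b \<in> words n" "valid_move n m"
  shows "movie_equiv n (a @ move_src m @ b @ v) (a @ move_tgt m @ b @ v')
    ([(a, m, b @ v)] @ whisker (a @ move_tgt m @ b) q [])
    (whisker (a @ move_src m @ b) q [] @ [(a, m, b @ v')])"
  using assms
proof (induction n v q v' rule: movie.induct)
  case (1 n v v')
  then show ?case using movie_step [of n a m "b @ v"] by (auto intro!: movie_equiv.refl)
next
  case (2 n v c m' d q v')
  let ?s = "a @ move_src m @ b" and ?t = "a @ move_tgt m @ b"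
  have w: "c \<in> words n" "d \<in> words n" "valid_move n m'" and v: "v = c @ move_src m' @ d" and q: "movie n (c @ move_tgt m' @ d) q v'"
    using 2 by auto
  have W: "move_src m \<in> words n" "move_tgt m \<in> words n" using \<open>valid_move n m\<close>
    by (cases m; auto simp: letters_def)+
  have 1: "movie_equiv n (?s @ v) (?t @ v')
     ([(a, m, b @ c @ move_src m' @ d), (a @ move_tgt m @ b @ c, m', d)] @ whisker ?t q [])
     ([(a @ move_src m @ b @ c, m', d), (a, m, b @ c @ move_tgt m' @ d)] @ whisker ?t q [])"
    using equiv_append2 [OF interchange_steps [of a n b c d m m'], of "whisker ?t q []" "?t @ v'"]
      movie_whisker_left [OF q, of ?t] 2(3-5) w v W by simp
  have 2: "movie_equiv n (?s @ v) (?t @ v')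
     ([(a @ move_src m @ b @ c, m', d)] @ [(a, m, b @ c @ move_tgt m' @ d)] @ whisker ?t q [])
     ([(a @ move_src m @ b @ c, m', d)] @ whisker ?s q [] @ [(a, m, b @ v')])"
  proof (rule equiv_append1)
    show "movie_equiv n (?s @ c @ move_tgt m' @ d) (?t @ v')
      ([(a, m, b @ c @ move_tgt m' @ d)] @ whisker ?t q []) (whisker ?s q [] @ [(a, m, b @ v')])"
      using 2(1) [OF q 2(3-5)] by simp
    show "movie n (?s @ v) [(a @ move_src m @ b @ c, m', d)] (?s @ c @ move_tgt m' @ d)"
      using movie_step [of n "?s @ c" m' d] w 2(3-5) v W by simp
  qed
  show ?case using movie_equiv.trans [OF 1] 2 v by simp
qed

text \<open>Moves on disjoint subwords commute, and hence so do movies on the two factors of a concatenation.\<close>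

lemma movie_interchange:
  assumes "movie n u p u'" "movie n v q v'"
  shows "movie_equiv n (u @ v) (u' @ v') (whisker [] p v @ whisker u' q []) (whisker u q [] @ whisker [] p v')"
  using assms
proof (induction n u p u' rule: movie.induct)
  case (1 n u u')
  then show ?case using movie_whisker_left [of n v q v' u] by (auto intro!: movie_equiv.refl)
next
  case (2 n u a m b p u')
  let ?w = "a @ move_tgt m @ b"
  have w: "a \<in> words n" "b \<in> words n" "valid_move n m" and u: "u = a @ move_src m @ b" and p: "movie n ?w p u'"
    using 2 by auto
  have 3: "movie n (u @ v) [(a, m, b @ v)] (?w @ v)"
    using movie_step [of n a m "b @ v"] w u movie_ends [OF 2(3)] by simp
  have 1: "movie_equiv n (u @ v) (u' @ v')
     ([(a, m, b @ v)] @ whisker [] p v @ whisker u' q []) ([(a, m, b @ v)] @ whisker ?w q [] @ whisker [] p v')"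
    by (rule equiv_append1 [OF _ 3]) (use 2 p in simp)
  have 2: "movie_equiv n (u @ v) (u' @ v')
     (([(a, m, b @ v)] @ whisker ?w q []) @ whisker [] p v') ((whisker u q [] @ [(a, m, b @ v')]) @ whisker [] p v')"
    by (rule equiv_append2 [OF _ movie_whisker_right [OF p]])
       (use interchange_step_movie [OF 2(3) w(1,2,3)] movie_ends [OF 2(3)] u in simp_all)
  show ?case using movie_equiv.trans [OF 1] 2 by simp
qed

text \<open>A letter \<open>x\<close> on the right is removed by appending its inverse and sliding the creation of \<open>x\<close> with its
  inverse from one end of the movie to the other.\<close>

lemma equiv_whisker_right_cancel1:
  assumes p: "movie n u p v" and q: "movie n u q v" and x: "x \<in> letters n"
    and eq: "movie_equiv n (u @ [x]) (v @ [x]) (whisker [] p [x]) (whisker [] q [x])"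
  shows "movie_equiv n u v p q"
proof -
  let ?c = "[([], Create x, [])]" and ?X = "[x, bar x]"
  have c: "movie n [] ?c ?X" using x by simp
  have N: "movie_equiv n u (v @ ?X) (p @ whisker v ?c []) (whisker u ?c [] @ whisker [] p ?X)"
    if "movie n u p v" for p
    using movie_interchange [OF that c] by simp
  have "movie_equiv n (u @ ?X) (v @ ?X) (whisker [] p ?X) (whisker [] q ?X)"
    using equiv_whisker [OF eq, of "[]" "[bar x]"] x by simp
  moreover have cu: "movie n u (whisker u ?c []) (u @ ?X)" and cv: "movie n v (whisker v ?c []) (v @ ?X)"
    using movie_whisker_left [OF c, of u] movie_whisker_left [OF c, of v] movie_ends [OF p] by simp_all
  ultimately have "movie_equiv n u (v @ ?X) (whisker u ?c [] @ whisker [] p ?X) (whisker u ?c [] @ whisker [] q ?X)"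
    by (intro equiv_append1)
  then have "movie_equiv n u (v @ ?X) (p @ whisker v ?c []) (q @ whisker v ?c [])"
    by (rule equiv_conj [OF N [OF p, THEN movie_equiv.sym] _ N [OF q, THEN movie_equiv.sym]])
  then show ?thesis using equiv_cancel_right cv p q by blast
qed

lemma equiv_whisker_right_cancel:
  assumes "movie n u p v" "movie n u q v" "w \<in> words n"
    and "movie_equiv n (u @ w) (v @ w) (whisker [] p w) (whisker [] q w)"
  shows "movie_equiv n u v p q"
  using assms
proof (induction w arbitrary: u p v q)
  case (Cons x w)
  have "movie_equiv n (u @ [x]) (v @ [x]) (whisker [] p [x]) (whisker [] q [x])"
    by (rule Cons.IH) (use Cons.prems movie_whisker_right [OF Cons.prems(1), of "[x]"] movie_whisker_right [OF Cons.prems(2), of "[x]"] in auto)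
  then show ?case using equiv_whisker_right_cancel1 Cons.prems by auto
qed auto

section \<open>Zamolodzhikov loops\<close>

lemma simple_refl_apply: "simple_refl i x = (if x = i then Suc i else if x = Suc i then i else x)"
  by (auto simp: simple_refl_def transpose_def)

lemma simple_refl_involutive [simp]: "simple_refl i \<circ> simple_refl i = id" "simple_refl i (simple_refl i x) = x"
  by (auto simp: simple_refl_apply fun_eq_iff)

lemma simple_refl_permutes: "i \<in> {1..<n} \<Longrightarrow> simple_refl i permutes {1..n}"
  unfolding simple_refl_def by (rule permutes_swap_id) auto

lemma perm_of_word_simps [simp]:
  "perm_of_word [] = id" "perm_of_word (x # w) = simple_refl (index x) \<circ> perm_of_word w"
  by (auto simp: perm_of_word_def)

lemma perm_of_word_append: "perm_of_word (v @ w) = perm_of_word v \<circ> perm_of_word w"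
  by (induction v) (auto simp: comp_assoc)

subsection \<open>Length and inversions\<close>

definition inversions :: "(nat \<Rightarrow> nat) \<Rightarrow> (nat \<times> nat) set" where
  "inversions f = {(x, y). x < y \<and> f y < f x}"

lemma inversions_id [simp]: "inversions id = {}"
  by (auto simp: inversions_def)

lemma permutes_bounds:
  assumes "f permutes {1..n}"
  shows "f x \<in> {1..n} \<longleftrightarrow> x \<in> {1..n}" "x \<notin> {1..n} \<Longrightarrow> f x = x"
  by (rule permutes_in_image [OF assms], rule permutes_not_in [OF assms])

lemma inversions_subset: "f permutes {1..n} \<Longrightarrow> inversions f \<subseteq> {1..n} \<times> {1..n}"
proof
  fix z assume f: "f permutes {1..n}" and "z \<in> inversions f"
  then obtain x y where z: "z = (x, y)" "x < y" "f y < f x" by (auto simp: inversions_def)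
  have "x \<in> {1..n}"
    using z permutes_bounds [OF f, of x] permutes_bounds [OF f, of y] by (cases "x \<in> {1..n}"; cases "y \<in> {1..n}") auto
  moreover have "y \<in> {1..n}"
    using z permutes_bounds [OF f, of x] permutes_bounds [OF f, of y] by (cases "x \<in> {1..n}"; cases "y \<in> {1..n}") auto
  ultimately show "z \<in> {1..n} \<times> {1..n}" using z by simp
qed

lemma finite_inversions: "f permutes {1..n} \<Longrightarrow> finite (inversions f)"
  using inversions_subset finite_subset by blast

text \<open>Exchanging two neighbouring arguments changes the order of no other pair.\<close>

lemma inversions_refl:
  "inversions (f \<circ> simple_refl i) - {(i, Suc i)} = map_prod (simple_refl i) (simple_refl i) ` (inversions f - {(i, Suc i)})"
  (is "?L = ?h ` ?R")
proof -
  have sub: "?h ` (inversions g - {(i, Suc i)}) \<subseteq> inversions (g \<circ> simple_refl i) - {(i, Suc i)}" for g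
    by (auto simp: inversions_def simple_refl_apply split: if_splits)
  have "?h ` ?L \<subseteq> ?R"
    using sub [of "f \<circ> simple_refl i"] by (simp add: comp_assoc)
  then have "?h ` ?h ` ?L \<subseteq> ?h ` ?R" by blast
  then have "?L \<subseteq> ?h ` ?R" by (simp add: image_image map_prod.compositionality prod.map_id flip: map_prod_compose)
  then show ?thesis using sub [of f] by blast
qed

lemma card_inversions_refl:
  "card (inversions (f \<circ> simple_refl i) - {(i, Suc i)}) = card (inversions f - {(i, Suc i)})"
  unfolding inversions_refl
  by (rule card_image) (rule inj_on_inverseI [of _ "map_prod (simple_refl i) (simple_refl i)"], auto)

lemma perm_of_word_permutes: "\<forall>x \<in> set u. index x \<in> {1..<n} \<Longrightarrow> perm_of_word u permutes {1..n}"
proof (induction u)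
  case (Cons x u)
  then have "perm_of_word u permutes {1..n}" "simple_refl (index x) permutes {1..n}"
    using simple_refl_permutes [of "index x" n] by auto
  then show ?case unfolding perm_of_word_simps by (rule permutes_compose)
qed (simp only: permutes_id perm_of_word_simps)

lemma card_inversions_le:
  "\<forall>x \<in> set u. index x \<in> {1..<n} \<Longrightarrow> card (inversions (perm_of_word u)) \<le> length u"
proof (induction u rule: rev_induct)
  case Nil
  show ?case by (simp only: perm_of_word_simps inversions_id card.empty)
next
  case (snoc x u)
  have p: "perm_of_word (u @ [x]) = perm_of_word u \<circ> simple_refl (index x)"
    by (simp add: perm_of_word_append)
  have "finite (inversions (perm_of_word (u @ [x])))" "finite (inversions (perm_of_word u))"
    using snoc.prems by (auto intro!: finite_inversions perm_of_word_permutes)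
  then have "card (inversions (perm_of_word (u @ [x]))) \<le> Suc (card (inversions (perm_of_word u)))"
    using card_inversions_refl [of "perm_of_word u" "index x"] unfolding p
    by (auto simp: card_Diff_singleton_if split: if_splits)
  also have "\<dots> \<le> length (u @ [x])" using snoc by simp
  finally show ?case .
qed

lemma exists_descent:
  assumes f: "f permutes {1..n}" and "f \<noteq> id"
  shows "\<exists>i \<in> {1..<n}. f (Suc i) < f i"
proof (rule ccontr)
  assume "\<not> ?thesis"
  then have mono: "f i < f (Suc i)" if "i \<in> {1..<n}" for i
    using that permutes_inj [OF f] by (metis injD linorder_neqE_nat n_not_Suc_n)
  have lo: "i \<in> {1..n} \<Longrightarrow> i \<le> f i" for i
  proof (induction i)
    case (Suc i)
    then show ?case using mono [of i] permutes_bounds [OF f, of 1] by (cases "i = 0") auto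
  qed simp
  have "k < n \<Longrightarrow> f (n - k) \<le> n - k" for k
  proof (induction k)
    case 0
    then show ?case using permutes_bounds [OF f, of n] by auto
  next
    case (Suc k)
    then have "Suc (n - Suc k) = n - k" by simp
    moreover have "n - Suc k \<in> {1..<n}" using Suc.prems by auto
    ultimately show ?case using Suc mono [of "n - Suc k"] by auto
  qed
  then have hi: "f i \<le> i" if "i \<in> {1..n}" for i
    using that diff_diff_cancel [of i n] by (metis One_nat_def Suc_le_lessD atLeastAtMost_iff diff_less less_le_trans)
  have "f i = i" for i
    using lo [of i] hi [of i] permutes_bounds [OF f, of i] by (cases "i \<in> {1..n}") auto
  then show False using assms by (auto simp: fun_eq_iff)
qed

subsection \<open>Parabolic subgroups and their cosets\<close>

lemma image_o: "(f \<circ> g) ` A = f ` g ` A"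
  by auto

text \<open>By \<open>parabolic_iff\<close> this characterizes the elements of the parabolic subgroup of \<open>J\<close> among all
  permutations. In contrast to generation, it can be read off from the values.\<close>

definition preserves :: "nat set \<Rightarrow> (nat \<Rightarrow> nat) \<Rightarrow> bool" where
  "preserves J f \<longleftrightarrow> (\<forall>k. k \<notin> J \<longrightarrow> f ` {..k} = {..k})"

lemma refl_image: "k \<noteq> i \<Longrightarrow> simple_refl i ` {..k} = {..k}"
proof -
  assume "k \<noteq> i"
  then have *: "simple_refl i ` {..k} \<subseteq> {..k}" by (auto simp: simple_refl_apply)
  then have "simple_refl i ` simple_refl i ` {..k} \<subseteq> simple_refl i ` {..k}" by blast
  then show ?thesis using * by (auto simp: image_image)
qed

lemma preserves_refl: "i \<in> J \<Longrightarrow> preserves J (simple_refl i)"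
  unfolding preserves_def using refl_image by metis

lemma preserves_comp: "preserves J f \<Longrightarrow> preserves J g \<Longrightarrow> preserves J (f \<circ> g)"
  unfolding preserves_def image_o by metis

text \<open>Sorting: composition with a neighbouring transposition at a descent removes one inversion. A descent
  of \<open>f\<close> at \<open>i\<close> forces \<open>i \<in> J\<close>, because \<open>f\<close> would otherwise preserve \<open>{..i}\<close> and send \<open>Suc i\<close> above it.\<close>

lemma preserves_word_of_inversions:
  assumes "f permutes {1..n}" "preserves J f"
  shows "\<exists>u. set u \<subseteq> Pos ` (J \<inter> {1..<n}) \<and> perm_of_word u = f \<and> length u = card (inversions f)"
  using assms
proof (induction "card (inversions f)" arbitrary: f)
  case 0
  have "f = id"
  proof (rule ccontr)
    assume "f \<noteq> id"
    then obtain i where "f (Suc i) < f i" using exists_descent 0 by blast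
    then have "(i, Suc i) \<in> inversions f" by (auto simp: inversions_def)
    then show False using 0 finite_inversions by fastforce
  qed
  then show ?case using 0 by (intro exI [of _ "[]"]) auto
next
  case (Suc c)
  have "f \<noteq> id" using Suc.hyps(2) by (metis card.empty inversions_id nat.distinct(1))
  then obtain i where i: "i \<in> {1..<n}" "f (Suc i) < f i" using exists_descent Suc.prems(1) by blast
  have J: "i \<in> J"
  proof (rule ccontr)
    assume "i \<notin> J"
    then have "f ` {..i} = {..i}" using Suc.prems(2) by (simp add: preserves_def)
    moreover from this have "f i \<le> i" by auto
    ultimately have "f (Suc i) \<in> f ` {..i}" using i(2) by auto
    then show False by (simp add: inj_image_mem_iff [OF permutes_inj [OF Suc.prems(1)]])
  qed
  define g where "g = f \<circ> simple_refl i"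
  have f: "f = g \<circ> simple_refl i" by (simp add: g_def comp_assoc)
  have g: "g permutes {1..n}" "preserves J g"
    unfolding g_def
    by (rule permutes_compose [OF simple_refl_permutes [OF i(1)] Suc.prems(1)])
      (rule preserves_comp [OF Suc.prems(2) preserves_refl [OF J]])
  have "(i, Suc i) \<in> inversions f" "(i, Suc i) \<notin> inversions g"
    using i(2) by (auto simp: inversions_def g_def simple_refl_apply)
  then have "card (inversions g) = c"
    using card_inversions_refl [of f i] Suc.hyps(2) finite_inversions [OF Suc.prems(1)]
    by (auto simp: card_Diff_singleton_if g_def)
  then obtain u where "set u \<subseteq> Pos ` (J \<inter> {1..<n})" "perm_of_word u = g" "length u = c"
    using Suc.hyps(1) g by metis
  then show ?case using i(1) J f Suc.hyps(2)
    by (intro exI [of _ "u @ [Pos i]"]) (auto simp: perm_of_word_append)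
qed

lemma coxeter_length_eq:
  assumes "f permutes {1..n}"
  shows "coxeter_length n f = card (inversions f)"
  unfolding coxeter_length_def
proof (rule Least_equality)
  obtain u where "set u \<subseteq> Pos ` (UNIV \<inter> {1..<n})" "perm_of_word u = f" "length u = card (inversions f)"
    using preserves_word_of_inversions [OF assms, of UNIV] by (auto simp: preserves_def)
  then show "\<exists>u. expression n u f \<and> length u = card (inversions f)"
    by (auto simp: expression_def in_lists_conv_set subset_iff)
next
  fix k assume "\<exists>u. expression n u f \<and> length u = k"
  then obtain u where u: "u \<in> lists (Pos ` {1..<n})" "perm_of_word u = f" "length u = k"
    by (auto simp: expression_def)
  then have "\<forall>x \<in> set u. index x \<in> {1..<n}" by (auto simp: in_lists_conv_set)
  then show "card (inversions f) \<le> k"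
    using card_inversions_le [of u n] u by simp
qed

lemma sym_group_simps [simp]:
  "carrier (sym_group n) = {p. p permutes {1..n}}" "f \<otimes>\<^bsub>sym_group n\<^esub> g = f \<circ> g" "\<one>\<^bsub>sym_group n\<^esub> = id"
  by (auto simp: sym_group_def)

lemma parabolic_word: "set u \<subseteq> Pos ` J \<Longrightarrow> perm_of_word u \<in> parabolic n J"
proof (induction u)
  case Nil
  show ?case using generate.one [of "sym_group n" "simple_refl ` J"]
    unfolding parabolic_def perm_of_word_simps sym_group_simps .
next
  case (Cons x u)
  then obtain j where j: "j \<in> J" "x = Pos j" by auto
  have "simple_refl j \<otimes>\<^bsub>sym_group n\<^esub> perm_of_word u \<in> parabolic n J"
    unfolding parabolic_def
    by (rule generate.eng [OF generate.incl]) (use Cons j in \<open>auto simp: parabolic_def\<close>)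
  then show ?case unfolding j(2) perm_of_word_simps sym_group_simps index.simps .
qed

lemma parabolic_iff:
  assumes "J \<subseteq> {1..<n}"
  shows "f \<in> parabolic n J \<longleftrightarrow> f permutes {1..n} \<and> preserves J f"
proof
  assume "f permutes {1..n} \<and> preserves J f"
  then obtain u where u: "set u \<subseteq> Pos ` (J \<inter> {1..<n})" "perm_of_word u = f"
    using preserves_word_of_inversions [of f n J] by blast
  then have "set u \<subseteq> Pos ` J" by blast
  then show "f \<in> parabolic n J" using parabolic_word u(2) by blast
next
  have inv_refl: "inv\<^bsub>sym_group n\<^esub> (simple_refl i) = simple_refl i" if "i \<in> J" for i
    using that assms simple_refl_permutes [of i n]
    by (intro group.inv_equality [OF sym_group_is_group]) auto
  assume "f \<in> parabolic n J"
  then show "f permutes {1..n} \<and> preserves J f"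
    unfolding parabolic_def
  proof (induction rule: generate.induct)
    case one
    show ?case unfolding sym_group_simps preserves_def by (intro conjI permutes_id) simp
  next
    case (incl h)
    then show ?case using assms simple_refl_permutes preserves_refl by auto
  next
    case (inv h)
    then obtain i where "i \<in> J" "h = simple_refl i" by blast
    then show ?case using assms simple_refl_permutes [of i n] preserves_refl [of i J] inv_refl by auto
  next
    case (eng h1 h2)
    then show ?case unfolding sym_group_simps by (blast intro: preserves_comp permutes_compose)
  qed
qed

text \<open>The inversions of an element of the parabolic subgroup are pairs that no index outside \<open>I\<close> separates.
  If a word of \<open>I\<close> inverts all these pairs and has no more letters than there are pairs, then it is
  reduced and expresses the longest element.\<close>

lemma longest_reduced:
  assumes I: "I \<subseteq> {1..<n}" and u: "set u \<subseteq> Pos ` I"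
    and S: "\<And>x y. \<lbrakk>x < y; {x..<y} \<subseteq> I\<rbrakk> \<Longrightarrow> (x, y) \<in> S" "S \<subseteq> inversions (perm_of_word u)" "length u \<le> card S"
    and fin: "finite S"
  shows "longest n I (perm_of_word u)" "reduced_expression n u (perm_of_word u)"
proof -
  have ix: "\<forall>x \<in> set u. index x \<in> {1..<n}" using I u by fastforce
  have p: "perm_of_word u permutes {1..n}" by (rule perm_of_word_permutes [OF ix])
  have "card S \<le> card (inversions (perm_of_word u))"
    using S(2) finite_inversions [OF p] by (rule card_mono [rotated])
  then have len: "coxeter_length n (perm_of_word u) = length u" "card S = length u"
    using card_inversions_le [OF ix] S(3) coxeter_length_eq [OF p] by auto
  then show "reduced_expression n u (perm_of_word u)"
    using I u by (fastforce simp: reduced_expression_def expression_def in_lists_conv_set)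
  show "longest n I (perm_of_word u)"
    unfolding longest_def
  proof (intro conjI ballI)
    show "perm_of_word u \<in> parabolic n I" by (rule parabolic_word [OF u])
    fix v assume "v \<in> parabolic n I"
    then have v: "v permutes {1..n}" "preserves I v" using parabolic_iff [OF I] by auto
    have "inversions v \<subseteq> S"
    proof
      fix z assume "z \<in> inversions v"
      then obtain x y where z: "z = (x, y)" "x < y" "v y < v x" by (auto simp: inversions_def)
      have "{x..<y} \<subseteq> I"
      proof (rule ccontr)
        assume "\<not> {x..<y} \<subseteq> I"
        then obtain k where k: "x \<le> k" "k < y" "k \<notin> I" by (meson atLeastLessThan_iff subsetI)
        then have im: "v ` {..k} = {..k}" using v by (simp add: preserves_def)
        then have "v x \<le> k" using k(1) by auto
        then have "v y \<in> v ` {..k}" using im z(3) by auto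
        then show False using k(2) by (simp add: inj_image_mem_iff [OF permutes_inj [OF v(1)]])
      qed
      then show "z \<in> S" using S(1) z by blast
    qed
    then show "coxeter_length n v \<le> coxeter_length n (perm_of_word u)"
      using len coxeter_length_eq [OF v(1)] card_mono [OF fin] by metis
  qed
qed

lemma permutes_inv_comp:
  assumes "y permutes {1..n}" "y' permutes {1..n}"
  shows "inv_into UNIV y' \<circ> y permutes {1..n}" "y' \<circ> (inv_into UNIV y' \<circ> y) = y"
  using assms permutes_inv permutes_compose apply blast
  using permutes_inv_o(1) [OF assms(2)] by (simp flip: comp_assoc)

text \<open>Both elements preserve \<open>{..l}\<close> for \<open>l \<notin> I\<close>, so that they differ by an element of the parabolic subgroup of
  \<open>I - {k}\<close> exactly when they have the same image of \<open>{..k}\<close>. The coset determines the omitted index: among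
  the simple reflections with index in \<open>I\<close>, right multiplication by this one alone leaves the coset.\<close>

lemma coset_eq_iff:
  assumes I: "I \<subseteq> {1..<n}" and k: "k \<in> I" "k' \<in> I" and y: "y \<in> parabolic n I" "y' \<in> parabolic n I"
  shows "y' <#\<^bsub>sym_group n\<^esub> parabolic n (I - {k'}) = y <#\<^bsub>sym_group n\<^esub> parabolic n (I - {k})
    \<longleftrightarrow> k' = k \<and> y' ` {..k} = y ` {..k}" (is "?L = ?R")
proof
  have J: "f \<in> parabolic n (I - {k}) \<longleftrightarrow> f permutes {1..n} \<and> preserves (I - {k}) f" for k f
    using I by (intro parabolic_iff) auto
  have y: "y permutes {1..n}" "y' permutes {1..n}" "preserves I y" "preserves I y'"
    using y I by (auto simp: parabolic_iff)
  have mem: "f \<in> y <#\<^bsub>sym_group n\<^esub> parabolic n (I - {k}) \<longleftrightarrow> (\<exists>h. h permutes {1..n} \<and> preserves (I - {k}) h \<and> f = y \<circ> h)" for f y k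
    by (auto simp: l_coset_def J)
  have pI: "id permutes {1..n} \<and> preserves (I - {k}) id" for k by (auto simp: permutes_id preserves_def)
  {
    assume L: ?L
    have "y \<in> y <#\<^bsub>sym_group n\<^esub> parabolic n (I - {k})" unfolding mem using pI by fastforce
    then obtain h where h: "h permutes {1..n}" "preserves (I - {k'}) h" "y = y' \<circ> h"
      unfolding L [symmetric] mem by blast
    then have im: "y ` {..k'} = y' ` {..k'}" unfolding h(3) image_o by (simp add: preserves_def)
    have "k' = k"
    proof (rule ccontr)
      assume "k' \<noteq> k"
      then have "k' \<in> I - {k}" using k by auto
      then have "y \<circ> simple_refl k' \<in> y <#\<^bsub>sym_group n\<^esub> parabolic n (I - {k})"
        unfolding mem using preserves_refl [of k' "I - {k}"] simple_refl_permutes [of k' n] I k by blast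
      then obtain g where g: "preserves (I - {k'}) g" "y \<circ> simple_refl k' = y' \<circ> g"
        unfolding L [symmetric] mem by blast
      have "y ` simple_refl k' ` {..k'} = y' ` g ` {..k'}" using g(2) by (metis image_o)
      also have "\<dots> = y ` {..k'}" using g(1) im by (simp add: preserves_def)
      finally have "simple_refl k' ` {..k'} = {..k'}" using permutes_inj [OF y(1)] by (simp add: inj_image_eq_iff)
      moreover have "Suc k' \<in> simple_refl k' ` {..k'}" by (auto simp: simple_refl_apply image_iff)
      ultimately show False by auto
    qed
    then show ?R using im by auto
  }
  {
    assume R: ?R
    have sub: "y <#\<^bsub>sym_group n\<^esub> parabolic n (I - {k}) \<subseteq> y' <#\<^bsub>sym_group n\<^esub> parabolic n (I - {k})"
      if y: "y permutes {1..n}" "y' permutes {1..n}" "preserves I y" "preserves I y'" "y' ` {..k} = y ` {..k}" for y y'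
    proof
      fix f assume "f \<in> y <#\<^bsub>sym_group n\<^esub> parabolic n (I - {k})"
      then obtain h where h: "h permutes {1..n}" "preserves (I - {k}) h" "f = y \<circ> h" unfolding mem by blast
      let ?g = "inv_into UNIV y' \<circ> y"
      have "preserves (I - {k}) ?g"
        unfolding preserves_def
      proof (intro allI impI)
        fix l assume "l \<notin> I - {k}"
        then have "y' ` {..l} = y ` {..l}" using y(3-5) by (cases "l \<in> I") (auto simp: preserves_def)
        then have "?g ` {..l} = inv_into UNIV y' ` y' ` {..l}" by (simp only: image_o)
        then show "?g ` {..l} = {..l}" by (simp only: image_o [symmetric] permutes_inv_o(2) [OF y(2)] image_id id_apply)
      qed
      then show "f \<in> y' <#\<^bsub>sym_group n\<^esub> parabolic n (I - {k})"
        unfolding mem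
      proof (intro exI conjI)
        show "?g \<circ> h permutes {1..n}" by (rule permutes_compose [OF h(1) permutes_inv_comp(1) [OF y(1,2)]])
        show "f = y' \<circ> (?g \<circ> h)" unfolding h(3) comp_assoc [symmetric] permutes_inv_comp(2) [OF y(1,2), unfolded comp_assoc [symmetric]] ..
      qed (rule preserves_comp [OF _ h(2)])
    qed
    show ?L using R sub [OF y] sub [of y' y] y by auto
  }
qed

subsection \<open>The three types of loops\<close>

text \<open>In the three types of loops, the image of \<open>{..k}\<close> is determined by one or two values: those at the bottom
  of a block of consecutive elements of \<open>I\<close> (this lemma), or the value just above its top (the next one).\<close>

lemma image_eq_below:
  assumes "f permutes {1..n}" "g permutes {1..n}" "preserves I f" "preserves I g" "a = 0 \<or> a - 1 \<notin> I"
  shows "f ` {..a + k} = g ` {..a + k} \<longleftrightarrow> f ` {a..a + k} = g ` {a..a + k}"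
proof -
  have *: "h ` {..<a} = {..<a}" if "preserves I h" for h
  proof (cases a)
    case (Suc b)
    then show ?thesis using assms(5) that by (simp add: preserves_def lessThan_Suc_atMost)
  qed simp
  have "{..a + k} = {..<a} \<union> {a..a + k}" by auto
  then have **: "h ` {..a + k} = {..<a} \<union> h ` {a..a + k}" if "preserves I h" for h
    by (simp only: image_Un * [OF that])
  have disj: "{..<a} \<inter> h ` {a..a + k} = {}" if h: "h permutes {1..n}" "preserves I h" for h
  proof -
    have "h ` {..<a} \<inter> h ` {a..a + k} = h ` ({..<a} \<inter> {a..a + k})"
      by (rule image_Int [OF permutes_inj [OF h(1)], symmetric])
    moreover have "{..<a} \<inter> {a..a + k} = {}" by auto
    ultimately show ?thesis by (simp add: * [OF h(2)])
  qed
  have un: "{..<a} \<union> X = {..<a} \<union> Y \<longleftrightarrow> X = Y" if "{..<a} \<inter> X = {}" "{..<a} \<inter> Y = {}" for X Y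
    using that by blast
  show ?thesis
    unfolding ** [OF assms(3)] ** [OF assms(4)] by (rule un [OF disj [OF assms(1,3)] disj [OF assms(2,4)]])
qed

lemma image_eq_above:
  assumes "f permutes {1..n}" "g permutes {1..n}" "preserves I f" "preserves I g" "Suc a \<notin> I"
  shows "f ` {..a} = g ` {..a} \<longleftrightarrow> f (Suc a) = g (Suc a)"
proof -
  have *: "{..Suc a} - {h (Suc a)} = h ` {..a}" "h (Suc a) \<in> {..Suc a}" if h: "h permutes {1..n}" "preserves I h" for h
  proof -
    have im: "h ` {..Suc a} = {..Suc a}" using that assms(5) by (simp add: preserves_def)
    have "h ` ({..Suc a} - {Suc a}) = h ` {..Suc a} - h ` {Suc a}"
      by (rule image_set_diff [OF permutes_inj [OF h(1)]])
    moreover have "{..Suc a} - {Suc a} = {..a}" by auto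
    ultimately show "{..Suc a} - {h (Suc a)} = h ` {..a}" by (simp only: im image_insert image_empty)
    show "h (Suc a) \<in> {..Suc a}" using im by blast
  qed
  have diff: "{..Suc a} - {x} = {..Suc a} - {y} \<longleftrightarrow> x = y" if "x \<in> {..Suc a}" "y \<in> {..Suc a}" for x y
    using that by blast
  show ?thesis
    unfolding *(1) [OF assms(1,3), symmetric] *(1) [OF assms(2,4), symmetric]
    by (rule diff [OF *(2) [OF assms(1,3)] *(2) [OF assms(2,4)]])
qed

lemma preserves_range:
  assumes "f permutes {1..n}" "preserves I f" "a = 0 \<or> a - 1 \<notin> I" "b \<notin> I" "x \<in> {a..b}"
  shows "f x \<in> {a..b}"
proof -
  have "f ` {..b} = {..b}" using assms by (simp add: preserves_def)
  then have "f x \<le> b" using assms(5) by auto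
  moreover have "a \<le> f x"
  proof (rule ccontr)
    assume "\<not> a \<le> f x"
    then have "f x \<in> {..a - 1}" "a - 1 \<notin> I" "x \<notin> {..a - 1}" using assms(3,5) by auto
    moreover from this have "f ` {..a - 1} = {..a - 1}" using assms(2) by (simp add: preserves_def)
    ultimately show False using inj_image_mem_iff [OF permutes_inj [OF assms(1)], of x "{..a - 1}"] by simp
  qed
  ultimately show ?thesis by simp
qed

text \<open>The list \<open>cs\<close> gives for every step the prefix and the index omitted by the crossed coset, and \<open>c k y\<close> is an
  explicit invariant that is equivalent to the image of \<open>{..k}\<close> under \<open>y\<close>. The crossings of a coset are
  then counted by comparing values of \<open>c\<close>.\<close>

lemma zamolodzhikov_loopI:
  assumes I: "I \<subseteq> {1..<n}" "card I = 3" and u: "set u \<subseteq> Pos ` I"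
    and S: "\<And>x y. \<lbrakk>x < y; {x..<y} \<subseteq> I\<rbrakk> \<Longrightarrow> (x, y) \<in> S" "S \<subseteq> inversions (perm_of_word u)" "length u \<le> card S" "finite S"
    and p: "movie n u p u" "\<forall>(a, m, b) \<in> set p. braid_move m"
    and crossed: "map (crossed_coset n) p = map (\<lambda>(a, k). perm_of_word a <#\<^bsub>sym_group n\<^esub> parabolic n (I - {k})) cs"
    and cs: "\<forall>(a, k) \<in> set cs. set a \<subseteq> Pos ` I \<and> k \<in> I"
    and c: "\<And>k y y'. \<lbrakk>k \<in> I; y permutes {1..n}; y' permutes {1..n}; preserves I y; preserves I y'\<rbrakk>
      \<Longrightarrow> y' ` {..k} = y ` {..k} \<longleftrightarrow> c k y' = c k y"
    and count: "\<And>k y. \<lbrakk>k \<in> I; y permutes {1..n}; preserves I y\<rbrakk>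
      \<Longrightarrow> length (filter (\<lambda>(a, k'). k' = k \<and> c k (perm_of_word a) = c k y) cs) = 1"
  shows "zamolodzhikov_loop n I p"
  unfolding zamolodzhikov_loop_def
proof (intro conjI ballI)
  show "\<exists>w v. longest n I w \<and> reduced_expression n v w \<and> movie n v p v"
    using longest_reduced [OF I(1) u S] p(1) by blast
  show "case x of (a, m, b) \<Rightarrow> braid_move m" if "x \<in> set p" for x using p(2) that by blast
next
  fix K assume "K \<in> rank2_cosets n I"
  then obtain y J where K: "K = y <#\<^bsub>sym_group n\<^esub> parabolic n J" "y \<in> parabolic n I" "J \<subseteq> I" "card J = 2"
    unfolding rank2_cosets_def by blast
  have fin: "finite I" using I(2) card.infinite by fastforce
  then have "card (I - J) = 1" using K I(2) by (simp add: card_Diff_subset finite_subset)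
  then obtain k where "I - J = {k}" by (auto simp: card_1_singleton_iff)
  then have k: "k \<in> I" "J = I - {k}" using K(3) by auto
  have y: "y permutes {1..n}" "preserves I y" using K(2) parabolic_iff [OF I(1)] by auto
  have eq: "(perm_of_word a <#\<^bsub>sym_group n\<^esub> parabolic n (I - {k'}) = K) \<longleftrightarrow> k' = k \<and> c k (perm_of_word a) = c k y"
    if "(a, k') \<in> set cs" for a k'
  proof -
    have "perm_of_word a \<in> parabolic n I" "k' \<in> I" using that cs parabolic_word by auto
    moreover from this have "perm_of_word a permutes {1..n}" "preserves I (perm_of_word a)"
      using parabolic_iff [OF I(1)] by auto
    ultimately show ?thesis
      using coset_eq_iff [OF I(1) k(1) _ K(2), of k' "perm_of_word a"] c [OF k(1) y(1) _ y(2), of "perm_of_word a"] K(1) k(2) by blast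
  qed
  have "count_list (map (crossed_coset n) p) K
      = length (filter (\<lambda>(a, k'). perm_of_word a <#\<^bsub>sym_group n\<^esub> parabolic n (I - {k'}) = K) cs)"
    unfolding crossed by (induction cs) auto
  also have "\<dots> = length (filter (\<lambda>(a, k'). k' = k \<and> c k (perm_of_word a) = c k y) cs)"
    using eq by (intro arg_cong [where f = length] filter_cong) auto
  finally show "count_list (map (crossed_coset n) p) K = 1" using count [OF k(1) y] by simp
qed

text \<open>The loops sweep once over the faces of a cube (six squares), a hexagonal prism (six squares and two
  hexagons) and a permutohedron (six squares and eight hexagons). Each of them starts directly after a
  move that changes the first letter, so that it falls into three segments with constant first letter,
  each followed by a change of the first letter.\<close>

lemma zamolodzhikov_cube:
  assumes ijk: "i \<in> {1..<n}" "j \<in> {1..<n}" "k \<in> {1..<n}" "distant i j" "distant j k" "distant i k"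
  shows "zamolodzhikov_loop n {i, j, k}
    [([Pos i], Exch k j, []), ([], Exch i j, [Pos k]), ([Pos j], Exch i k, []), ([], Exch j k, [Pos i]),
     ([Pos k], Exch j i, []), ([], Exch k i, [Pos j])]"
proof -
  let ?I = "{i, j, k}"
  have d: "i \<noteq> j" "j \<noteq> k" "i \<noteq> k" "Suc i \<noteq> j" "Suc j \<noteq> i" "Suc j \<noteq> k" "Suc k \<noteq> j" "Suc i \<noteq> k" "Suc k \<noteq> i"
    using ijk by (auto simp: distant_def)
  note d = d d [symmetric]
  have Suc: "Suc x \<noteq> a" if "x \<in> ?I" "a \<in> ?I" for x a
    using that by (elim insertE emptyE) (simp_all add: d)
  have below: "a - 1 \<notin> ?I" "Suc a \<notin> ?I" if a: "a \<in> ?I" for a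
  proof -
    have "0 < a" using a ijk(1-3) by auto
    then show "a - 1 \<notin> ?I" using Suc [OF _ a, of "a - 1"] by auto
    show "Suc a \<notin> ?I" using Suc [OF a] by blast
  qed
  show ?thesis
  proof (rule zamolodzhikov_loopI [of _ _ "[Pos i, Pos k, Pos j]" "{(i, Suc i), (j, Suc j), (k, Suc k)}" _
        "[([Pos i], i), ([], k), ([Pos j], j), ([], i), ([Pos k], k), ([], j)]" "\<lambda>k y. y k"])
    show "(x, y) \<in> {(i, Suc i), (j, Suc j), (k, Suc k)}" if "x < y" "{x..<y} \<subseteq> ?I" for x y
    proof -
      have x: "x \<in> ?I" using subsetD [OF that(2), of x] that(1) by simp
      have "\<not> Suc x < y" using subsetD [OF that(2), of "Suc x"] below(2) [OF x] by auto
      then have "y = Suc x" using that(1) by simp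
      then show ?thesis using x by blast
    qed
    show "y' ` {..l} = y ` {..l} \<longleftrightarrow> y' l = y l"
      if "l \<in> ?I" "y permutes {1..n}" "y' permutes {1..n}" "preserves ?I y" "preserves ?I y'" for l y y'
      using image_eq_below [OF that(3,2,5,4), of l 0] below [OF that(1)] by auto
    show "length (filter (\<lambda>(a, k'). k' = l \<and> perm_of_word a l = y l)
            [([Pos i], i), ([], k), ([Pos j], j), ([], i), ([Pos k], k), ([], j)]) = 1"
      if l: "l \<in> ?I" "y permutes {1..n}" "preserves ?I y" for l y
    proof -
      have "y l \<in> {l..Suc l}"
        by (rule preserves_range [OF l(2,3)]) (use below [OF l(1)] in auto)
      then have range: "y l = l \<or> y l = Suc l" by auto
      have "l = i \<or> l = j \<or> l = k" using l(1) by auto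
      then show ?thesis using range by (elim disjE) (simp_all add: d simple_refl_apply)
    qed
    show "map (crossed_coset n) [([Pos i], Exch k j, []), ([], Exch i j, [Pos k]), ([Pos j], Exch i k, []),
      ([], Exch j k, [Pos i]), ([Pos k], Exch j i, []), ([], Exch k i, [Pos j])]
      = map (\<lambda>(a, k). perm_of_word a <#\<^bsub>sym_group n\<^esub> parabolic n (?I - {k}))
         [([Pos i], i), ([], k), ([Pos j], j), ([], i), ([Pos k], k), ([], j)]"
      using d by (simp add: insert_commute insert_Diff_if)
    show "{(i, Suc i), (j, Suc j), (k, Suc k)} \<subseteq> inversions (perm_of_word [Pos i, Pos k, Pos j])"
      by (simp add: inversions_def simple_refl_apply d)
    show "movie n [Pos i, Pos k, Pos j] [([Pos i], Exch k j, []), ([], Exch i j, [Pos k]), ([Pos j], Exch i k, []),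
      ([], Exch j k, [Pos i]), ([Pos k], Exch j i, []), ([], Exch k i, [Pos j])] [Pos i, Pos k, Pos j]"
      using ijk ijk(4-6) [THEN distant_sym] by (simp add: letters_def)
  qed (use ijk(1-3) in \<open>simp_all add: d\<close>)
qed

lemma zamolodzhikov_prism:
  assumes ijk: "i \<in> {1..<n}" "Suc i \<in> {1..<n}" "k \<in> {1..<n}" "distant i k" "distant (Suc i) k"
  defines "a \<equiv> Pos i" and "b \<equiv> Pos (Suc i)" and "c \<equiv> Pos k"
  shows "zamolodzhikov_loop n {i, Suc i, k}
    [([a, b], Exch i k, []), ([a], Exch (Suc i) k, [a]), ([], Exch i k, [b, a]),
     ([c], RIII i (Suc i), []), ([], Exch k (Suc i), [a, b]),
     ([b], Exch k i, [b]), ([b, a], Exch k (Suc i), []), ([], RIII (Suc i) i, [c])]"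
    (is "zamolodzhikov_loop n ?I ?p")
proof -
  have d: "i \<noteq> k" "Suc i \<noteq> k" "Suc (Suc i) \<noteq> k" "i \<noteq> Suc k" "Suc (Suc i) \<noteq> Suc k"
    using ijk by (auto simp: distant_def)
  note d = d d [symmetric]
  let ?u = "[a, b, a, c]" and ?S = "{(i, Suc i), (i, Suc (Suc i)), (Suc i, Suc (Suc i)), (k, Suc k)}"
  let ?cs = "[([a, b], Suc i), ([a], i), ([], Suc i), ([c], k), ([], i), ([b], Suc i), ([b, a], i), ([], k)]"
  let ?c = "\<lambda>l y. if l = Suc i then y (Suc (Suc i)) else y l"
  have below: "i - 1 \<notin> ?I" "Suc (Suc i) \<notin> ?I" "k - 1 \<notin> ?I" "Suc k \<notin> ?I"
    using ijk d by (auto simp: distant_def)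
  show ?thesis
  proof (rule zamolodzhikov_loopI [of _ _ ?u ?S _ ?cs ?c])
    show "(x, y) \<in> ?S" if "x < y" "{x..<y} \<subseteq> ?I" for x y
    proof -
      have x: "x \<in> ?I" using that by auto
      then consider "x = k" | "x = i" | "x = Suc i" by auto
      then show ?thesis
      proof cases
        case 1
        then have "\<not> Suc k < y" using below(4) subsetD [OF that(2), of "Suc k"] by auto
        then have "y = Suc k" using that(1) 1 by auto
        then show ?thesis using 1 by simp
      next
        case 2
        then have "\<not> Suc (Suc i) < y" using below(2) subsetD [OF that(2), of "Suc (Suc i)"] by auto
        then have "y = Suc i \<or> y = Suc (Suc i)" using that(1) 2 by auto
        then show ?thesis using 2 by auto
      next
        case 3
        then have "\<not> Suc (Suc i) < y" using below(2) subsetD [OF that(2), of "Suc (Suc i)"] by auto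
        then have "y = Suc (Suc i)" using that(1) 3 by auto
        then show ?thesis using 3 by auto
      qed
    qed
    show "y' ` {..l} = y ` {..l} \<longleftrightarrow> ?c l y' = ?c l y"
      if "l \<in> ?I" "y permutes {1..n}" "y' permutes {1..n}" "preserves ?I y" "preserves ?I y'" for l y y'
      using that(1) image_eq_below [OF that(3,2,5,4), of i 0] image_eq_below [OF that(3,2,5,4), of k 0]
        image_eq_above [OF that(3,2,5,4), of "Suc i"] below d by auto
    show "length (filter (\<lambda>(a, k'). k' = l \<and> ?c l (perm_of_word a) = ?c l y) ?cs) = 1"
      if l: "l \<in> ?I" "y permutes {1..n}" "preserves ?I y" for l y
    proof -
      have "y k \<in> {k..Suc k}" "y i \<in> {i..Suc (Suc i)}" "y (Suc (Suc i)) \<in> {i..Suc (Suc i)}"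
        by (rule preserves_range [OF l(2,3)]; use below in auto)+
      then have "y k = k \<or> y k = Suc k" "y i = i \<or> y i = Suc i \<or> y i = Suc (Suc i)"
        "y (Suc (Suc i)) = i \<or> y (Suc (Suc i)) = Suc i \<or> y (Suc (Suc i)) = Suc (Suc i)" by auto
      moreover have "l = i \<or> l = Suc i \<or> l = k" using l(1) by auto
      ultimately consider "l = i" "y i = i \<or> y i = Suc i \<or> y i = Suc (Suc i)"
        | "l = Suc i" "y (Suc (Suc i)) = i \<or> y (Suc (Suc i)) = Suc i \<or> y (Suc (Suc i)) = Suc (Suc i)"
        | "l = k" "y k = k \<or> y k = Suc k" by blast
      then show ?thesis by cases (elim disjE; simp add: d simple_refl_apply a_def b_def c_def)+
    qed
    show "map (crossed_coset n) ?p = map (\<lambda>(a, k). perm_of_word a <#\<^bsub>sym_group n\<^esub> parabolic n (?I - {k})) ?cs"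
      using d by (simp add: insert_commute insert_Diff_if)
    show "?S \<subseteq> inversions (perm_of_word ?u)"
      by (simp add: inversions_def simple_refl_apply d a_def b_def c_def)
    show "movie n ?u ?p ?u"
      using ijk ijk(4,5) [THEN distant_sym] by (simp add: letters_def a_def b_def c_def adjacent_def)
  qed (use ijk(1-3) in \<open>simp_all add: d a_def b_def c_def\<close>)
qed

lemma zamolodzhikov_permutohedron:
  assumes "{i, Suc i, Suc (Suc i)} \<subseteq> {1..<n}"
  defines "a \<equiv> Pos i" and "b \<equiv> Pos (Suc i)" and "c \<equiv> Pos (Suc (Suc i))"
    and "ac \<equiv> Exch i (Suc (Suc i))" and "ca \<equiv> Exch (Suc (Suc i)) i"
    and "ab \<equiv> RIII i (Suc i)" and "ba \<equiv> RIII (Suc i) i"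
    and "bc \<equiv> RIII (Suc i) (Suc (Suc i))" and "cb \<equiv> RIII (Suc (Suc i)) (Suc i)"
  shows "zamolodzhikov_loop n {i, Suc i, Suc (Suc i)}
    [([a, b], ac, [b, a]), ([a, b, c], ab, []), ([a], bc, [a, b]), ([], ac, [b, c, a, b]),
     ([c, a, b], ca, [b]), ([c], ab, [c, b]), ([c, b, a], bc, []), ([c, b], ac, [b, c]), ([], cb, [a, b, c]),
     ([b, c], ba, [c]), ([b], ca, [b, a, c]), ([b, a, c, b], ac, []), ([b, a], cb, [a]), ([], ba, [c, b, a])]"
    (is "zamolodzhikov_loop n ?I ?p")
proof -
  let ?b = "Suc i" and ?c = "Suc (Suc i)" and ?d = "Suc (Suc (Suc i))"
  note letter_defs = a_def b_def c_def ac_def ca_def ab_def ba_def bc_def cb_def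
  let ?u = "[a, b, a, c, b, a]" and ?S = "{(i, ?b), (i, ?c), (i, ?d), (?b, ?c), (?b, ?d), (?c, ?d)}"
  let ?cs = "[([a, b], ?b), ([a, b, c], ?c), ([a], i), ([], ?b), ([c, a, b], ?b), ([c], ?c), ([c, b, a], i),
    ([c, b], ?b), ([], i), ([b, c], ?c), ([b], ?b), ([b, a, c, b], ?b), ([b, a], i), ([], ?c)]"
  let ?f = "\<lambda>l y. if l = i then {y i} else if l = ?b then {y i, y ?b} else {y ?d}"
  have below: "i - 1 \<notin> ?I" "?d \<notin> ?I"
    using assms(1) by auto
  show ?thesis
  proof (rule zamolodzhikov_loopI [of _ _ ?u ?S _ ?cs ?f])
    show "(x, y) \<in> ?S" if "x < y" "{x..<y} \<subseteq> ?I" for x y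
    proof -
      have "0 < y" using that(1) by simp
      then obtain z where y: "y = Suc z" using gr0_conv_Suc by blast
      have "x \<in> ?I" "z \<in> ?I"
        using that(1) subsetD [OF that(2), of x] subsetD [OF that(2), of z] by (auto simp: y)
      then have "x = i \<or> x = ?b \<or> x = ?c" "z = i \<or> z = ?b \<or> z = ?c" by auto
      then show ?thesis using that(1) by (elim disjE) (simp_all add: y)
    qed
    show "y' ` {..l} = y ` {..l} \<longleftrightarrow> ?f l y' = ?f l y"
      if "l \<in> ?I" "y permutes {1..n}" "y' permutes {1..n}" "preserves ?I y" "preserves ?I y'" for l y y'
    proof -
      have "{i..Suc i} = {i, Suc i}" by auto
      then have "y' ` {..i} = y ` {..i} \<longleftrightarrow> {y' i} = {y i}"
        "y' ` {..?b} = y ` {..?b} \<longleftrightarrow> {y' i, y' ?b} = {y i, y ?b}"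
        "y' ` {..?c} = y ` {..?c} \<longleftrightarrow> {y' ?d} = {y ?d}"
        using image_eq_below [OF that(3,2,5,4) disjI2 [OF below(1)], of 0]
          image_eq_below [OF that(3,2,5,4) disjI2 [OF below(1)], of 1]
          image_eq_above [OF that(3,2,5,4) below(2)] by simp_all
      moreover have "l = i \<or> l = ?b \<or> l = ?c" using that(1) by simp
      ultimately show ?thesis by (elim disjE) simp_all
    qed
    show "length (filter (\<lambda>(a, k'). k' = l \<and> ?f l (perm_of_word a) = ?f l y) ?cs) = 1"
      if l: "l \<in> ?I" "y permutes {1..n}" "preserves ?I y" for l y
    proof -
      have "y i \<in> {i..?d}" "y ?b \<in> {i..?d}" "y ?d \<in> {i..?d}"
        by (rule preserves_range [OF l(2,3)]; use below in auto)+
      then have range: "y i = i \<or> y i = ?b \<or> y i = ?c \<or> y i = ?d" "y ?b = i \<or> y ?b = ?b \<or> y ?b = ?c \<or> y ?b = ?d"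
        "y ?d = i \<or> y ?d = ?b \<or> y ?d = ?c \<or> y ?d = ?d" by auto
      have ne: "y i \<noteq> y ?b" by (simp add: inj_eq [OF permutes_inj [OF l(2)]])
      consider "l = i" | "l = ?b" | "l = ?c" using l(1) by auto
      then show ?thesis
      proof cases
        case 1
        then show ?thesis using range(1) by (elim disjE) (simp_all add: simple_refl_apply a_def b_def c_def)
      next
        case 2
        have "length (filter (\<lambda>(a, k'). k' = ?b \<and> {perm_of_word a i, perm_of_word a ?b} = Y) ?cs)
            = length (filter (\<lambda>Z. Z = Y) [{?b, ?c}, {i, ?b}, {?b, ?d}, {i, ?d}, {i, ?c}, {?c, ?d}])" for Y
          by (simp add: simple_refl_apply a_def b_def c_def)
        moreover have "length (filter (\<lambda>Z. Z = {v, w}) [{?b, ?c}, {i, ?b}, {?b, ?d}, {i, ?d}, {i, ?c}, {?c, ?d}]) = 1"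
          if "v = i \<or> v = ?b \<or> v = ?c \<or> v = ?d" "w = i \<or> w = ?b \<or> w = ?c \<or> w = ?d" "v \<noteq> w" for v w
          using that by (elim disjE) (simp_all add: doubleton_eq_iff)
        ultimately show ?thesis using 2 range(1,2) ne by simp
      next
        case 3
        then show ?thesis using range(3) by (elim disjE) (simp_all add: simple_refl_apply a_def b_def c_def)
      qed
    qed
    show "map (crossed_coset n) ?p = map (\<lambda>(a, k). perm_of_word a <#\<^bsub>sym_group n\<^esub> parabolic n (?I - {k})) ?cs"
      by (simp add: insert_commute insert_Diff_if letter_defs)
  qed (use assms(1) in \<open>auto simp: inversions_def simple_refl_apply letters_def letter_defs adjacent_def distant_def\<close>)
qed

declare movie_equiv.trans [trans]

lemma equiv_middle:
  assumes "movie_equiv n u' v' q q'" "movie n u p u'" "movie n v' r v"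
  shows "movie_equiv n u v (p @ q @ r) (p @ q' @ r)"
  by (rule equiv_append1 [OF equiv_append2 [OF assms(1,3)] assms(2)])

lemma movie_appendI: "movie n u p v \<Longrightarrow> movie n v q w \<Longrightarrow> movie n u (p @ q) w"
  by (auto simp: movie_append)

lemma equiv_insert_inv:
  assumes "movie n u p v" "movie n v r w" "movie n v q t"
  shows "movie_equiv n u t (p @ r @ inv_movie r @ q) (p @ q)"
  using equiv_middle [OF equiv_inv_right [OF assms(2)] assms(1,3)] by simp

section \<open>Positive movies\<close>

abbreviation pos :: "nat list \<Rightarrow> word" where
  "pos A \<equiv> map Pos A"

lemma map_Pos_inj [simp]: "pos A = pos B \<longleftrightarrow> A = B"
  by (simp add: inj_map_eq_map inj_def)

lemma Pos_letters: "Pos i \<in> letters n \<longleftrightarrow> i \<in> {1..<n}" "Neg i \<in> letters n \<longleftrightarrow> i \<in> {1..<n}"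
  by (auto simp: letters_def)

lemma W_words [simp]: "pos A \<in> words n \<longleftrightarrow> set A \<subseteq> {1..<n}"
  by (auto simp: letters_def subset_iff)

definition pmovie :: "nat \<Rightarrow> nat list \<Rightarrow> step list \<Rightarrow> nat list \<Rightarrow> bool" where
  "pmovie n A p B \<longleftrightarrow> movie n (pos A) p (pos B) \<and> (\<forall>(a, m, b) \<in> set p. braid_move m)"

lemma pmovie_movie: "pmovie n A p B \<Longrightarrow> movie n (pos A) p (pos B)"
  by (simp add: pmovie_def)

lemma pmovie_Nil: "pmovie n A [] B \<longleftrightarrow> A = B \<and> set A \<subseteq> {1..<n}"
  by (auto simp: pmovie_def)

lemma pmovie_append: "pmovie n A p B \<Longrightarrow> pmovie n B q C \<Longrightarrow> pmovie n A (p @ q) C"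
  by (auto simp: pmovie_def movie_append)

lemma pmovie_inv: "pmovie n A p B \<Longrightarrow> pmovie n B (inv_movie p) A"
  by (auto simp: pmovie_def movie_inv) (auto simp: inv_movie_def)

lemma pmovie_whisker:
  "pmovie n A p B \<Longrightarrow> set C \<subseteq> {1..<n} \<Longrightarrow> set D \<subseteq> {1..<n} \<Longrightarrow> pmovie n (C @ A @ D) (whisker (pos C) p (pos D)) (C @ B @ D)"
  using movie_whisker [of n "pos A" p "pos B" "pos C" "pos D"] by (auto simp: pmovie_def) (auto simp: whisker_def)

lemma pmovie_cons: "pmovie n A p B \<Longrightarrow> i \<in> {1..<n} \<Longrightarrow> pmovie n (i # A) (whisker [Pos i] p []) (i # B)"
  using pmovie_whisker [of n A p B "[i]" "[]"] by simp

lemma braid_move_words: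
  assumes "braid_move m" "valid_move n m"
  obtains S T where "move_src m = pos S" "move_tgt m = pos T" "S \<approx> T" "set S \<subseteq> {1..<n}"
  using assms
proof (cases m)
  case (Exch i j)
  then show thesis using assms that [of "[i, j]" "[j, i]"] artin_comm by auto
next
  case (RIII i j)
  then show thesis using assms that [of "[i, j, i]" "[j, i, j]"] artin_braid by auto
qed auto

lemma pmovie_Cons:
  assumes "pmovie n A ((a, m, b) # p) B"
  obtains S T X Y where "a = pos X" "b = pos Y" "move_src m = pos S" "move_tgt m = pos T" "A = X @ S @ Y" "S \<approx> T"
    "pmovie n A [(a, m, b)] (X @ T @ Y)" "pmovie n (X @ T @ Y) p B"
proof -
  have m: "movie n (pos A) ((a, m, b) # p) (pos B)" "braid_move m" "valid_move n m" "pos A = a @ move_src m @ b"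
    and b: "\<forall>(a, m, b) \<in> set p. braid_move m"
    using assms by (auto simp: pmovie_def)
  obtain S T where ST: "move_src m = pos S" "move_tgt m = pos T" "S \<approx> T" "set S \<subseteq> {1..<n}"
    using braid_move_words m(2,3) by blast
  obtain X Y where XY: "a = pos X" "b = pos Y" "A = X @ S @ Y"
    using m(4) unfolding ST by (auto simp: map_eq_append_conv append_eq_map_conv)
  have "movie n (pos A) [(a, m, b)] (a @ move_tgt m @ b)" "movie n (a @ move_tgt m @ b) p (pos B)"
    using m(1) movie_step [of n a m b] by auto
  then show thesis using that [OF XY(1,2) ST(1,2) XY(3) ST(3)] m(2) b ST XY by (auto simp: pmovie_def simp del: movie.simps)
qed

lemma pmovie_ends: "pmovie n A p B \<Longrightarrow> set A \<subseteq> {1..<n} \<and> set B \<subseteq> {1..<n}"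
  unfolding pmovie_def using movie_ends W_words by metis

lemma pmovie_artin: "pmovie n A p B \<Longrightarrow> A \<approx> B"
proof (induction p arbitrary: A)
  case Nil
  then show ?case by (simp add: pmovie_Nil)
next
  case (Cons s p)
  obtain a m b where s: "s = (a, m, b)" by (cases s)
  obtain S T X Y where "A = X @ S @ Y" "S \<approx> T" "pmovie n (X @ T @ Y) p B"
    using pmovie_Cons Cons.prems unfolding s by metis
  then show ?case using Cons.IH artin_prepend [OF artin_append1] artin_trans by blast
qed

lemma artin_step_pmovie: "artin_step A B \<Longrightarrow> set A \<subseteq> {1..<n} \<Longrightarrow> \<exists>p. pmovie n A p B"
proof (induction rule: artin_step.induct)
  case (comm i j A)
  then have "pmovie n (i # j # A) [([], Exch i j, pos A)] (j # i # A)"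
    by (simp add: pmovie_def Pos_letters)
  then show ?case by blast
next
  case (braid i j A)
  then have "pmovie n (i # j # i # A) [([], RIII i j, pos A)] (j # i # j # A)"
    by (simp add: pmovie_def Pos_letters)
  then show ?case by blast
next
  case (cons A B x)
  then obtain p where "pmovie n A p B" by auto
  then show ?case using pmovie_cons [of n A p B x] cons.prems by auto
qed

lemma artin_pmovie: "A \<approx> B \<Longrightarrow> set A \<subseteq> {1..<n} \<Longrightarrow> \<exists>p. pmovie n A p B"
  unfolding artin_def
proof (induction rule: rtranclp_induct)
  case base
  then show ?case using pmovie_Nil by blast
next
  case (step B C)
  then obtain p where "pmovie n A p B" by blast
  moreover obtain q where "pmovie n B q C"
    using artin_step_pmovie [OF step(2)] pmovie_ends [OF \<open>pmovie n A p B\<close>] by blast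
  ultimately show ?case using pmovie_append by blast
qed

subsection \<open>Changing the first letter\<close>

definition change :: "nat \<Rightarrow> nat \<Rightarrow> move" where
  "change i j = (if distant i j then Exch i j else RIII i j)"

lemma change_simps:
  assumes "i \<noteq> j"
  shows "move_src (change i j) = pos (i # res i j)" "move_tgt (change i j) = pos (j # res j i)"
    "inv_move (change i j) = change j i" "braid_move (change i j)"
    "valid_move n (change i j) \<longleftrightarrow> i \<in> {1..<n} \<and> j \<in> {1..<n}"
  using assms adjacent_if_not_distant [OF assms] distant_sym adjacent_sym
  by (auto simp: change_def res_def)

lemma set_res: "set (res i j) \<subseteq> {i, j}"
  by (auto simp: res_def)

lemma change_pmovie:
  assumes "i \<noteq> j" "i \<in> {1..<n}" "j \<in> {1..<n}" "set C \<subseteq> {1..<n}"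
  shows "pmovie n (i # res i j @ C) [([], change i j, pos C)] (j # res j i @ C)"
  using movie_step [of n "[]" "change i j" "pos C"] assms
  by (simp add: pmovie_def change_simps)

text \<open>A standard movie from \<open>i # A\<close> to \<open>j # B\<close> changes the first letter at most once: it rewrites \<open>A\<close>, applies the
  move that replaces \<open>i\<close> by \<open>j\<close> if they differ, and rewrites what follows \<open>j\<close>.\<close>

definition std :: "nat \<Rightarrow> nat \<Rightarrow> nat list \<Rightarrow> nat \<Rightarrow> nat list \<Rightarrow> step list \<Rightarrow> bool" where
  "std n i A j B p \<longleftrightarrow> i \<in> {1..<n} \<and> j \<in> {1..<n} \<and>
    (if i = j then \<exists>q. pmovie n A q B \<and> p = whisker [Pos i] q []
     else \<exists>C q r. pmovie n A q (res i j @ C) \<and> pmovie n (res j i @ C) r B \<and>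
       p = whisker [Pos i] q [] @ [([], change i j, pos C)] @ whisker [Pos j] r [])"

lemma stdI:
  assumes "i \<noteq> j" "i \<in> {1..<n}" "j \<in> {1..<n}" "pmovie n A q (res i j @ C)" "pmovie n (res j i @ C) r B"
  shows "std n i A j B (whisker [Pos i] q [] @ [([], change i j, pos C)] @ whisker [Pos j] r [])"
  using assms unfolding std_def by auto

lemma std_sameI: "i \<in> {1..<n} \<Longrightarrow> pmovie n A q B \<Longrightarrow> std n i A i B (whisker [Pos i] q [])"
  unfolding std_def by auto

lemma std_pmovie: "std n i A j B p \<Longrightarrow> pmovie n (i # A) p (j # B)"
proof -
  assume std: "std n i A j B p"
  show ?thesis
  proof (cases "i = j")
    case True
    then show ?thesis using std pmovie_cons by (auto simp: std_def)
  next
    case False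
    then obtain C q r where *: "pmovie n A q (res i j @ C)" "pmovie n (res j i @ C) r B" "i \<in> {1..<n}" "j \<in> {1..<n}"
      "p = whisker [Pos i] q [] @ [([], change i j, pos C)] @ whisker [Pos j] r []"
      using std by (auto simp: std_def)
    have "set C \<subseteq> {1..<n}" using pmovie_ends [OF *(1)] by simp
    then show ?thesis unfolding *(5)
      by (intro pmovie_append [OF pmovie_cons [OF *(1,3)]] pmovie_append [OF change_pmovie [OF False *(3,4)]] pmovie_cons [OF *(2,4)])
  qed
qed

lemma std_length: "std n i A j B p \<Longrightarrow> length A = length B"
  using artin_length [OF pmovie_artin [OF std_pmovie]] by fastforce

lemma std_exists:
  assumes "i # A \<approx> j # B" "set (i # A) \<subseteq> {1..<n}"
  shows "\<exists>p. std n i A j B p"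
proof -
  have ij: "i \<in> {1..<n}" "j \<in> {1..<n}" "set A \<subseteq> {1..<n}" using assms artin_set [OF assms(1)] by auto
  show ?thesis
  proof (cases "i = j")
    case True
    then show ?thesis using artin_cancel assms artin_pmovie [of A B n] std_sameI [of i n] ij by blast
  next
    case False
    obtain C where C: "A \<approx> res i j @ C" "B \<approx> res j i @ C" using garside [OF assms(1)] by blast
    have "set C \<subseteq> {1..<n}" "set (res j i) \<subseteq> {1..<n}" using artin_set [OF C(1)] ij set_res [of j i] by auto
    then show ?thesis using stdI [OF False ij(1,2)] artin_pmovie [OF C(1) ij(3)] artin_pmovie [OF artin_sym [OF C(2)], of n]
      by (metis Un_subset_iff set_append)
  qed
qed

lemma std_inv:
  assumes "std n i A j B p"
  shows "std n j B i A (inv_movie p)"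
proof (cases "i = j")
  case True
  then obtain q where "pmovie n A q B" "p = whisker [Pos i] q []" "i \<in> {1..<n}" using assms by (auto simp: std_def)
  then show ?thesis using True std_sameI [OF _ pmovie_inv] by (simp add: inv_movie_whisker)
next
  case False
  then obtain C q r where *: "pmovie n A q (res i j @ C)" "pmovie n (res j i @ C) r B" "i \<in> {1..<n}" "j \<in> {1..<n}"
    "p = whisker [Pos i] q [] @ [([], change i j, pos C)] @ whisker [Pos j] r []"
    using assms by (auto simp: std_def)
  show ?thesis
    using stdI [OF False [symmetric] *(4,3) pmovie_inv [OF *(2)] pmovie_inv [OF *(1)]]
    by (simp add: *(5) inv_movie_whisker change_simps [OF False])
qed

lemma std_extend:
  assumes "std n i A j B p" "pmovie n A' a A" "pmovie n B b B'"
  shows "std n i A' j B' (whisker [Pos i] a [] @ p @ whisker [Pos j] b [])"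
proof (cases "i = j")
  case True
  then obtain q where "pmovie n A q B" "p = whisker [Pos i] q []" "i \<in> {1..<n}" using assms by (auto simp: std_def)
  then show ?thesis using True std_sameI [OF _ pmovie_append [OF assms(2) pmovie_append [OF _ assms(3)]], of i q] by simp
next
  case False
  then obtain C q r where *: "pmovie n A q (res i j @ C)" "pmovie n (res j i @ C) r B" "i \<in> {1..<n}" "j \<in> {1..<n}"
    "p = whisker [Pos i] q [] @ [([], change i j, pos C)] @ whisker [Pos j] r []"
    using assms by (auto simp: std_def)
  show ?thesis
    using stdI [OF False *(3,4) pmovie_append [OF assms(2) *(1)] pmovie_append [OF *(2) assms(3)]]
    by (simp add: *(5))
qed

lemma std_single_step:
  assumes "pmovie n (i # A) [s] (j # B)"
  shows "std n i A j B [s]"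
proof -
  obtain a m b where s: "s = (a, m, b)" by (cases s)
  have ij: "i \<in> {1..<n}" "j \<in> {1..<n}" using pmovie_ends [OF assms] by auto
  obtain S T X Y where *: "a = pos X" "b = pos Y" "move_src m = pos S" "move_tgt m = pos T" "i # A = X @ S @ Y"
    "pmovie n (X @ T @ Y) [] (j # B)"
    by (rule pmovie_Cons [OF assms [unfolded s]])
  have m: "braid_move m" "valid_move n m" using assms by (auto simp: s pmovie_def)
  have jB: "j # B = X @ T @ Y" "set Y \<subseteq> {1..<n}" using *(6) by (auto simp: pmovie_Nil)
  show ?thesis
  proof (cases X)
    case Nil
    have "\<exists>k. k \<noteq> i \<and> m = change i k \<and> S = i # res i k \<and> T = k # res k i"
      using m
    proof (cases m)
      case (Exch x y)
      then have "x = i" using * Nil by auto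
      then show ?thesis using m *(3,4) Exch by (auto simp: change_def res_distant)
    next
      case (RIII x y)
      then have "x = i" using * Nil by auto
      moreover from this have "adjacent i y" using m(2) RIII by simp
      ultimately show ?thesis
        using *(3,4) RIII adjacent_not_distant [of i y] res_adjacent [of i y] by (intro exI [of _ y]) (auto simp: change_def)
    qed auto
    then obtain k where k: "k \<noteq> i" "m = change i k" "S = i # res i k" "T = k # res k i" by blast
    have eq: "k = j" "B = res j i @ Y" "A = res i j @ Y" using jB * k Nil by auto
    have "set A \<subseteq> {1..<n}" "set B \<subseteq> {1..<n}" using pmovie_ends [OF assms] by auto
    then show ?thesis
      using stdI [OF _ ij, of A "[]" Y "[]" B] k eq * Nil s by (auto simp: pmovie_Nil)
  next
    case (Cons x X')
    have eq: "x = i" "x = j" "A = X' @ S @ Y" "B = X' @ T @ Y" using Cons * jB by auto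
    have "pmovie n A [(pos X', m, b)] B"
      using assms eq * s Cons by (auto simp: pmovie_def)
    then show ?thesis using std_sameI [OF ij(1)] s * Cons eq by fastforce
  qed
qed

definition coherent :: "nat \<Rightarrow> nat \<Rightarrow> bool" where
  "coherent n l \<longleftrightarrow> (\<forall>A B p q. length A = l \<longrightarrow> pmovie n A p B \<longrightarrow> pmovie n A q B \<longrightarrow> movie_equiv n (pos A) (pos B) p q)"

lemma coherentD: "coherent n (length A) \<Longrightarrow> pmovie n A p B \<Longrightarrow> pmovie n A q B \<Longrightarrow> movie_equiv n (pos A) (pos B) p q"
  by (simp add: coherent_def)

lemma equiv_cons: "movie_equiv n u v p q \<Longrightarrow> x \<in> letters n \<Longrightarrow> movie_equiv n (x # u) (x # v) (whisker [x] p []) (whisker [x] q [])"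
  using equiv_whisker [of n u v p q "[x]" "[]"] by simp

text \<open>Two standard movies replace the first letter in front of words \<open>C\<close> and \<open>D\<close>, which are equivalent by left
  cancellation. A movie from \<open>C\<close> to \<open>D\<close> can be slid past the move that replaces the first letter, and
  what is left are movies of shorter words.\<close>

lemma std_unique:
  assumes coh: "coherent n (length A)" and p: "std n i A j B p" and q: "std n i A j B q"
  shows "movie_equiv n (pos (i # A)) (pos (j # B)) p q"
proof (cases "i = j")
  case True
  then show ?thesis using p q coherentD [OF coh] equiv_cons [of n "pos A" "pos B" _ _ "Pos i"]
    by (auto simp: std_def Pos_letters)
next
  case False
  obtain C p1 p2 where C: "pmovie n A p1 (res i j @ C)" "pmovie n (res j i @ C) p2 B" "i \<in> {1..<n}" "j \<in> {1..<n}"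
    "p = whisker [Pos i] p1 [] @ [([], change i j, pos C)] @ whisker [Pos j] p2 []"
    using p False by (auto simp: std_def)
  obtain D q1 q2 where D: "pmovie n A q1 (res i j @ D)" "pmovie n (res j i @ D) q2 B"
    "q = whisker [Pos i] q1 [] @ [([], change i j, pos D)] @ whisker [Pos j] q2 []"
    using q False by (auto simp: std_def)
  have sets: "set C \<subseteq> {1..<n}" "set D \<subseteq> {1..<n}" "set (res i j) \<subseteq> {1..<n}" "set (res j i) \<subseteq> {1..<n}"
    using pmovie_ends [OF C(1)] pmovie_ends [OF D(1)] pmovie_ends [OF C(2)] by auto
  have "C \<approx> D"
    using artin_cancel_list [OF artin_trans [OF artin_sym [OF pmovie_artin [OF C(1)]] pmovie_artin [OF D(1)]]] .
  then obtain r where r: "pmovie n C r D" using artin_pmovie sets by blast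
  let ?ri = "whisker (pos (res i j)) r []" and ?rj = "whisker (pos (res j i)) r []"
  have ri: "pmovie n (res i j @ C) ?ri (res i j @ D)" and rj: "pmovie n (res j i @ C) ?rj (res j i @ D)"
    using pmovie_whisker [OF r sets(3), of "[]"] pmovie_whisker [OF r sets(4), of "[]"] by auto
  have len: "length (res j i @ C) = length A"
    using std_length [OF p] artin_length [OF pmovie_artin [OF C(2)]] by simp
  have e1: "movie_equiv n (pos A) (pos (res i j @ D)) (p1 @ ?ri) q1"
    by (rule coherentD [OF coh pmovie_append [OF C(1) ri] D(1)])
  have e2: "movie_equiv n (pos (res j i @ C)) (pos B) p2 (?rj @ q2)"
    by (rule coherentD [OF _ C(2) pmovie_append [OF rj D(2)]]) (use coh len in simp)
  have e1': "movie_equiv n (pos (i # A)) (pos (i # res i j @ D)) (whisker [Pos i] p1 [] @ whisker [Pos i] ?ri []) (whisker [Pos i] q1 [])"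
    using equiv_cons [OF e1, of "Pos i"] C(3) by (simp add: Pos_letters)
  let ?c = "change i j"
  have cC: "movie n (pos (i # res i j @ C)) [([], ?c, pos C)] (pos (j # res j i @ C))"
    and cD: "movie n (pos (i # res i j @ D)) [([], ?c, pos D)] (pos (j # res j i @ D))"
    using change_pmovie [OF False C(3,4)] sets pmovie_movie by blast+
  have p1: "movie n (pos (i # A)) (whisker [Pos i] p1 []) (pos (i # res i j @ C))"
    and q2: "movie n (pos (j # res j i @ D)) (whisker [Pos j] q2 []) (pos (j # B))"
    using pmovie_movie [OF pmovie_cons [OF C(1,3)]] pmovie_movie [OF pmovie_cons [OF D(2) C(4)]] .
  have nat: "movie_equiv n (pos (i # res i j @ C)) (pos (j # res j i @ D))
      ([([], ?c, pos C)] @ whisker [Pos j] ?rj []) (whisker [Pos i] ?ri [] @ [([], ?c, pos D)])"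
    using interchange_step_movie [OF pmovie_movie [OF r], of "[]" "[]" ?c] C(3,4) by (simp add: change_simps [OF False])
  have "movie_equiv n (pos (i # A)) (pos (j # B)) p
      ((whisker [Pos i] p1 [] @ [([], ?c, pos C)]) @ whisker [Pos j] (?rj @ q2) [])"
    unfolding C(5) append_assoc [symmetric]
    by (rule equiv_append1 [OF _ movie_appendI [OF p1 cC]]) (use equiv_cons [OF e2] C(4) in \<open>simp add: Pos_letters\<close>)
  also have "movie_equiv n (pos (i # A)) (pos (j # B)) \<dots>
      (whisker [Pos i] p1 [] @ (whisker [Pos i] ?ri [] @ [([], ?c, pos D)]) @ whisker [Pos j] q2 [])"
    using equiv_middle [OF nat p1 q2] by simp
  also have "movie_equiv n (pos (i # A)) (pos (j # B)) \<dots> q"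
    using equiv_append2 [OF e1' movie_appendI [OF cD q2]] D(3) by simp
  finally show ?thesis .
qed

subsection \<open>Triangles of standard movies\<close>

definition triangle :: "nat \<Rightarrow> nat \<Rightarrow> nat \<Rightarrow> nat \<Rightarrow> nat \<Rightarrow> bool" where
  "triangle n l i j k \<longleftrightarrow> (\<forall>A B D p q r. length A = l \<longrightarrow> std n i A j B p \<longrightarrow> std n j B k D q \<longrightarrow> std n k D i A r
     \<longrightarrow> movie_equiv n (pos (i # A)) (pos (i # A)) (p @ q @ r) [])"

lemmas std_movie = pmovie_movie [OF std_pmovie]

lemma triangle_rotate:
  assumes "triangle n l i j k"
  shows "triangle n l j k i"
  unfolding triangle_def
proof (intro allI impI)
  fix B D A q r p
  assume len: "length B = l" and q: "std n j B k D q" and r: "std n k D i A r" and p: "std n i A j B p"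
  have "length A = l" using std_length [OF p] len by simp
  then have "movie_equiv n (pos (i # A)) (pos (i # A)) (p @ q @ r) []"
    using assms p q r unfolding triangle_def by blast
  then have "movie_equiv n (pos (i # A)) (pos (j # B)) (p @ (q @ r @ p)) (p @ [])"
    using equiv_append2 [OF _ std_movie [OF p]] by fastforce
  then show "movie_equiv n (pos (j # B)) (pos (j # B)) (q @ r @ p) []"
    by (rule equiv_cancel_left [OF _ std_movie [OF p]])
qed

lemma triangle_reverse:
  assumes "triangle n l i j k"
  shows "triangle n l i k j"
  unfolding triangle_def
proof (intro allI impI)
  fix A D B r q p
  assume len: "length A = l" and "std n i A k D r" "std n k D j B q" "std n j B i A p"
  then have "movie_equiv n (pos (i # A)) (pos (i # A)) (inv_movie p @ inv_movie q @ inv_movie r) []"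
    using assms std_inv unfolding triangle_def by blast
  from equiv_inv [OF this] show "movie_equiv n (pos (i # A)) (pos (i # A)) (r @ q @ p) []"
    by simp
qed

text \<open>The loop, followed by a word \<open>F\<close>, is a composite of three standard movies which is the identity by the
  Zamolodzhikov relation. Any other three standard movies with the same first letters are conjugate to
  these, since standard movies are determined by their ends.\<close>

lemma triangle_loop:
  assumes ijk: "i \<noteq> j" "j \<noteq> k" "k \<noteq> i" "{i, j, k} \<subseteq> {1..<n}"
    and P: "pmovie n (res i k @ C3) P1 (res i j @ C1)" "pmovie n (res j i @ C1) P2 (res j k @ C2)" "pmovie n (res k j @ C2) P3 (res k i @ C3)"
    and loop: "zamolodzhikov_loop n {i, j, k} (whisker [Pos i] P1 [] @ [([], change i j, pos C1)] @
      whisker [Pos j] P2 [] @ [([], change j k, pos C2)] @ whisker [Pos k] P3 [] @ [([], change k i, pos C3)])"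
    and start: "\<And>A B D. \<lbrakk>i # A \<approx> j # B; j # B \<approx> k # D\<rbrakk> \<Longrightarrow> \<exists>F. i # A \<approx> i # res i k @ C3 @ F"
    and coh: "coherent n l"
  shows "triangle n l i j k"
  unfolding triangle_def
proof (intro allI impI)
  fix A B D p q r
  assume len: "length A = l" and p: "std n i A j B p" and q: "std n j B k D q" and r: "std n k D i A r"
  have ends: "i \<in> {1..<n}" "j \<in> {1..<n}" "k \<in> {1..<n}" using ijk by auto
  have ABD: "i # A \<approx> j # B" "j # B \<approx> k # D" using pmovie_artin std_pmovie p q by blast+
  obtain F where F: "i # A \<approx> i # res i k @ C3 @ F" using start [OF ABD] by blast
  have sA: "set A \<subseteq> {1..<n}" "set B \<subseteq> {1..<n}" "set D \<subseteq> {1..<n}"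
    using pmovie_ends [OF std_pmovie [OF p]] pmovie_ends [OF std_pmovie [OF q]] by auto
  then have sF: "set F \<subseteq> {1..<n}" using artin_set [OF F] ends by auto
  let ?X = "res i k @ C3 @ F" and ?Y = "res j i @ C1 @ F" and ?Z = "res k j @ C2 @ F"
  let ?P = "\<lambda>P. whisker [] P (pos F)"
  have PF: "pmovie n ?X (?P P1) (res i j @ C1 @ F)" "pmovie n ?Y (?P P2) (res j k @ C2 @ F)"
    "pmovie n ?Z (?P P3) (res k i @ C3 @ F)"
    using pmovie_whisker [OF P(1), of "[]" F] pmovie_whisker [OF P(2), of "[]" F] pmovie_whisker [OF P(3), of "[]" F] sF
    by simp_all
  have nil: "pmovie n ?X [] ?X" "pmovie n ?Y [] ?Y" "pmovie n ?Z [] ?Z"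
    using pmovie_ends [OF PF(1)] pmovie_ends [OF PF(2)] pmovie_ends [OF PF(3)] unfolding pmovie_Nil by blast+
  define p' where "p' = whisker [Pos i] (?P P1) [] @ [([], change i j, pos (C1 @ F))]"
  define q' where "q' = whisker [Pos j] (?P P2) [] @ [([], change j k, pos (C2 @ F))]"
  define r' where "r' = whisker [Pos k] (?P P3) [] @ [([], change k i, pos (C3 @ F))]"
  have p': "std n i ?X j ?Y p'" and q': "std n j ?Y k ?Z q'" and r': "std n k ?Z i ?X r'"
    using stdI [OF ijk(1) ends(1,2) PF(1) nil(2)] stdI [OF ijk(2) ends(2,3) PF(2) nil(3)] stdI [OF ijk(3) ends(3,1) PF(3) nil(1)]
    by (simp_all add: p'_def q'_def r'_def)
  have loop': "movie_equiv n (pos (i # ?X)) (pos (i # ?X)) (p' @ q' @ r') []"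
  proof -
    let ?L = "whisker [Pos i] P1 [] @ [([], change i j, pos C1)] @
      whisker [Pos j] P2 [] @ [([], change j k, pos C2)] @ whisker [Pos k] P3 [] @ [([], change k i, pos C3)]"
    have "movie_move n ?L []"
      by (rule movie_move.zamolodzhikov [OF ijk(4) _ loop]) (use ijk in simp)
    moreover have "whisker [] ?L (pos F) = p' @ q' @ r'"
      by (simp add: p'_def q'_def r'_def)
    moreover have "movie n (pos (i # ?X)) (p' @ q' @ r') (pos (i # ?X))"
      by (intro movie_appendI [OF std_movie [OF p'] movie_appendI [OF std_movie [OF q'] std_movie [OF r']]])
    moreover have "movie n (pos (i # ?X)) [] (pos (i # ?X))"
      using movie_ends [OF std_movie [OF p']] by simp
    ultimately show ?thesis using equiv_moveI [of n ?L "[]" "pos (i # ?X)" "[]" "pos F" "pos (i # ?X)"] by simp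
  qed
  have AX: "A \<approx> ?X" using artin_cancel F by blast
  have "j # B \<approx> j # ?Y" by (rule artin_trans [OF artin_sym [OF ABD(1)] artin_trans [OF F pmovie_artin [OF std_pmovie [OF p']]]])
  then have BY: "B \<approx> ?Y" by (rule artin_cancel)
  have "k # D \<approx> k # ?Z"
    by (rule artin_trans [OF artin_sym [OF ABD(2)] artin_trans [OF artin_cons [OF BY] pmovie_artin [OF std_pmovie [OF q']]]])
  then have DZ: "D \<approx> ?Z" by (rule artin_cancel)
  obtain \<alpha> \<beta> \<delta> where movies: "pmovie n A \<alpha> ?X" "pmovie n B \<beta> ?Y" "pmovie n D \<delta> ?Z"
    using artin_pmovie AX BY DZ sA by meson
  let ?\<alpha> = "whisker [Pos i] \<alpha> []" and ?\<beta> = "whisker [Pos j] \<beta> []" and ?\<delta> = "whisker [Pos k] \<delta> []"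
  have m: "movie n (pos (i # A)) ?\<alpha> (pos (i # ?X))" "movie n (pos (j # B)) ?\<beta> (pos (j # ?Y))" "movie n (pos (k # D)) ?\<delta> (pos (k # ?Z))"
    using pmovie_movie [OF pmovie_cons [OF movies(1) ends(1)]] pmovie_movie [OF pmovie_cons [OF movies(2) ends(2)]]
      pmovie_movie [OF pmovie_cons [OF movies(3) ends(3)]] .
  have nilA: "pmovie n A [] A" "pmovie n B [] B" "pmovie n D [] D" using sA by (auto simp: pmovie_Nil)
  have lens: "length A = l" "length B = l" "length D = l" using len std_length [OF p] std_length [OF q] by auto
  have e1: "movie_equiv n (pos (i # A)) (pos (j # ?Y)) (p @ ?\<beta>) (?\<alpha> @ p')"
    using std_unique [of n A, OF _ std_extend [OF p nilA(1) movies(2)] std_extend [OF p' movies(1) nil(2)]] coh lens by simp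
  have e2: "movie_equiv n (pos (j # B)) (pos (k # ?Z)) (q @ ?\<delta>) (?\<beta> @ q')"
    using std_unique [of n B, OF _ std_extend [OF q nilA(2) movies(3)] std_extend [OF q' movies(2) nil(3)]] coh lens by simp
  have e3: "movie_equiv n (pos (k # D)) (pos (i # ?X)) (r @ ?\<alpha>) (?\<delta> @ r')"
    using std_unique [of n D, OF _ std_extend [OF r nilA(3) movies(1)] std_extend [OF r' movies(3) nil(1)]] coh lens by simp
  note sm = std_movie [OF p] std_movie [OF q] std_movie [OF r] std_movie [OF p'] std_movie [OF q'] std_movie [OF r']
  have "movie_equiv n (pos (i # A)) (pos (i # ?X)) (p @ q @ r @ ?\<alpha>) (p @ q @ ?\<delta> @ r')"
    by (rule equiv_append1 [OF equiv_append1 [OF e3 sm(2)] sm(1)])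
  also have "movie_equiv n (pos (i # A)) (pos (i # ?X)) \<dots> (p @ ?\<beta> @ q' @ r')"
    using equiv_middle [OF e2 sm(1,6)] by simp
  also have "movie_equiv n (pos (i # A)) (pos (i # ?X)) \<dots> (?\<alpha> @ p' @ q' @ r')"
    using equiv_append2 [OF e1 movie_appendI [OF sm(5,6)]] by simp
  also have "movie_equiv n (pos (i # A)) (pos (i # ?X)) \<dots> (?\<alpha> @ [])"
    by (rule equiv_append1 [OF loop' m(1)])
  finally have "movie_equiv n (pos (i # A)) (pos (i # ?X)) ((p @ q @ r) @ ?\<alpha>) ([] @ ?\<alpha>)" by simp
  then show "movie_equiv n (pos (i # A)) (pos (i # A)) (p @ q @ r) []"
    by (rule equiv_cancel_right [OF _ m(1) movie_appendI [OF sm(1) movie_appendI [OF sm(2,3)]]])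
       (use movie_ends [OF sm(1)] in simp)
qed

lemma triangle_cube:
  assumes ijk: "{i, j, k} \<subseteq> {1..<n}" "distant i j" "distant j k" "distant i k" and coh: "coherent n l"
  shows "triangle n l i j k"
proof (rule triangle_loop [where ?C1.0 = "[k]" and ?C2.0 = "[i]" and ?C3.0 = "[j]" and ?P1.0 = "[([], Exch k j, [])]"
    and ?P2.0 = "[([], Exch i k, [])]" and ?P3.0 = "[([], Exch j i, [])]", OF _ _ _ ijk(1) _ _ _ _ _ coh])
  note d = ijk(2-4) ijk(2-4) [THEN distant_sym]
  note res = ijk(2-4) [THEN res_distant]
  have mem: "i \<in> {1..<n}" "j \<in> {1..<n}" "k \<in> {1..<n}" using ijk(1) by auto
  show "i \<noteq> j" "j \<noteq> k" "k \<noteq> i" using d by auto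
  show "pmovie n (res i k @ [j]) [([], Exch k j, [])] (res i j @ [k])"
    "pmovie n (res j i @ [k]) [([], Exch i k, [])] (res j k @ [i])"
    "pmovie n (res k j @ [i]) [([], Exch j i, [])] (res k i @ [j])"
    using mem d by (simp_all add: res pmovie_def Pos_letters)
  show "zamolodzhikov_loop n {i, j, k} (whisker [Pos i] [([], Exch k j, [])] [] @ [([], change i j, pos [k])] @
      whisker [Pos j] [([], Exch i k, [])] [] @ [([], change j k, pos [i])] @ whisker [Pos k] [([], Exch j i, [])] [] @
      [([], change k i, pos [j])])"
    using zamolodzhikov_cube [OF mem ijk(2-4)] d by (simp add: change_def)
  fix A B D assume "i # A \<approx> j # B" "j # B \<approx> k # D"
  then obtain F where F: "i # A \<approx> [i, j, k] @ F" using cube_word ijk(2-4) by blast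
  have "i # A \<approx> i # k # j # F"
    by (rule artin_trans [OF F]) (simp add: artin_cons [OF artin_comm [OF d(2)]])
  then show "\<exists>F. i # A \<approx> i # res i k @ [j] @ F" by (auto simp: res)
qed

lemma triangle_prism:
  assumes ik: "{i, Suc i, k} \<subseteq> {1..<n}" "distant i k" "distant (Suc i) k" and coh: "coherent n l"
  shows "triangle n l i k (Suc i)"
proof (rule triangle_loop [where ?C1.0 = "[Suc i, i]" and ?C2.0 = "[i, Suc i]" and ?C3.0 = "[k]"
    and ?P1.0 = "[([Pos (Suc i)], Exch i k, []), ([], Exch (Suc i) k, [Pos i])]"
    and ?P2.0 = "[([], RIII i (Suc i), [])]" and ?P3.0 = "[([], Exch k i, [Pos (Suc i)]), ([Pos i], Exch k (Suc i), [])]", OF _ _ _ _ _ _ _ _ _ coh])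
  note d = ik(2,3) ik(2,3) [THEN distant_sym]
  have a: "adjacent i (Suc i)" by (simp add: adjacent_def)
  note a = a adjacent_sym [OF a] adjacent_not_distant [OF a] adjacent_not_distant [OF adjacent_sym [OF a]]
  note res = ik(2,3) [THEN res_distant] a(1) [THEN res_adjacent]
  have mem: "i \<in> {1..<n}" "Suc i \<in> {1..<n}" "k \<in> {1..<n}" using ik(1) by auto
  show "i \<noteq> k" "k \<noteq> Suc i" "Suc i \<noteq> i" using d by auto
  show "{i, k, Suc i} \<subseteq> {1..<n}" using mem by blast
  show "pmovie n (res i (Suc i) @ [k]) [([Pos (Suc i)], Exch i k, []), ([], Exch (Suc i) k, [Pos i])] (res i k @ [Suc i, i])"
    "pmovie n (res k i @ [Suc i, i]) [([], RIII i (Suc i), [])] (res k (Suc i) @ [i, Suc i])"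
    "pmovie n (res (Suc i) k @ [i, Suc i]) [([], Exch k i, [Pos (Suc i)]), ([Pos i], Exch k (Suc i), [])] (res (Suc i) i @ [k])"
    using mem d a by (simp_all add: res pmovie_def Pos_letters)
  have I: "{i, k, Suc i} = {i, Suc i, k}" by blast
  show "zamolodzhikov_loop n {i, k, Suc i} (whisker [Pos i] [([Pos (Suc i)], Exch i k, []), ([], Exch (Suc i) k, [Pos i])] [] @
      [([], change i k, pos [Suc i, i])] @ whisker [Pos k] [([], RIII i (Suc i), [])] [] @ [([], change k (Suc i), pos [i, Suc i])] @
      whisker [Pos (Suc i)] [([], Exch k i, [Pos (Suc i)]), ([Pos i], Exch k (Suc i), [])] [] @ [([], change (Suc i) i, pos [k])])"
    using zamolodzhikov_prism [OF mem ik(2,3)] d a unfolding I by (simp add: change_def)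
  fix A B D assume AB: "i # A \<approx> k # B" and BD: "k # B \<approx> Suc i # D"
  have "\<exists>F. i # A \<approx> [i, Suc i, i, k] @ F"
    using prism_word [OF artin_trans [OF AB BD] artin_sym [OF BD]] d a by blast
  then show "\<exists>F. i # A \<approx> i # res i (Suc i) @ [k] @ F" by (auto simp: res)
qed

lemma triangle_permutohedron:
  assumes I: "{i, Suc i, Suc (Suc i)} \<subseteq> {1..<n}" and coh: "coherent n l"
  shows "triangle n l i (Suc (Suc i)) (Suc i)"
proof -
  define b c where "b = Suc i" and "c = Suc (Suc i)"
  let ?P1 = "[([Pos b], Exch i c, [Pos b, Pos i]), ([Pos b, Pos c], RIII i b, []), ([], RIII b c, [Pos i, Pos b])]"
  let ?P2 = "[([Pos i, Pos b], Exch c i, [Pos b]), ([], RIII i b, [Pos c, Pos b]), ([Pos b, Pos i], RIII b c, []), ([Pos b], Exch i c, [Pos b, Pos c])]"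
  let ?P3 = "[([Pos c], RIII b i, [Pos c]), ([], Exch c i, [Pos b, Pos i, Pos c]), ([Pos i, Pos c, Pos b], Exch i c, []), ([Pos i], RIII c b, [Pos i])]"
  have a: "adjacent i b" "adjacent b c" and d: "distant i c" by (simp_all add: adjacent_def distant_def b_def c_def)
  note a = a a [THEN adjacent_sym] a [THEN adjacent_not_distant] a [THEN adjacent_sym, THEN adjacent_not_distant]
  note d = d distant_sym [OF d]
  note res = d(1) [THEN res_distant] a(1,2) [THEN res_adjacent]
  have mem: "i \<in> {1..<n}" "b \<in> {1..<n}" "c \<in> {1..<n}" using I by (auto simp: b_def c_def)
  have "triangle n l i c b"
  proof (rule triangle_loop [where ?C1.0 = "[b, c, i, b]" and ?C2.0 = "[i, b, c]" and ?C3.0 = "[c, b, i]"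
    and ?P1.0 = ?P1 and ?P2.0 = ?P2 and ?P3.0 = ?P3, OF _ _ _ _ _ _ _ _ _ coh])
    show "i \<noteq> c" "c \<noteq> b" "b \<noteq> i" by (auto simp: b_def c_def)
    show "{i, c, b} \<subseteq> {1..<n}" using mem by blast
    show "pmovie n (res i b @ [c, b, i]) ?P1 (res i c @ [b, c, i, b])"
      "pmovie n (res c i @ [b, c, i, b]) ?P2 (res c b @ [i, b, c])"
      "pmovie n (res b c @ [i, b, c]) ?P3 (res b i @ [c, b, i])"
      using mem d a by (simp_all add: res pmovie_def Pos_letters)
    have I: "{i, c, b} = {i, b, c}" by blast
    show "zamolodzhikov_loop n {i, c, b} (whisker [Pos i] ?P1 [] @ [([], change i c, pos [b, c, i, b])] @
      whisker [Pos c] ?P2 [] @ [([], change c b, pos [i, b, c])] @ whisker [Pos b] ?P3 [] @ [([], change b i, pos [c, b, i])])"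
      using zamolodzhikov_permutohedron [OF assms(1), folded c_def, folded b_def] d a
      unfolding I by (simp add: change_def)
    fix A B D assume AB: "i # A \<approx> c # B" and BD: "c # B \<approx> b # D"
    have "\<exists>F. i # A \<approx> [i, b, i, c, b, i] @ F"
      using permutohedron_word [OF artin_trans [OF AB BD] artin_sym [OF BD]] d a by blast
    then show "\<exists>F. i # A \<approx> i # res i b @ [c, b, i] @ F" by (auto simp: res)
  qed
  then show ?thesis unfolding b_def c_def .
qed

text \<open>The triangle relation is invariant under permutations of the three letters, so that they may be assumed
  to be increasing. Then it depends on which of them are neighbours.\<close>

lemma triangle_all:
  assumes coh: "coherent n l" and ijk: "{i, j, k} \<subseteq> {1..<n}" "i \<noteq> j" "j \<noteq> k" "i \<noteq> k"
  shows "triangle n l i j k"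
proof -
  have sorted: "triangle n l i j k" if less: "i < j" "j < k" and sub: "{i, j, k} \<subseteq> {1..<n}" for i j k
  proof -
    consider "j = Suc i" "k = Suc (Suc i)" | "j = Suc i" "distant i k" "distant (Suc i) k"
      | "k = Suc j" "distant j i" "distant (Suc j) i" | "distant i j" "distant j k" "distant i k"
      using less unfolding distant_def by fastforce
    then show ?thesis
    proof cases
      case 1
      then show ?thesis using triangle_reverse [OF triangle_permutohedron [OF _ coh, of i]] sub by simp
    next
      case 2
      then show ?thesis using triangle_reverse [OF triangle_prism [OF _ 2(2,3) coh]] sub by simp
    next
      case 3
      have "{j, Suc j, i} \<subseteq> {1..<n}" using sub 3(1) by blast
      from triangle_rotate [OF triangle_prism [OF this 3(2,3) coh]] show ?thesis
        using 3(1) triangle_reverse triangle_rotate by blast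
    next
      case 4
      then show ?thesis using triangle_cube [OF sub _ _ _ coh] by blast
    qed
  qed
  consider "i < j" "j < k" | "i < k" "k < j" | "j < i" "i < k" | "j < k" "k < i" | "k < i" "i < j" | "k < j" "j < i"
    using ijk(2-4) by linarith
  then show ?thesis
  proof cases
    case 1 then show ?thesis using sorted [of i j k] ijk(1) by blast
  next
    case 2 then show ?thesis using triangle_reverse [OF sorted [of i k j]] ijk(1) by blast
  next
    case 3 then show ?thesis using triangle_rotate [OF triangle_reverse [OF triangle_rotate [OF triangle_rotate [OF sorted [of j i k]]]]] ijk(1)
      triangle_rotate [OF triangle_rotate [OF triangle_reverse [OF sorted [of j i k]]]] triangle_reverse [OF triangle_rotate [OF sorted [of j i k]]] by blast
  next
    case 4 then show ?thesis using triangle_rotate [OF triangle_rotate [OF sorted [of j k i]]] ijk(1) by blast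
  next
    case 5 then show ?thesis using triangle_rotate [OF sorted [of k i j]] ijk(1) by blast
  next
    case 6 then show ?thesis using triangle_reverse [OF triangle_rotate [OF triangle_rotate [OF sorted [of k j i]]]] ijk(1) by blast
  qed
qed

lemma std_comp:
  assumes coh: "coherent n (length A)" and p: "std n i A j B p" and q: "std n j B k D q" and r: "std n i A k D r"
  shows "movie_equiv n (pos (i # A)) (pos (k # D)) (p @ q) r"
proof -
  have len: "length B = length A" "length D = length A" using std_length [OF p] std_length [OF r] by auto
  have nil: "pmovie n A [] A" "pmovie n B [] B" "pmovie n D [] D"
    using pmovie_ends [OF std_pmovie [OF p]] pmovie_ends [OF std_pmovie [OF q]] by (auto simp: pmovie_Nil)
  consider "i = j" | "j = k" | "i = k" "i \<noteq> j" | "i \<noteq> j" "j \<noteq> k" "i \<noteq> k" by blast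
  then show ?thesis
  proof cases
    case 1
    then obtain p' where p': "pmovie n A p' B" "p = whisker [Pos i] p' []" using p by (auto simp: std_def)
    have "std n i A k D (p @ q)" using std_extend [OF q p'(1) nil(3)] 1 p'(2) by simp
    then show ?thesis using std_unique [OF coh _ r] by blast
  next
    case 2
    then obtain q' where q': "pmovie n B q' D" "q = whisker [Pos j] q' []" using q by (auto simp: std_def)
    have "std n i A k D (p @ q)" using std_extend [OF p nil(1) q'(1)] 2 q'(2) by simp
    then show ?thesis using std_unique [OF coh _ r] by blast
  next
    case 3
    then obtain r' where r': "pmovie n A r' D" "r = whisker [Pos i] r' []" using r by (auto simp: std_def)
    have "std n j B k D (inv_movie p @ r)" using std_extend [OF std_inv [OF p] nil(2) r'(1)] 3(1) r'(2) by simp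
    then have "movie_equiv n (pos (j # B)) (pos (k # D)) q (inv_movie p @ r)" using std_unique [OF _ q] coh len by simp
    from equiv_append1 [OF this std_movie [OF p]]
    have "movie_equiv n (pos (i # A)) (pos (k # D)) (p @ q) ((p @ inv_movie p) @ r)" by simp
    also have "movie_equiv n (pos (i # A)) (pos (k # D)) ((p @ inv_movie p) @ r) ([] @ r)"
      by (rule equiv_append2 [OF equiv_inv_right [OF std_movie [OF p]] std_movie [OF r]])
    finally show ?thesis by simp
  next
    case 4
    have "{i, j, k} \<subseteq> {1..<n}" using p q by (auto simp: std_def)
    then have "triangle n (length A) i j k" using triangle_all [OF coh] 4 by blast
    then have "movie_equiv n (pos (i # A)) (pos (i # A)) (p @ q @ inv_movie r) []"
      using p q std_inv [OF r] unfolding triangle_def by blast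
    from equiv_append2 [OF this std_movie [OF r]]
    have 1: "movie_equiv n (pos (i # A)) (pos (k # D)) ((p @ q) @ inv_movie r @ r) r" by simp
    have "movie_equiv n (pos (i # A)) (pos (k # D)) ((p @ q) @ inv_movie r @ r) ((p @ q) @ [])"
      by (rule equiv_append1 [OF equiv_inv_left [OF std_movie [OF r]] movie_appendI [OF std_movie [OF p] std_movie [OF q]]])
    from movie_equiv.trans [OF movie_equiv.sym [OF this] 1] show ?thesis by simp
  qed
qed

text \<open>Each step of a positive movie is a standard movie by itself, and standard movies compose to standard
  ones.\<close>

lemma pmovie_equiv_std:
  assumes coh: "coherent n l" and "pmovie n (i # A) p (k # D)" "std n i A k D r" "length A = l"
  shows "movie_equiv n (pos (i # A)) (pos (k # D)) p r"
  using assms(2-4)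
proof (induction p arbitrary: i A r)
  case Nil
  then have eq: "i = k" "A = D" by (auto simp: pmovie_Nil)
  then obtain r' where r': "pmovie n A r' A" "r = whisker [Pos i] r' []" "i \<in> {1..<n}" using Nil(2) by (auto simp: std_def)
  have "movie_equiv n (pos A) (pos A) [] r'"
    by (rule coherentD [OF _ _ r'(1)]) (use coh Nil(3) pmovie_ends [OF r'(1)] in \<open>auto simp: pmovie_Nil\<close>)
  then show ?case using equiv_cons [of n "pos A" "pos A" "[]" r' "Pos i"] r' eq by (simp add: Pos_letters)
next
  case (Cons s p)
  obtain a m b where s: "s = (a, m, b)" by (cases s)
  obtain E where E: "pmovie n (i # A) [s] E" "pmovie n E p (k # D)"
    using pmovie_Cons [OF Cons.prems(1) [unfolded s]] unfolding s by metis
  have "length E = Suc (length A)" using artin_length [OF pmovie_artin [OF E(1)]] by simp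
  then obtain j B where jB: "E = j # B" "length B = length A" by (cases E) auto
  have st: "std n i A j B [s]" using std_single_step E(1) jB by simp
  obtain q where q: "std n j B k D q"
    using std_exists [OF pmovie_artin [OF E(2) [unfolded jB(1)]]] pmovie_ends [OF E(2)] jB(1) by blast
  have "movie_equiv n (pos (j # B)) (pos (k # D)) p q"
    using Cons.IH [OF E(2) [unfolded jB(1)] q] jB Cons.prems(3) by simp
  from equiv_append1 [OF this std_movie [OF st]]
  have "movie_equiv n (pos (i # A)) (pos (k # D)) ([s] @ p) ([s] @ q)" .
  also have "movie_equiv n (pos (i # A)) (pos (k # D)) ([s] @ q) r"
    by (rule std_comp [OF _ st q Cons.prems(2)]) (use coh Cons.prems(3) in simp)
  finally show ?case by simp
qed

theorem all_coherent: "coherent n l"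
proof (induction l)
  case 0
  have "p = []" if "pmovie n [] p B" for p B
  proof (rule ccontr)
    assume "p \<noteq> []"
    then obtain a m b p' where p: "p = (a, m, b) # p'" by (cases p) auto
    then have "a @ move_src m @ b = []" "braid_move m" using that by (auto simp: pmovie_def)
    then show False by (cases m) auto
  qed
  then show ?case unfolding coherent_def using pmovie_movie movie_equiv.refl
    by (metis length_0_conv)
next
  case (Suc l)
  show ?case unfolding coherent_def
  proof (intro allI impI)
    fix A B p q assume len: "length A = Suc l" and p: "pmovie n A p B" and q: "pmovie n A q B"
    obtain i A' where A: "A = i # A'" "length A' = l" using len by (cases A) auto
    have "length B = Suc l" using artin_length [OF pmovie_artin [OF p]] len by simp
    then obtain k D where B: "B = k # D" by (cases B) auto
    obtain r where r: "std n i A' k D r"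
      using std_exists [OF pmovie_artin [OF p [unfolded A B]]] pmovie_ends [OF p] A(1) by blast
    show "movie_equiv n (pos A) (pos B) p q"
      using pmovie_equiv_std [OF Suc.IH p [unfolded A B] r A(2)] pmovie_equiv_std [OF Suc.IH q [unfolded A B] r A(2)]
      unfolding A B by (blast intro: movie_equiv.trans movie_equiv.sym)
  qed
qed

corollary positive_coherence:
  "pmovie n A p B \<Longrightarrow> pmovie n A q B \<Longrightarrow> movie_equiv n (pos A) (pos B) p q"
  by (rule coherentD [OF all_coherent])

section \<open>The partial action of words on positive words\<close>

text \<open>\<open>canon n w V V' p\<close> says that the action of \<open>w\<close> on the positive word \<open>V\<close> is defined with result \<open>V'\<close> and that
  \<open>p\<close> is one of the resulting movies from \<open>wV\<close> to \<open>V'\<close>. The result is determined up to positive movies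
  only, and this is why it is a relation: a negative letter asks for some way of bringing its index to
  the front.\<close>

fun canon :: "nat \<Rightarrow> word \<Rightarrow> nat list \<Rightarrow> nat list \<Rightarrow> step list \<Rightarrow> bool" where
  "canon n [] V V' p \<longleftrightarrow> pmovie n V p V'"
| "canon n (Pos i # w) V V' p \<longleftrightarrow> i \<in> {1..<n} \<and>
     (\<exists>U q r. canon n w V U q \<and> pmovie n (i # U) r V' \<and> p = whisker [Pos i] q [] @ r)"
| "canon n (Neg i # w) V V' p \<longleftrightarrow> i \<in> {1..<n} \<and>
     (\<exists>U q r. canon n w V U q \<and> pmovie n U r (i # V') \<and>
        p = whisker [Neg i] q [] @ whisker [Neg i] r [] @ [([], Cancel (Neg i), pos V')])"

lemma movie_cons: "movie n u p v \<Longrightarrow> x \<in> letters n \<Longrightarrow> movie n (x # u) (whisker [x] p []) (x # v)"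
  using movie_whisker_left [of n u p v "[x]"] by simp

lemma cancel_movie:
  assumes "i \<in> {1..<n}" "set V \<subseteq> {1..<n}"
  shows "movie n (Neg i # pos (i # V)) [([], Cancel (Neg i), pos V)] (pos V)"
  using movie_step [of n "[]" "Cancel (Neg i)" "pos V"] assms by (simp add: Pos_letters)

lemma canon_movie: "canon n w V V' p \<Longrightarrow> movie n (w @ pos V) p (pos V')"
proof (induction n w V V' p rule: canon.induct)
  case (1 n V V' p)
  then show ?case by (simp add: pmovie_movie)
next
  case (2 n i w V V' p)
  then obtain U q r where *: "i \<in> {1..<n}" "canon n w V U q" "pmovie n (i # U) r V'" "p = whisker [Pos i] q [] @ r"
    by auto
  have "movie n (Pos i # w @ pos V) (whisker [Pos i] q []) (pos (i # U))"
    using movie_cons [OF 2(1) [OF *(2)], of "Pos i"] *(1) by (simp add: Pos_letters)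
  from movie_appendI [OF this pmovie_movie [OF *(3)]] show ?case by (simp add: *(4))
next
  case (3 n i w V V' p)
  then obtain U q r where *: "i \<in> {1..<n}" "canon n w V U q" "pmovie n U r (i # V')"
    "p = whisker [Neg i] q [] @ whisker [Neg i] r [] @ [([], Cancel (Neg i), pos V')]" by auto
  have "set V' \<subseteq> {1..<n}" using pmovie_ends [OF *(3)] by simp
  then show ?case unfolding *(4)
    using movie_appendI [OF movie_cons [OF 3(1) [OF *(2)]] movie_appendI [OF movie_cons [OF pmovie_movie [OF *(3)]] cancel_movie]] *(1)
    by (simp add: Pos_letters)
qed

lemma canon_set: "canon n w V V' p \<Longrightarrow> set V' \<subseteq> {1..<n}"
  using movie_ends [OF canon_movie] by fastforce

lemma cancel_natural:
  assumes "pmovie n V r V'" "i \<in> {1..<n}"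
  shows "movie_equiv n (Neg i # pos (i # V)) (pos V') ([([], Cancel (Neg i), pos V)] @ r)
    (whisker [Neg i, Pos i] r [] @ [([], Cancel (Neg i), pos V')])"
  using interchange_step_movie [OF pmovie_movie [OF assms(1)], of "[]" "[]" "Cancel (Neg i)"] assms(2)
  by (simp add: Pos_letters)

text \<open>The action does not depend on the choices and is natural in the positive word. In the case of a
  negative letter, left cancellation provides the comparison of the results, and positive
  coherence shows that it is compatible with bringing the letter to the front.\<close>

lemma canon_map:
  assumes "canon n w V V' p" "canon n w U U' q" "pmovie n V s U"
  shows "\<exists>r. pmovie n V' r U' \<and> movie_equiv n (w @ pos V) (pos U') (p @ r) (whisker w s [] @ q)"
  using assms
proof (induction w arbitrary: V' p U' q)
  case Nil
  then have p: "pmovie n V p V'" and sq: "pmovie n V (s @ q) U'" using pmovie_append by auto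
  have "pmovie n V' (inv_movie p @ s @ q) U'"
    by (rule pmovie_append [OF pmovie_inv [OF p] sq])
  moreover have "movie_equiv n (pos V) (pos U') (p @ inv_movie p @ s @ q) (s @ q)"
    using equiv_append2 [OF equiv_inv_right [OF pmovie_movie [OF p]] pmovie_movie [OF sq]] by simp
  ultimately show ?case by auto
next
  case (Cons x w)
  have s: "movie n (w @ pos V) (whisker w s []) (w @ pos U)"
    using movie_whisker_left [OF pmovie_movie [OF Cons.prems(3)], of w] movie_ends [OF canon_movie [OF Cons.prems(1)]] by simp
  show ?case
  proof (cases x)
    case (Pos i)
    obtain V1 p1 p2 where p: "canon n w V V1 p1" "pmovie n (i # V1) p2 V'" "p = whisker [Pos i] p1 [] @ p2" and i: "i \<in> {1..<n}"
      using Cons.prems(1) Pos by auto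
    obtain U1 q1 q2 where q: "canon n w U U1 q1" "pmovie n (i # U1) q2 U'" "q = whisker [Pos i] q1 [] @ q2"
      using Cons.prems(2) Pos by auto
    obtain r where r: "pmovie n V1 r U1" "movie_equiv n (w @ pos V) (pos U1) (p1 @ r) (whisker w s [] @ q1)"
      using Cons.IH [OF p(1) q(1) Cons.prems(3)] by blast
    have x: "Pos i \<in> letters n" using i by (simp add: Pos_letters)
    let ?r = "inv_movie p2 @ whisker [Pos i] r [] @ q2"
    have "pmovie n V' ?r U'"
      by (intro pmovie_append [OF pmovie_inv [OF p(2)]] pmovie_append [OF pmovie_cons [OF r(1) i] q(2)])
    moreover have "movie_equiv n (Pos i # w @ pos V) (pos U') (p @ ?r) (whisker [Pos i] p1 [] @ whisker [Pos i] r [] @ q2)"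
    proof -
      have "movie n (Pos i # w @ pos V) (whisker [Pos i] p1 []) (pos (i # V1))"
        using movie_cons [OF canon_movie [OF p(1)] x] by simp
      from equiv_insert_inv [OF this pmovie_movie [OF p(2)] movie_appendI
          [OF pmovie_movie [OF pmovie_cons [OF r(1) i]] pmovie_movie [OF q(2)]]]
      show ?thesis by (simp add: p(3))
    qed
    moreover have "movie_equiv n (Pos i # w @ pos V) (pos U') (whisker [Pos i] p1 [] @ whisker [Pos i] r [] @ q2) (whisker (Pos i # w) s [] @ q)"
      using equiv_append2 [OF equiv_cons [OF r(2) x], of q2 "pos U'"] pmovie_movie [OF q(2)] by (simp add: q(3))
    ultimately show ?thesis using movie_equiv.trans Pos by fastforce
  next
    case (Neg i)
    obtain V1 p1 p2 where p: "canon n w V V1 p1" "pmovie n V1 p2 (i # V')" and i: "i \<in> {1..<n}"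
      and p_eq: "p = whisker [Neg i] p1 [] @ whisker [Neg i] p2 [] @ [([], Cancel (Neg i), pos V')]"
      using Cons.prems(1) Neg by auto
    obtain U1 q1 q2 where q: "canon n w U U1 q1" "pmovie n U1 q2 (i # U')"
      and q_eq: "q = whisker [Neg i] q1 [] @ whisker [Neg i] q2 [] @ [([], Cancel (Neg i), pos U')]"
      using Cons.prems(2) Neg by auto
    obtain r where r: "pmovie n V1 r U1" "movie_equiv n (w @ pos V) (pos U1) (p1 @ r) (whisker w s [] @ q1)"
      using Cons.IH [OF p(1) q(1) Cons.prems(3)] by blast
    have "i # V' \<approx> i # U'"
      by (rule artin_trans [OF artin_sym [OF pmovie_artin [OF p(2)]] artin_trans [OF pmovie_artin [OF r(1)] pmovie_artin [OF q(2)]]])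
    then have "V' \<approx> U'" by (rule artin_cancel)
    then obtain t where t: "pmovie n V' t U'" using artin_pmovie canon_set [OF Cons.prems(1)] by blast
    have x: "Neg i \<in> letters n" using i by (simp add: Pos_letters)
    let ?C = "[([], Cancel (Neg i), pos U')]" and ?x = "\<lambda>p. whisker [Neg i] p []"
    have C: "movie n (Neg i # pos (i # U')) ?C (pos U')" by (rule cancel_movie [OF i canon_set [OF Cons.prems(2)]])
    have m: "movie n (Neg i # w @ pos V) (?x p1) (Neg i # pos V1)" "movie n (Neg i # pos V1) (?x p2) (Neg i # pos (i # V'))"
      "movie n (Neg i # pos U1) (?x q2) (Neg i # pos (i # U'))"
      using movie_cons [OF canon_movie [OF p(1)] x] movie_cons [OF pmovie_movie [OF p(2)] x] movie_cons [OF pmovie_movie [OF q(2)] x] .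
    have e: "movie_equiv n (pos V1) (pos (i # U')) (p2 @ whisker [Pos i] t []) (r @ q2)"
      by (rule positive_coherence [OF pmovie_append [OF p(2) pmovie_cons [OF t i]] pmovie_append [OF r(1) q(2)]])
    have "movie_equiv n (Neg i # w @ pos V) (pos U') (p @ t) ((?x p1 @ ?x p2) @ whisker [Neg i, Pos i] t [] @ ?C)"
      using equiv_append1 [OF cancel_natural [OF t i] movie_appendI [OF m(1,2)]] by (simp add: p_eq)
    also have "movie_equiv n (Neg i # w @ pos V) (pos U') \<dots> (?x p1 @ ?x (r @ q2) @ ?C)"
      using equiv_middle [OF equiv_cons [OF e x] m(1) C] by simp
    also have "movie_equiv n (Neg i # w @ pos V) (pos U') \<dots> (?x (whisker w s [] @ q1) @ ?x q2 @ ?C)"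
      using equiv_append2 [OF equiv_cons [OF r(2) x] movie_appendI [OF m(3) C]] by simp
    finally show ?thesis using t Neg by (auto simp: q_eq)
  qed
qed

lemma canon_split:
  "canon n (a @ w) V V' p \<Longrightarrow> \<exists>U q r. canon n w V U q \<and> canon n a U V' r \<and> p = whisker a q [] @ r"
proof (induction n a V V' p rule: canon.induct)
  case (1 n V V' p)
  have "canon n [] V' V' []" using canon_set [OF 1] by (simp add: pmovie_Nil)
  then show ?case using 1 by fastforce
next
  case (2 n i a V V' p)
  then obtain U q r where *: "i \<in> {1..<n}" "canon n (a @ w) V U q" "pmovie n (i # U) r V'" "p = whisker [Pos i] q [] @ r"
    by auto
  obtain T s t where **: "canon n w V T s" "canon n a T U t" "q = whisker a s [] @ t"
    using 2(1) [OF *(2)] by blast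
  show ?case
    by (rule exI [of _ T], rule exI [of _ s], rule exI [of _ "whisker [Pos i] t [] @ r"]) (use * ** in auto)
next
  case (3 n i a V V' p)
  then obtain U q r where *: "i \<in> {1..<n}" "canon n (a @ w) V U q" "pmovie n U r (i # V')"
    "p = whisker [Neg i] q [] @ whisker [Neg i] r [] @ [([], Cancel (Neg i), pos V')]"
    by auto
  obtain T s t where **: "canon n w V T s" "canon n a T U t" "q = whisker a s [] @ t"
    using 3(1) [OF *(2)] by blast
  show ?case
    by (rule exI [of _ T], rule exI [of _ s], rule exI [of _ "whisker [Neg i] t [] @ whisker [Neg i] r [] @ [([], Cancel (Neg i), pos V')]"])
      (use * ** in auto)
qed

lemma canon_precompose: "canon n w U V' p \<Longrightarrow> pmovie n V s U \<Longrightarrow> \<exists>q. canon n w V V' q"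
proof (induction n w U V' p rule: canon.induct)
  case (1 n U V' p)
  then show ?case using pmovie_append by fastforce
qed fastforce+

lemma canon_positive: "canon n (pos S) V V' p \<Longrightarrow> pmovie n (S @ V) p V'"
proof (induction S arbitrary: V' p)
  case (Cons i S)
  then show ?case using pmovie_append [OF pmovie_cons] by fastforce
qed auto

subsection \<open>Compatibility with moves\<close>

text \<open>The action of the target of the move composed with the move is the action of its source, up to a positive
  movie.\<close>

definition compatible :: "nat \<Rightarrow> move \<Rightarrow> bool" where
  "compatible n m \<longleftrightarrow> (\<forall>V V1 V2 p q. canon n (move_src m) V V1 p \<longrightarrow> canon n (move_tgt m) V V2 q \<longrightarrow>
     (\<exists>r. pmovie n V1 r V2 \<and> movie_equiv n (move_src m @ pos V) (pos V2) (p @ r) ([([], m, pos V)] @ q)))"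

lemma compatible_braid_move:
  assumes "braid_move m" "valid_move n m"
  shows "compatible n m"
  unfolding compatible_def
proof (intro allI impI)
  fix V V1 V2 p q assume p: "canon n (move_src m) V V1 p" and q: "canon n (move_tgt m) V V2 q"
  obtain S T where ST: "move_src m = pos S" "move_tgt m = pos T" by (rule braid_move_words [OF assms])
  have p: "pmovie n (S @ V) p V1" and q: "pmovie n (T @ V) q V2" using p q canon_positive unfolding ST by blast+
  have "set V \<subseteq> {1..<n}" using pmovie_ends [OF p] by simp
  then have m: "pmovie n (S @ V) [([], m, pos V)] (T @ V)"
    using movie_step [of n "[]" m "pos V"] assms ST by (simp add: pmovie_def)
  have "pmovie n V1 (inv_movie p @ [([], m, pos V)] @ q) V2"
    by (intro pmovie_append [OF pmovie_inv [OF p]] pmovie_append [OF m q])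
  moreover have "movie_equiv n (move_src m @ pos V) (pos V2) (p @ inv_movie p @ [([], m, pos V)] @ q) ([([], m, pos V)] @ q)"
    using equiv_append2 [OF equiv_inv_right [OF pmovie_movie [OF p]] pmovie_movie [OF pmovie_append [OF m q]]] by (simp add: ST)
  ultimately show "\<exists>r. pmovie n V1 r V2 \<and> movie_equiv n (move_src m @ pos V) (pos V2) (p @ r) ([([], m, pos V)] @ q)" by blast
qed

lemma compatible_inv:
  assumes "compatible n m" "valid_move n m"
  shows "compatible n (inv_move m)"
  unfolding compatible_def
proof (intro allI impI)
  fix V V1 V2 p q assume p: "canon n (move_src (inv_move m)) V V1 p" and q: "canon n (move_tgt (inv_move m)) V V2 q"
  obtain r where r: "pmovie n V2 r V1" "movie_equiv n (move_src m @ pos V) (pos V1) (q @ r) ([([], m, pos V)] @ p)"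
    using assms(1) [unfolded compatible_def, rule_format, of V V2 q V1 p] p q by auto
  have V: "set V \<subseteq> {1..<n}" using movie_ends [OF canon_movie [OF p]] by simp
  let ?i = "[([], inv_move m, pos V)]"
  have m: "movie n (move_src m @ pos V) [([], m, pos V)] (move_tgt m @ pos V)" "movie n (move_tgt m @ pos V) ?i (move_src m @ pos V)"
    using movie_step [of n "[]" m "pos V"] movie_step [of n "[]" "inv_move m" "pos V"] assms(2) V by simp_all
  have q': "movie n (move_src m @ pos V) q (pos V2)" using canon_movie [OF q] by simp
  have p': "movie n (move_tgt m @ pos V) p (pos V1)" using canon_movie [OF p] by simp
  have "movie_equiv n (move_tgt m @ pos V) (pos V2) (p @ inv_movie r) ((?i @ [([], m, pos V)]) @ p @ inv_movie r)"
    using equiv_append2 [OF equiv_inv_right [OF m(2)] movie_appendI [OF p' movie_inv [OF pmovie_movie [OF r(1)]]], THEN movie_equiv.sym]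
    by simp
  also have "movie_equiv n (move_tgt m @ pos V) (pos V2) \<dots> (?i @ (q @ r) @ inv_movie r)"
    using equiv_middle [OF movie_equiv.sym [OF r(2)] m(2) movie_inv [OF pmovie_movie [OF r(1)]]] by simp
  also have "movie_equiv n (move_tgt m @ pos V) (pos V2) \<dots> ((?i @ q) @ [])"
    using equiv_append1 [OF equiv_inv_right [OF pmovie_movie [OF r(1)]] movie_appendI [OF m(2) q']] by simp
  finally show "\<exists>r. pmovie n V1 r V2 \<and> movie_equiv n (move_src (inv_move m) @ pos V) (pos V2) (p @ r) (?i @ q)"
    using pmovie_inv [OF r(1)] by auto
qed

text \<open>The creation is slid past the movie that brings \<open>i\<close> to the front, where it meets the cancellation in
  the action of the negative letter; the two form a zigzag.\<close>

lemma compatible_create_Pos: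
  assumes i: "i \<in> {1..<n}"
  shows "compatible n (Create (Pos i))"
  unfolding compatible_def
proof (intro allI impI)
  fix V V1 V2 p q assume "canon n (move_src (Create (Pos i))) V V1 p" and q: "canon n (move_tgt (Create (Pos i))) V V2 q"
  then have p: "pmovie n V p V1" by simp
  obtain V3 U q1 q2 q3 where q: "pmovie n V q1 V3" "pmovie n V3 q2 (i # U)" "pmovie n (i # U) q3 V2"
    "q = whisker [Pos i] (whisker [Neg i] q1 [] @ whisker [Neg i] q2 [] @ [([], Cancel (Neg i), pos U)]) [] @ q3"
    using q by auto
  let ?g = "q1 @ q2" and ?c = "\<lambda>X. [([], Create (Pos i), pos X)]"
  have g: "pmovie n V ?g (i # U)" by (rule pmovie_append [OF q(1,2)])
  have U: "set U \<subseteq> {1..<n}" using pmovie_ends [OF q(2)] by simp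
  have "pmovie n V1 (inv_movie p @ ?g @ q3) V2" by (intro pmovie_append [OF pmovie_inv [OF p]] pmovie_append [OF g q(3)])
  moreover have "movie_equiv n (pos V) (pos V2) (p @ inv_movie p @ ?g @ q3) (?c V @ q)"
  proof -
    have zz: "movie_equiv n (pos (i # U)) (pos (i # U)) (?c (i # U) @ [([Pos i], Cancel (Neg i), pos U)]) []"
      using equiv_moveI [OF movie_move.zigzag_left [of n "Pos i"], of "pos (i # U)" "[]" "pos U" "pos (i # U)"] i U
      by (simp add: Pos_letters)
    have nat: "movie_equiv n (pos V) ([Pos i, Neg i] @ pos (i # U)) (?c V @ whisker [Pos i, Neg i] ?g []) (?g @ ?c (i # U))"
      using interchange_step_movie [OF pmovie_movie [OF g], of "[]" "[]" "Create (Pos i)"] i by (simp add: Pos_letters)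
    have m: "movie n ([Pos i, Neg i] @ pos (i # U)) [([Pos i], Cancel (Neg i), pos U)] (pos (i # U))"
      using movie_step [of n "[Pos i]" "Cancel (Neg i)" "pos U"] i U by (simp add: Pos_letters)
    have "movie_equiv n (pos V) (pos V2) (?c V @ q) ((?g @ ?c (i # U)) @ [([Pos i], Cancel (Neg i), pos U)] @ q3)"
      using equiv_append2 [OF nat movie_appendI [OF m pmovie_movie [OF q(3)]]] by (simp add: q(4))
    also have "movie_equiv n (pos V) (pos V2) \<dots> (?g @ [] @ q3)"
      using equiv_middle [OF zz pmovie_movie [OF g] pmovie_movie [OF q(3)]] by simp
    also have "movie_equiv n (pos V) (pos V2) \<dots> (p @ inv_movie p @ ?g @ q3)"
      using equiv_append2 [OF equiv_inv_right [OF pmovie_movie [OF p]] pmovie_movie [OF pmovie_append [OF g q(3)]], THEN movie_equiv.sym]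
      by simp
    finally show ?thesis by (rule movie_equiv.sym)
  qed
  ultimately show "\<exists>r. pmovie n V1 r V2 \<and> movie_equiv n (move_src (Create (Pos i)) @ pos V) (pos V2) (p @ r) (?c V @ q)"
    by auto
qed

text \<open>Multiplication by \<open>i\<close> followed by its removal amounts to a positive movie \<open>h\<close> under the letter \<open>i\<close>, by positive
  coherence. Creation and cancellation then meet directly and are inverse to each other.\<close>

lemma compatible_create_Neg:
  assumes i: "i \<in> {1..<n}"
  shows "compatible n (Create (Neg i))"
  unfolding compatible_def
proof (intro allI impI)
  fix V V1 V2 p q assume "canon n (move_src (Create (Neg i))) V V1 p" and q: "canon n (move_tgt (Create (Neg i))) V V2 q"
  then have p: "pmovie n V p V1" by simp
  obtain V3 U q1 q2 q3 where q: "pmovie n V q1 V3" "pmovie n (i # V3) q2 U" "pmovie n U q3 (i # V2)"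
    "q = whisker [Neg i] (whisker [Pos i] q1 [] @ q2) [] @ whisker [Neg i] q3 [] @ [([], Cancel (Neg i), pos V2)]"
    using q by auto
  let ?g = "whisker [Pos i] q1 [] @ q2 @ q3" and ?c = "[([], Create (Neg i), pos V)]"
    and ?d = "\<lambda>X. [([], Cancel (Neg i), pos X)]"
  have g: "pmovie n (i # V) ?g (i # V2)" by (intro pmovie_append [OF pmovie_cons [OF q(1) i]] pmovie_append [OF q(2,3)])
  have V: "set V \<subseteq> {1..<n}" using pmovie_ends [OF p] by simp
  obtain h where h: "pmovie n V h V2" using artin_pmovie [OF artin_cancel [OF pmovie_artin [OF g]] V] by blast
  have x: "Neg i \<in> letters n" using i by (simp add: Pos_letters)
  have "pmovie n V1 (inv_movie p @ h) V2" by (rule pmovie_append [OF pmovie_inv [OF p] h])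
  moreover have "movie_equiv n (pos V) (pos V2) (p @ inv_movie p @ h) (?c @ q)"
  proof -
    have c: "movie n (pos V) ?c (Neg i # pos (i # V))" "movie n (Neg i # pos (i # V)) (?d V) (pos V)"
      using movie_step [of n "[]" "Create (Neg i)" "pos V"] x V cancel_movie [OF i V] by simp_all
    have "movie_equiv n (pos V) (pos V) (?c @ ?d V) []"
      using equiv_inv_right [OF c(1)] by simp
    from equiv_append2 [OF this pmovie_movie [OF h]]
    have 1: "movie_equiv n (pos V) (pos V2) (?c @ ?d V @ h) h" by simp
    have 2: "movie_equiv n (pos V) (pos V2) (?c @ ?d V @ h) (?c @ whisker [Neg i, Pos i] h [] @ ?d V2)"
      by (rule equiv_append1 [OF cancel_natural [OF h i] c(1)])
    have "movie_equiv n (pos (i # V)) (pos (i # V2)) (whisker [Pos i] h []) ?g"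
      by (rule positive_coherence [OF pmovie_cons [OF h i] g])
    from equiv_middle [OF equiv_cons [OF this x] c(1) cancel_movie [OF i]]
    have 3: "movie_equiv n (pos V) (pos V2) (?c @ whisker [Neg i, Pos i] h [] @ ?d V2) (?c @ q)"
      using pmovie_ends [OF h] by (simp add: q(4))
    have 4: "movie_equiv n (pos V) (pos V2) (p @ inv_movie p @ h) h"
      using equiv_append2 [OF equiv_inv_right [OF pmovie_movie [OF p]] pmovie_movie [OF h]] by simp
    show ?thesis by (rule movie_equiv.trans [OF 4 movie_equiv.trans [OF movie_equiv.sym [OF 1] movie_equiv.trans [OF 2 3]]])
  qed
  ultimately show "\<exists>r. pmovie n V1 r V2 \<and> movie_equiv n (move_src (Create (Neg i)) @ pos V) (pos V2) (p @ r) (?c @ q)"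
    by auto
qed

lemma compatible: "valid_move n m \<Longrightarrow> compatible n m"
proof -
  have create: "compatible n (Create x)" if "x \<in> letters n" for x
    using that compatible_create_Pos compatible_create_Neg by (cases x) (auto simp: Pos_letters)
  assume m: "valid_move n m"
  show ?thesis
  proof (cases m)
    case (Create x)
    then show ?thesis using m create by simp
  next
    case (Cancel x)
    then show ?thesis using m create [of x] compatible_inv [of n "Create x"] by simp
  qed (use m compatible_braid_move in auto)
qed

text \<open>A step \<open>(a, m, b)\<close> is reduced to the move itself: the action of \<open>b\<close> commutes with the move because it takes
  place on a disjoint subword, and the action of \<open>a\<close> is natural.\<close>

lemma canon_step:
  assumes p: "canon n (a @ move_src m @ b) V V' p" and q: "canon n (a @ move_tgt m @ b) V V'' q" and m: "valid_move n m"
  shows "\<exists>r. pmovie n V' r V'' \<and> movie_equiv n (a @ move_src m @ b @ pos V) (pos V'') (p @ r) ([(a, m, b @ pos V)] @ q)"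
proof -
  let ?s = "move_src m" and ?t = "move_tgt m"
  obtain V1 V2 p1 p2 p3 where p: "canon n b V V1 p1" "canon n ?s V1 V2 p2" "canon n a V2 V' p3"
    "p = whisker (a @ ?s) p1 [] @ whisker a p2 [] @ p3"
  proof -
    obtain U s t where 1: "canon n (?s @ b) V U s" "canon n a U V' t" "p = whisker a s [] @ t" using canon_split [OF p] by blast
    obtain T s' t' where 2: "canon n b V T s'" "canon n ?s T U t'" "s = whisker ?s s' [] @ t'" using canon_split [OF 1(1)] by blast
    show thesis by (rule that [OF 2(1,2) 1(2)]) (use 1 2 in simp)
  qed
  obtain U1 U2 q1 q2 q3 where q: "canon n b V U1 q1" "canon n ?t U1 U2 q2" "canon n a U2 V'' q3"
    "q = whisker (a @ ?t) q1 [] @ whisker a q2 [] @ q3"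
  proof -
    obtain U s t where 1: "canon n (?t @ b) V U s" "canon n a U V'' t" "q = whisker a s [] @ t" using canon_split [OF q] by blast
    obtain T s' t' where 2: "canon n b V T s'" "canon n ?t T U t'" "s = whisker ?t s' [] @ t'" using canon_split [OF 1(1)] by blast
    show thesis by (rule that [OF 2(1,2) 1(2)]) (use 1 2 in simp)
  qed
  have aw: "a \<in> words n" "b \<in> words n" "set V \<subseteq> {1..<n}"
    using movie_ends [OF canon_movie [OF p(3)]] movie_ends [OF canon_movie [OF p(1)]] by auto
  have stw: "?s \<in> words n" "?t \<in> words n"
    using movie_ends [OF canon_movie [OF p(2)]] movie_ends [OF canon_movie [OF q(2)]] by auto
  have V: "pmovie n V [] V" using aw by (simp add: pmovie_Nil)
  obtain r1 where r1: "pmovie n V1 r1 U1" "movie_equiv n (b @ pos V) (pos U1) (p1 @ r1) q1"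
    using canon_map [OF p(1) q(1) V] by auto
  obtain q2' where q2': "canon n ?t V1 U2 q2'" using canon_precompose [OF q(2) r1(1)] by blast
  obtain r2 where r2: "pmovie n V2 r2 U2" "movie_equiv n (?s @ pos V1) (pos U2) (p2 @ r2) ([([], m, pos V1)] @ q2')"
    using compatible [OF m] p(2) q2' unfolding compatible_def by blast
  obtain r3 where r3: "pmovie n U2 r3 U2" "movie_equiv n (?t @ pos V1) (pos U2) (q2' @ r3) (whisker ?t r1 [] @ q2)"
    using canon_map [OF q2' q(2) r1(1)] by blast
  obtain r4 where r4: "pmovie n V' r4 V''" "movie_equiv n (a @ pos V2) (pos V'') (p3 @ r4) (whisker a (r2 @ r3) [] @ q3)"
    using canon_map [OF p(3) q(3) pmovie_append [OF r2(1) r3(1)]] by blast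
  have V1: "set V1 \<subseteq> {1..<n}" by (rule canon_set [OF p(1)])
  have m1: "movie n (?s @ pos V1) [([], m, pos V1)] (?t @ pos V1)"
    using movie_step [of n "[]" m "pos V1"] V1 m by simp
  have e: "movie_equiv n (?s @ pos V1) (pos U2) (p2 @ r2 @ r3) ([([], m, pos V1)] @ whisker ?t r1 [] @ q2)"
  proof -
    have "movie_equiv n (?s @ pos V1) (pos U2) (p2 @ r2 @ r3) ([([], m, pos V1)] @ q2' @ r3)"
      using equiv_append2 [OF r2(2) pmovie_movie [OF r3(1)]] by simp
    also have "movie_equiv n (?s @ pos V1) (pos U2) \<dots> ([([], m, pos V1)] @ whisker ?t r1 [] @ q2)"
      by (rule equiv_append1 [OF r3(2) m1])
    finally show ?thesis .
  qed
  let ?P1 = "whisker (a @ ?s) p1 []"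
  have P1: "movie n (a @ ?s @ b @ pos V) ?P1 (a @ ?s @ pos V1)"
    using movie_whisker_left [OF canon_movie [OF p(1)], of "a @ ?s"] aw stw by simp
  have P2: "movie n (a @ ?s @ pos V1) (whisker a p2 []) (a @ pos V2)"
    using movie_whisker_left [OF canon_movie [OF p(2)] aw(1)] .
  have Q2: "movie n (a @ ?t @ pos U1) (whisker a q2 []) (a @ pos U2)"
    using movie_whisker_left [OF canon_movie [OF q(2)] aw(1)] .
  note Q3 = canon_movie [OF q(3)]
  have R1: "movie n (a @ ?t @ pos V1) (whisker (a @ ?t) r1 []) (a @ ?t @ pos U1)"
    using movie_whisker_left [OF pmovie_movie [OF r1(1)], of "a @ ?t"] aw stw by simp
  have M: "movie n (a @ ?s @ b @ pos V) [(a, m, b @ pos V)] (a @ ?t @ b @ pos V)"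
    using movie_step [of n a m "b @ pos V"] aw m by simp
  let ?goal = "\<lambda>p q. movie_equiv n (a @ ?s @ b @ pos V) (pos V'') p q"
  have "?goal (p @ r4) ((?P1 @ whisker a p2 []) @ whisker a (r2 @ r3) [] @ q3)"
    using equiv_append1 [OF r4(2) movie_appendI [OF P1 P2]] by (simp add: p(4))
  also have "?goal \<dots> (?P1 @ whisker a ([([], m, pos V1)] @ whisker ?t r1 [] @ q2) [] @ q3)"
    using equiv_middle [OF equiv_whisker [OF e aw(1), of "[]"], of "a @ ?s @ b @ pos V" ?P1 q3 "pos V''"] P1 Q3 by simp
  also have "?goal \<dots> (([(a, m, b @ pos V)] @ whisker (a @ ?t) p1 []) @ whisker (a @ ?t) r1 [] @ whisker a q2 [] @ q3)"
    using equiv_append2 [OF interchange_step_movie [OF canon_movie [OF p(1)] aw(1), of "[]" m, THEN movie_equiv.sym],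
        of "whisker (a @ ?t) r1 [] @ whisker a q2 [] @ q3" "pos V''"] m movie_appendI [OF R1 movie_appendI [OF Q2 Q3]] by simp
  also have "?goal \<dots> ([(a, m, b @ pos V)] @ whisker (a @ ?t) q1 [] @ whisker a q2 [] @ q3)"
    using equiv_middle [OF equiv_whisker [OF r1(2), of "a @ ?t" "[]"], of "a @ ?s @ b @ pos V" "[(a, m, b @ pos V)]" "whisker a q2 [] @ q3" "pos V''"]
      aw stw M movie_appendI [OF Q2 Q3] by simp
  finally show ?thesis using r4(1) by (auto simp: q(4))
qed

subsection \<open>Powers of the full twist\<close>

text \<open>Every letter of \<open>w\<close> uses up at most one of the \<open>k\<close> full twists. The index of a negative letter is split off
  from one of them, and the remaining ones are moved to the front since they are central.\<close>

lemma canon_exists: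
  assumes "w \<in> words n" "length w \<le> k" "set Y \<subseteq> {1..<n}"
  shows "\<exists>V Z p. canon n w (iterate k (full_twist (n - 1)) @ Y) V p \<and> V \<approx> iterate (k - length w) (full_twist (n - 1)) @ Z"
  using assms(1,2)
proof (induction w rule: list.induct)
  case Nil
  let ?D = "full_twist (n - 1)"
  have "set ?D \<subseteq> {1..<n}" using set_full_twist [of "n - 1"] by fastforce
  then have "pmovie n (iterate k ?D @ Y) [] (iterate k ?D @ Y)" using set_iterate [of k ?D] assms(3) by (auto simp: pmovie_Nil)
  then show ?case by fastforce
next
  case (Cons x w)
  let ?D = "full_twist (n - 1)"
  have D: "set ?D \<subseteq> {1..<n}" using set_full_twist [of "n - 1"] by fastforce
  obtain V Z p where V: "canon n w (iterate k ?D @ Y) V p" "V \<approx> iterate (k - length w) ?D @ Z"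
    using Cons by fastforce
  have sV: "set V \<subseteq> {1..<n}" by (rule canon_set [OF V(1)])
  obtain l where l: "k - length w = Suc l" "k - length (x # w) = l" using Cons.prems(2) by (auto intro: that [of "k - Suc (length w)"])
  have central: "X @ iterate l ?D @ A \<approx> iterate l ?D @ X @ A" if "set X \<subseteq> {1..<n}" for X A
  proof -
    have X: "set X \<subseteq> {1..n - 1}" using that by fastforce
    show ?thesis
    proof (induction l)
      case (Suc l)
      have "X @ iterate (Suc l) ?D @ A \<approx> ?D @ X @ iterate l ?D @ A"
        using full_twist_central_list [OF X, of "iterate l ?D @ A"] by simp
      also have "\<dots> \<approx> ?D @ iterate l ?D @ X @ A" by (rule artin_prepend [OF Suc])
      finally show ?case by simp
    qed simp
  qed
  show ?case
  proof (cases x)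
    case (Pos i)
    then have i: "i \<in> {1..<n}" using Cons.prems(1) by (simp add: Pos_letters)
    have "pmovie n (i # V) [] (i # V)" using i sV by (simp add: pmovie_Nil)
    then have "canon n (x # w) (iterate k ?D @ Y) (i # V) (whisker [Pos i] p [] @ [])"
      unfolding Pos canon.simps using V(1) i by blast
    moreover have "i # V \<approx> iterate l ?D @ (i # ?D @ Z)"
    proof -
      have "iterate (l + 1) ?D = iterate l ?D @ ?D"
        unfolding iterate_add by (simp only: One_nat_def iterate.simps append_Nil2)
      then have "iterate (Suc l) ?D @ Z = iterate l ?D @ ?D @ Z" by (simp only: Suc_eq_plus1 append_assoc)
      then have "i # V \<approx> [i] @ iterate l ?D @ (?D @ Z)"
        using artin_cons [OF V(2), of i] unfolding l(1) by simp
      also have "\<dots> \<approx> iterate l ?D @ [i] @ ?D @ Z" by (rule central) (use i in simp)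
      finally show ?thesis by simp
    qed
    ultimately show ?thesis unfolding l(2) by blast
  next
    case (Neg i)
    then have i: "i \<in> {1..<n}" using Cons.prems(1) by (simp add: Pos_letters)
    have "i \<in> {1..n - 1}" using i by auto
    then obtain X where X: "set X \<subseteq> {1..n - 1}" "?D \<approx> i # X" using full_twist_divisible by blast
    have "V \<approx> ?D @ iterate l ?D @ Z" using V(2) l(1) by simp
    also have "\<dots> \<approx> i # X @ iterate l ?D @ Z" using artin_append1 [OF X(2), of "iterate l ?D @ Z"] by simp
    finally have Vi: "V \<approx> i # X @ iterate l ?D @ Z" .
    obtain r where "pmovie n V r (i # X @ iterate l ?D @ Z)" using artin_pmovie [OF Vi sV] by blast
    then have "\<exists>p. canon n (x # w) (iterate k ?D @ Y) (X @ iterate l ?D @ Z) p"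
      using V(1) i Neg by auto
    moreover have "X @ iterate l ?D @ Z \<approx> iterate l ?D @ X @ Z" by (rule central) (use X(1) i in fastforce)
    ultimately show ?thesis unfolding l(2) by blast
  qed
qed

lemma movie_canon:
  assumes "movie n u p v" "\<forall>w \<in> words n. length w \<le> length u + 2 * length p \<longrightarrow> (\<exists>V' c. canon n w V V' c)"
    and "canon n u V V1 c" "canon n v V V2 d"
  shows "\<exists>r. pmovie n V1 r V2 \<and> movie_equiv n (u @ pos V) (pos V2) (c @ r) (whisker [] p (pos V) @ d)"
  using assms
proof (induction n u p v arbitrary: V1 c rule: movie.induct)
  case (1 n u v)
  have "set V \<subseteq> {1..<n}" using movie_ends [OF canon_movie [OF 1(3)]] by simp
  then show ?case using canon_map [OF 1(3), of V V2 d "[]"] 1 by (simp add: pmovie_Nil)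
next
  case (2 n u a m b p v)
  let ?w = "a @ move_tgt m @ b"
  have w: "a \<in> words n" "b \<in> words n" "valid_move n m" and u: "u = a @ move_src m @ b" and p: "movie n ?w p v"
    using 2(2) by auto
  \<comment> \<open>The bound on the lengths in the hypothesis allows for two new letters in every step.\<close>
  have len: "length (move_tgt m) \<le> length (move_src m) + 2" by (cases m) auto
  have def: "\<forall>w \<in> words n. length w \<le> length ?w + 2 * length p \<longrightarrow> (\<exists>V' c. canon n w V V' c)"
    using 2(3) len u by auto
  obtain V' c' where c': "canon n ?w V V' c'"
    using bspec [OF def, of ?w] movie_ends [OF p] by auto
  obtain r where r: "pmovie n V' r V2" "movie_equiv n (?w @ pos V) (pos V2) (c' @ r) (whisker [] p (pos V) @ d)"
    using 2(1) [OF p def c' 2(5)] by blast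
  obtain s where s: "pmovie n V1 s V'" "movie_equiv n (a @ move_src m @ b @ pos V) (pos V') (c @ s) ([(a, m, b @ pos V)] @ c')"
    using canon_step [OF 2(4) [unfolded u] c' w(3)] by blast
  have V: "set V \<subseteq> {1..<n}" using movie_ends [OF canon_movie [OF c']] by simp
  have M: "movie n (u @ pos V) [(a, m, b @ pos V)] (?w @ pos V)"
    using movie_step [of n a m "b @ pos V"] w V u by simp
  have "movie_equiv n (u @ pos V) (pos V2) (c @ s @ r) ([(a, m, b @ pos V)] @ c' @ r)"
    using equiv_append2 [OF s(2) pmovie_movie [OF r(1)]] u by simp
  also have "movie_equiv n (u @ pos V) (pos V2) \<dots> ([(a, m, b @ pos V)] @ whisker [] p (pos V) @ d)"
    by (rule equiv_append1 [OF r(2) M])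
  finally show ?case using pmovie_append [OF s(1) r(1)] by auto
qed

text \<open>The actions of \<open>u\<close> and \<open>v\<close> on a high power of the full twist are related by each of \<open>p\<close> and \<open>q\<close> through a
  positive movie, and positive movies with the same ends are equal.\<close>

theorem coherence:
  assumes p: "movie n u p v" and q: "movie n u q v"
  shows "movie_equiv n u v p q"
proof -
  \<comment> \<open>No word that occurs in one of the movies is longer than \<open>k\<close>.\<close>
  define k where "k = length u + length v + 2 * length p + 2 * length q"
  define V where "V = iterate k (full_twist (n - 1))"
  have uv: "u \<in> words n" "v \<in> words n" using movie_ends [OF p] by auto
  have def: "\<exists>V' c. canon n w V V' c" if "w \<in> words n" "length w \<le> k" for w
    using canon_exists [OF that, of "[]"] by (auto simp: V_def)
  obtain V1 c where c: "canon n u V V1 c" using def [OF uv(1)] by (auto simp: k_def)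
  obtain V2 d where d: "canon n v V V2 d" using def [OF uv(2)] by (auto simp: k_def)
  obtain r where r: "pmovie n V1 r V2" "movie_equiv n (u @ pos V) (pos V2) (c @ r) (whisker [] p (pos V) @ d)"
    using movie_canon [OF p _ c d] def by (auto simp: k_def)
  obtain s where s: "pmovie n V1 s V2" "movie_equiv n (u @ pos V) (pos V2) (c @ s) (whisker [] q (pos V) @ d)"
    using movie_canon [OF q _ c d] def by (auto simp: k_def)
  have "movie_equiv n (u @ pos V) (pos V2) (c @ r) (c @ s)"
    by (rule equiv_append1 [OF positive_coherence [OF r(1) s(1)] canon_movie [OF c]])
  with r(2) s(2) have eq: "movie_equiv n (u @ pos V) (pos V2) (whisker [] p (pos V) @ d) (whisker [] q (pos V) @ d)"
    by (meson equiv_conj)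
  have V: "pos V \<in> words n" using movie_ends [OF canon_movie [OF c]] by simp
  show ?thesis
    by (rule equiv_whisker_right_cancel [OF p q V equiv_cancel_right [OF eq canon_movie [OF d]
          movie_whisker_right [OF p V] movie_whisker_right [OF q V]]])
qed

section \<open>Categories and functors\<close>

lemma Hom_iff: "f \<in> Hom C X Y \<longleftrightarrow> f \<in> Arr C \<and> Dom C f = X \<and> Cod C f = Y"
  by (simp add: Hom_def)

context category
begin

lemma in_Hom: "f \<in> Arr C \<Longrightarrow> f \<in> Hom C (Dom C f) (Cod C f)"
  by (simp add: Hom_iff)

lemma comp_arr:
  assumes "f \<in> Arr C" "g \<in> Arr C" "Dom C g = Cod C f"
  shows "g \<cdot> f \<in> Arr C" "Dom C (g \<cdot> f) = Dom C f" "Cod C (g \<cdot> f) = Cod C g"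
  using comp_in [of f "Dom C f" "Cod C f" g "Cod C g"] assms by (auto simp: Hom_iff)

lemma ide_arr:
  assumes "X \<in> Obj C"
  shows "Ide C X \<in> Arr C" "Dom C (Ide C X) = X" "Cod C (Ide C X) = X"
  using ide_in [OF assms] by (auto simp: Hom_iff)

lemma assoc:
  assumes "f \<in> Arr C" "g \<in> Arr C" "h \<in> Arr C" "Dom C g = Cod C f" "Dom C h = Cod C g"
  shows "(h \<cdot> g) \<cdot> f = h \<cdot> (g \<cdot> f)"
  by (rule comp_assoc [of f "Dom C f" "Cod C f" g "Cod C g" h "Cod C h"]) (use assms in \<open>auto simp: Hom_iff\<close>)

lemma ide_comp: "f \<in> Arr C \<Longrightarrow> Cod C f = Y \<Longrightarrow> Ide C Y \<cdot> f = f"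
  using ide_left [of f "Dom C f" Y] by (simp add: Hom_iff)

lemma comp_ide: "f \<in> Arr C \<Longrightarrow> Dom C f = X \<Longrightarrow> f \<cdot> Ide C X = f"
  using ide_right [of f X "Cod C f"] by (simp add: Hom_iff)

lemmas cat_simps = comp_arr ide_arr ide_comp comp_ide dom_in cod_in

lemma iso_ide: "X \<in> Obj C \<Longrightarrow> iso_arrow C (Ide C X)"
  unfolding iso_arrow_def by (intro conjI bexI [of _ "Ide C X"]) (simp_all add: cat_simps Hom_iff)

lemma iso_comp:
  assumes "iso_arrow C f" "iso_arrow C g" "Dom C g = Cod C f"
  shows "iso_arrow C (g \<cdot> f)"
proof -
  obtain f' where f: "f \<in> Arr C" "f' \<in> Arr C" "Dom C f' = Cod C f" "Cod C f' = Dom C f"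
    "f' \<cdot> f = Ide C (Dom C f)" "f \<cdot> f' = Ide C (Cod C f)"
    using assms(1) by (auto simp: iso_arrow_def Hom_iff)
  obtain g' where g: "g \<in> Arr C" "g' \<in> Arr C" "Dom C g' = Cod C g" "Cod C g' = Dom C g"
    "g' \<cdot> g = Ide C (Dom C g)" "g \<cdot> g' = Ide C (Cod C g)"
    using assms(2) by (auto simp: iso_arrow_def Hom_iff)
  have "(f' \<cdot> g') \<cdot> (g \<cdot> f) = f' \<cdot> (g' \<cdot> (g \<cdot> f))"
    by (rule assoc) (use f g assms(3) in \<open>simp_all add: cat_simps\<close>)
  also have "g' \<cdot> (g \<cdot> f) = (g' \<cdot> g) \<cdot> f"
    by (rule assoc [symmetric]) (use f g assms(3) in \<open>simp_all add: cat_simps\<close>)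
  also have "f' \<cdot> ((g' \<cdot> g) \<cdot> f) = Ide C (Dom C f)" using f g assms(3) by (simp add: cat_simps)
  finally have 1: "(f' \<cdot> g') \<cdot> (g \<cdot> f) = Ide C (Dom C f)" .
  have "(g \<cdot> f) \<cdot> (f' \<cdot> g') = g \<cdot> (f \<cdot> (f' \<cdot> g'))"
    by (rule assoc) (use f g assms(3) in \<open>simp_all add: cat_simps\<close>)
  also have "f \<cdot> (f' \<cdot> g') = (f \<cdot> f') \<cdot> g'"
    by (rule assoc [symmetric]) (use f g assms(3) in \<open>simp_all add: cat_simps\<close>)
  also have "g \<cdot> ((f \<cdot> f') \<cdot> g') = Ide C (Cod C g)" using f g assms(3) by (simp add: cat_simps)
  finally have 2: "(g \<cdot> f) \<cdot> (f' \<cdot> g') = Ide C (Cod C g)" .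
  show ?thesis unfolding iso_arrow_def
    by (intro conjI bexI [of _ "f' \<cdot> g'"]) (use f g assms(3) 1 2 in \<open>simp_all add: cat_simps Hom_iff\<close>)
qed

end

lemma functor_simps:
  assumes "is_functor C D F"
  shows "X \<in> Obj C \<Longrightarrow> FOb F X \<in> Obj D"
    "f \<in> Arr C \<Longrightarrow> FAr F f \<in> Arr D"
    "f \<in> Arr C \<Longrightarrow> Dom D (FAr F f) = FOb F (Dom C f)"
    "f \<in> Arr C \<Longrightarrow> Cod D (FAr F f) = FOb F (Cod C f)"
    "X \<in> Obj C \<Longrightarrow> FAr F (Ide C X) = Ide D (FOb F X)"
    "f \<in> Arr C \<Longrightarrow> g \<in> Arr C \<Longrightarrow> Dom C g = Cod C f \<Longrightarrow> FAr F (g \<cdot>\<^bsub>C\<^esub> f) = FAr F g \<cdot>\<^bsub>D\<^esub> FAr F f"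
    "FOb F \<in> extensional (Obj C)" "FAr F \<in> extensional (Arr C)"
  using assms by (auto simp: is_functor_def PiE_iff)

lemma functor_iso:
  assumes F: "is_functor C D F" and C: "category C" and f: "iso_arrow C f"
  shows "iso_arrow D (FAr F f)"
proof -
  interpret category C by fact
  obtain f' where f: "f \<in> Arr C" "f' \<in> Arr C" "Dom C f' = Cod C f" "Cod C f' = Dom C f"
    "f' \<cdot>\<^bsub>C\<^esub> f = Ide C (Dom C f)" "f \<cdot>\<^bsub>C\<^esub> f' = Ide C (Cod C f)"
    using f by (auto simp: iso_arrow_def Hom_iff)
  have "FAr F f' \<cdot>\<^bsub>D\<^esub> FAr F f = Ide D (FOb F (Dom C f))" "FAr F f \<cdot>\<^bsub>D\<^esub> FAr F f' = Ide D (FOb F (Cod C f))"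
    using functor_simps(6) [OF F f(1,2), symmetric] functor_simps(6) [OF F f(2,1), symmetric] f functor_simps(5) [OF F]
    by (simp_all add: cat_simps)
  then show ?thesis
    unfolding iso_arrow_def by (intro conjI bexI [of _ "FAr F f'"]) (use f in \<open>simp_all add: functor_simps [OF F] Hom_iff\<close>)
qed

lemma functor_eqI:
  fixes F G :: "('o, 'm, 'p, 'k) ftor"
  assumes "FOb F \<in> extensional A" "FOb G \<in> extensional A" "FAr F \<in> extensional B" "FAr G \<in> extensional B"
    "\<And>X. X \<in> A \<Longrightarrow> FOb F X = FOb G X" "\<And>f. f \<in> B \<Longrightarrow> FAr F f = FAr G f"
  shows "F = G"
proof -
  have "FOb F = FOb G" "FAr F = FAr G"
    using assms by (auto intro: extensionalityI)
  then show ?thesis by (cases F; cases G) simp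
qed

lemma comp_functor:
  assumes F: "is_functor C D F" and G: "is_functor D E G" and C: "category C"
  shows "is_functor C E (comp_functor C G F)"
proof -
  interpret category C by fact
  show ?thesis
    unfolding is_functor_def comp_functor_def
    by (simp add: functor_simps [OF F] functor_simps [OF G] cat_simps)
qed

lemma id_functor: "category C \<Longrightarrow> is_functor C C (id_functor C)"
proof -
  assume "category C"
  then interpret category C .
  show ?thesis unfolding is_functor_def id_functor_def by (auto simp: cat_simps)
qed

lemma comp_functor_simps:
  "X \<in> Obj C \<Longrightarrow> FOb (comp_functor C G F) X = FOb G (FOb F X)"
  "f \<in> Arr C \<Longrightarrow> FAr (comp_functor C G F) f = FAr G (FAr F f)"
  "FOb (comp_functor C G F) \<in> extensional (Obj C)" "FAr (comp_functor C G F) \<in> extensional (Arr C)"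
  by (simp_all add: comp_functor_def)

lemma id_functor_simps:
  "X \<in> Obj C \<Longrightarrow> FOb (id_functor C) X = X" "f \<in> Arr C \<Longrightarrow> FAr (id_functor C) f = f"
  "FOb (id_functor C) \<in> extensional (Obj C)" "FAr (id_functor C) \<in> extensional (Arr C)"
  by (simp_all add: id_functor_def)

lemma comp_functor_assoc:
  assumes "is_functor C D F"
  shows "comp_functor C (comp_functor D H G) F = comp_functor C H (comp_functor C G F)"
  by (rule functor_eqI [where A = "Obj C" and B = "Arr C"]) (simp_all add: comp_functor_simps functor_simps [OF assms])

lemma comp_functor_id:
  fixes F :: "('o, 'm, 'p, 'k) ftor"
  assumes "is_functor C D F"
  shows "comp_functor C (id_functor D) F = F" "comp_functor C F (id_functor C) = F"
  by (rule functor_eqI [where A = "Obj C" and B = "Arr C"];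
      simp add: comp_functor_simps id_functor_simps functor_simps [OF assms])+

section \<open>Natural isomorphisms\<close>

lemma trafo_eqI:
  fixes \<alpha> \<beta> :: "('f, 'o, 'k) trafo"
  assumes "Src \<alpha> = Src \<beta>" "Tgt \<alpha> = Tgt \<beta>" "Comp \<alpha> \<in> extensional A" "Comp \<beta> \<in> extensional A"
    "\<And>X. X \<in> A \<Longrightarrow> Comp \<alpha> X = Comp \<beta> X"
  shows "\<alpha> = \<beta>"
proof -
  have "Comp \<alpha> = Comp \<beta>" using assms by (auto intro: extensionalityI)
  then show ?thesis using assms(1,2) by (cases \<alpha>; cases \<beta>) simp
qed

lemma natural_simps:
  assumes "natural C D \<theta>"
  shows "is_functor C D (Src \<theta>)" "is_functor C D (Tgt \<theta>)" "Comp \<theta> \<in> extensional (Obj C)"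
    "X \<in> Obj C \<Longrightarrow> Comp \<theta> X \<in> Arr D"
    "X \<in> Obj C \<Longrightarrow> Dom D (Comp \<theta> X) = FOb (Src \<theta>) X"
    "X \<in> Obj C \<Longrightarrow> Cod D (Comp \<theta> X) = FOb (Tgt \<theta>) X"
    "f \<in> Arr C \<Longrightarrow> Comp \<theta> (Cod C f) \<cdot>\<^bsub>D\<^esub> FAr (Src \<theta>) f = FAr (Tgt \<theta>) f \<cdot>\<^bsub>D\<^esub> Comp \<theta> (Dom C f)"
  using assms by (auto simp: natural_def Hom_iff)

lemma natural_id:
  assumes F: "is_functor C D F" and "category C" "category D"
  shows "natural C D (id_trafo C D F)"
proof -
  interpret C: category C by fact
  interpret D: category D by fact
  show ?thesis unfolding natural_def id_trafo_def
    by (simp add: F functor_simps [OF F] C.cat_simps D.cat_simps Hom_iff)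
qed

lemma natural_vertical:
  fixes D (structure)
  assumes a: "natural C D \<alpha>" and b: "natural C D \<beta>" and eq: "Tgt \<alpha> = Src \<beta>" and "category C" "category D"
  shows "natural C D (vertical_comp C D \<beta> \<alpha>)"
proof -
  interpret C: category C by fact
  interpret D: category D by fact
  note s = natural_simps [OF a] natural_simps [OF b] functor_simps [OF natural_simps(1) [OF a]]
    functor_simps [OF natural_simps(1) [OF b]] functor_simps [OF natural_simps(2) [OF b]]
  have "(Comp \<beta> (Cod C f) \<cdot> Comp \<alpha> (Cod C f)) \<cdot> FAr (Src \<alpha>) f
      = FAr (Tgt \<beta>) f \<cdot> (Comp \<beta> (Dom C f) \<cdot> Comp \<alpha> (Dom C f))" if f: "f \<in> Arr C" for f
  proof -
    have "(Comp \<beta> (Cod C f) \<cdot> Comp \<alpha> (Cod C f)) \<cdot> FAr (Src \<alpha>) f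
        = Comp \<beta> (Cod C f) \<cdot> (FAr (Src \<beta>) f \<cdot> Comp \<alpha> (Dom C f))"
      using f natural_simps(7) [OF a f] by (simp add: D.assoc C.cat_simps s eq)
    also have "\<dots> = (FAr (Tgt \<beta>) f \<cdot> Comp \<beta> (Dom C f)) \<cdot> Comp \<alpha> (Dom C f)"
      using f by (simp add: D.assoc [symmetric] C.cat_simps s eq)
    also have "\<dots> = FAr (Tgt \<beta>) f \<cdot> (Comp \<beta> (Dom C f) \<cdot> Comp \<alpha> (Dom C f))"
      using f by (simp add: D.assoc C.cat_simps s eq)
    finally show ?thesis .
  qed
  then show ?thesis unfolding natural_def vertical_comp_def
    by (simp add: s(1,9) D.cat_simps C.cat_simps Hom_iff s eq)
qed

text \<open>Horizontal composition, for arbitrary categories; it is the tensor product of arrows in \<^term>\<open>Aut C\<close>.\<close>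

definition hcomp :: "('o, 'm, 'z) cat_scheme \<Rightarrow> ('q, 'l, 'y) cat_scheme
    \<Rightarrow> (('p, 'k, 'q, 'l) ftor, 'p, 'l) trafo \<Rightarrow> (('o, 'm, 'p, 'k) ftor, 'o, 'k) trafo
    \<Rightarrow> (('o, 'm, 'q, 'l) ftor, 'o, 'l) trafo" where
  "hcomp C E \<beta> \<alpha> = \<lparr>Src = comp_functor C (Src \<beta>) (Src \<alpha>), Tgt = comp_functor C (Tgt \<beta>) (Tgt \<alpha>),
     Comp = (\<lambda>X \<in> Obj C. Comp \<beta> (FOb (Tgt \<alpha>) X) \<cdot>\<^bsub>E\<^esub> FAr (Src \<beta>) (Comp \<alpha> X))\<rparr>"

lemma natural_hcomp:
  fixes E (structure)
  assumes a: "natural C D \<alpha>" and b: "natural D E \<beta>" and "category C" "category D" "category E"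
  shows "natural C E (hcomp C E \<beta> \<alpha>)"
proof -
  interpret C: category C by fact
  interpret D: category D by fact
  interpret E: category E by fact
  note s = natural_simps(1-6) [OF a] natural_simps(1-6) [OF b] functor_simps [OF natural_simps(1) [OF a]] functor_simps [OF natural_simps(2) [OF a]]
    functor_simps [OF natural_simps(1) [OF b]] functor_simps [OF natural_simps(2) [OF b]]
  let ?F = "Src \<alpha>" and ?F' = "Tgt \<alpha>" and ?G = "Src \<beta>" and ?G' = "Tgt \<beta>"
  have "(Comp \<beta> (FOb ?F' (Cod C f)) \<cdot> FAr ?G (Comp \<alpha> (Cod C f))) \<cdot> FAr ?G (FAr ?F f)
      = FAr ?G' (FAr ?F' f) \<cdot> (Comp \<beta> (FOb ?F' (Dom C f)) \<cdot> FAr ?G (Comp \<alpha> (Dom C f)))" if f: "f \<in> Arr C" for f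
  proof -
    have "(Comp \<beta> (FOb ?F' (Cod C f)) \<cdot> FAr ?G (Comp \<alpha> (Cod C f))) \<cdot> FAr ?G (FAr ?F f)
       = Comp \<beta> (FOb ?F' (Cod C f)) \<cdot> FAr ?G (Comp \<alpha> (Cod C f) \<cdot>\<^bsub>D\<^esub> FAr ?F f)"
      using f by (simp add: E.assoc C.cat_simps D.cat_simps s)
    also have "\<dots> = Comp \<beta> (FOb ?F' (Cod C f)) \<cdot> FAr ?G (FAr ?F' f) \<cdot> FAr ?G (Comp \<alpha> (Dom C f))"
      unfolding natural_simps(7) [OF a f] using f by (simp add: C.cat_simps s)
    also have "\<dots> = (Comp \<beta> (FOb ?F' (Cod C f)) \<cdot> FAr ?G (FAr ?F' f)) \<cdot> FAr ?G (Comp \<alpha> (Dom C f))"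
      using f by (simp add: E.assoc C.cat_simps s)
    also have "Comp \<beta> (FOb ?F' (Cod C f)) \<cdot> FAr ?G (FAr ?F' f) = FAr ?G' (FAr ?F' f) \<cdot> Comp \<beta> (FOb ?F' (Dom C f))"
      using f natural_simps(7) [OF b, of "FAr ?F' f"] by (simp add: s)
    finally show ?thesis using f by (simp add: E.assoc C.cat_simps s)
  qed
  then show ?thesis unfolding natural_def hcomp_def
    using comp_functor [OF natural_simps(1) [OF a] natural_simps(1) [OF b]] comp_functor [OF natural_simps(2) [OF a] natural_simps(2) [OF b]]
    by (simp add: assms C.cat_simps E.cat_simps Hom_iff s comp_functor_simps)
qed

lemma natural_iso_id:
  assumes F: "is_functor C D F" and C: "category C" and D: "category D"
  shows "natural_iso C D (id_trafo C D F)"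
  using natural_id [OF assms] category.iso_ide [OF D] functor_simps [OF F]
  by (simp add: natural_iso_def) (simp add: id_trafo_def)

lemma natural_iso_vertical:
  assumes a: "natural_iso C D \<alpha>" and b: "natural_iso C D \<beta>" and eq: "Tgt \<alpha> = Src \<beta>" and C: "category C" and D: "category D"
  shows "natural_iso C D (vertical_comp C D \<beta> \<alpha>)"
proof -
  have n: "natural C D \<alpha>" "natural C D \<beta>" using a b by (auto simp: natural_iso_def)
  have "iso_arrow D (Comp \<beta> X \<cdot>\<^bsub>D\<^esub> Comp \<alpha> X)" if "X \<in> Obj C" for X
    by (rule category.iso_comp [OF D]) (use a b that natural_simps [OF n(1)] natural_simps [OF n(2)] eq in \<open>auto simp: natural_iso_def\<close>)
  then show ?thesis unfolding natural_iso_def using natural_vertical [OF n eq C D] by (simp add: vertical_comp_def)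
qed

lemma natural_iso_hcomp:
  assumes a: "natural_iso C D \<alpha>" and b: "natural_iso D E \<beta>" and C: "category C" and D: "category D" and E: "category E"
  shows "natural_iso C E (hcomp C E \<beta> \<alpha>)"
proof -
  have n: "natural C D \<alpha>" "natural D E \<beta>" using a b by (auto simp: natural_iso_def)
  note s = natural_simps [OF n(1)] natural_simps [OF n(2)]
  have "iso_arrow E (Comp \<beta> (FOb (Tgt \<alpha>) X) \<cdot>\<^bsub>E\<^esub> FAr (Src \<beta>) (Comp \<alpha> X))" if X: "X \<in> Obj C" for X
  proof (rule category.iso_comp [OF E])
    show "iso_arrow E (FAr (Src \<beta>) (Comp \<alpha> X))"
      by (rule functor_iso [OF s(8) D]) (use a X in \<open>auto simp: natural_iso_def\<close>)
    show "iso_arrow E (Comp \<beta> (FOb (Tgt \<alpha>) X))"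
      using b X functor_simps(1) [OF s(2) X] by (auto simp: natural_iso_def)
    show "Dom E (Comp \<beta> (FOb (Tgt \<alpha>) X)) = Cod E (FAr (Src \<beta>) (Comp \<alpha> X))"
      using X by (simp add: s functor_simps [OF s(8)] functor_simps [OF s(2)])
  qed
  then show ?thesis unfolding natural_iso_def using natural_hcomp [OF n C D E] by (simp add: hcomp_def)
qed

lemma isomorphic_functors_refl:
  "is_functor C D F \<Longrightarrow> category C \<Longrightarrow> category D \<Longrightarrow> isomorphic_functors C D F F"
  unfolding isomorphic_functors_def using natural_iso_id [of C D F] by (auto simp: id_trafo_def intro!: exI [of _ "id_trafo C D F"])

lemma isomorphic_functors_trans:
  assumes "isomorphic_functors C D F G" "isomorphic_functors C D G H" "category C" "category D"
  shows "isomorphic_functors C D F H"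
  using assms natural_iso_vertical unfolding isomorphic_functors_def vertical_comp_def
  by (smt (verit) trafo.select_convs)

lemma isomorphic_functors_comp:
  assumes "isomorphic_functors C D F F'" "isomorphic_functors D E G G'" and C: "category C" and D: "category D" and E: "category E"
  shows "isomorphic_functors C E (comp_functor C G F) (comp_functor C G' F')"
proof -
  obtain \<alpha> \<beta> where "natural_iso C D \<alpha>" "Src \<alpha> = F" "Tgt \<alpha> = F'" "natural_iso D E \<beta>" "Src \<beta> = G" "Tgt \<beta> = G'"
    using assms by (auto simp: isomorphic_functors_def)
  then show ?thesis unfolding isomorphic_functors_def
    using natural_iso_hcomp [OF _ _ C D E] by (intro exI [of _ "hcomp C E \<beta> \<alpha>"]) (auto simp: hcomp_def)
qed

lemma equivalence_id: "category C \<Longrightarrow> equivalence_of_cats C C (id_functor C)"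
  unfolding equivalence_of_cats_def
  using id_functor [of C] isomorphic_functors_refl [OF id_functor] comp_functor_id(1) [OF id_functor] by metis

lemma isomorphic_functors_inverse:
  fixes S :: "('o, 'm, 'p, 'k) ftor" and T :: "('p, 'k, 'q, 'l) ftor"
    and S' :: "('p, 'k, 'o, 'm) ftor" and T' :: "('q, 'l, 'p, 'k) ftor"
  assumes S: "is_functor X Y S" "is_functor Y X S'" "isomorphic_functors X X (comp_functor X S' S) (id_functor X)"
    and T: "is_functor Y Z T" "is_functor Z Y T'" "isomorphic_functors Y Y (comp_functor Y T' T) (id_functor Y)"
    and c: "category X" "category Y" "category Z"
  shows "isomorphic_functors X X (comp_functor X (comp_functor Z S' T') (comp_functor X T S)) (id_functor X)"
proof -
  have "comp_functor X (comp_functor Z S' T') (comp_functor X T S) = comp_functor X S' (comp_functor X (comp_functor Y T' T) S)"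
    using comp_functor_assoc [OF comp_functor [OF S(1) T(1) c(1)]] comp_functor_assoc [OF S(1)] by metis
  moreover have "isomorphic_functors X X (comp_functor X S' (comp_functor X (comp_functor Y T' T) S)) (comp_functor X S' (comp_functor X (id_functor Y) S))"
    by (rule isomorphic_functors_comp [OF isomorphic_functors_comp [OF isomorphic_functors_refl [OF S(1) c(1,2)] T(3) c(1,2,2)]
          isomorphic_functors_refl [OF S(2) c(2,1)] c(1,2,1)])
  moreover have "comp_functor X (id_functor Y) S = S" by (rule comp_functor_id [OF S(1)])
  ultimately show ?thesis using isomorphic_functors_trans [OF _ S(3) c(1,1)] by metis
qed

lemma equivalence_comp:
  fixes F :: "('o, 'm, 'p, 'k) ftor" and G :: "('p, 'k, 'q, 'l) ftor"
  assumes F: "equivalence_of_cats C D F" and G: "equivalence_of_cats D E G"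
  shows "equivalence_of_cats C E (comp_functor C G F)"
proof -
  have cats: "category C" "category D" "category E" using F G by (auto simp: equivalence_of_cats_def)
  obtain F' :: "('p, 'k, 'o, 'm) ftor" where F': "is_functor C D F" "is_functor D C F'"
    "isomorphic_functors C C (comp_functor C F' F) (id_functor C)" "isomorphic_functors D D (comp_functor D F F') (id_functor D)"
    using F by (auto simp: equivalence_of_cats_def)
  obtain G' :: "('q, 'l, 'p, 'k) ftor" where G': "is_functor D E G" "is_functor E D G'"
    "isomorphic_functors D D (comp_functor D G' G) (id_functor D)" "isomorphic_functors E E (comp_functor E G G') (id_functor E)"
    using G by (auto simp: equivalence_of_cats_def)
  show ?thesis unfolding equivalence_of_cats_def
    using cats comp_functor [OF F'(1) G'(1) cats(1)] comp_functor [OF G'(2) F'(2) cats(3)]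
      isomorphic_functors_inverse [OF F'(1,2,3) G'(1,2,3) cats] isomorphic_functors_inverse [OF G'(2,1,4) F'(2,1,4) cats(3,2,1)] by blast
qed

section \<open>The strict monoidal category of autoequivalences\<close>

lemma Aut_simps:
  "Obj (Aut C) = {F. equivalence_of_cats C C F}"
  "Arr (Aut C) = {\<theta>. natural_iso C C \<theta> \<and> equivalence_of_cats C C (Src \<theta>) \<and> equivalence_of_cats C C (Tgt \<theta>)}"
  "Dom (Aut C) = Src" "Cod (Aut C) = Tgt" "Ide (Aut C) = id_trafo C C" "Cmp (Aut C) = vertical_comp C C"
  "TOb (Aut C) = comp_functor C" "TAr (Aut C) = hcomp C C" "Unit (Aut C) = id_functor C"
  by (simp_all add: Aut_def hcomp_def fun_eq_iff)

lemma vertical_comp_simps [simp]: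
  "Src (vertical_comp C D \<beta> \<alpha>) = Src \<alpha>" "Tgt (vertical_comp C D \<beta> \<alpha>) = Tgt \<beta>"
  "X \<in> Obj C \<Longrightarrow> Comp (vertical_comp C D \<beta> \<alpha>) X = Comp \<beta> X \<cdot>\<^bsub>D\<^esub> Comp \<alpha> X"
  "Comp (vertical_comp C D \<beta> \<alpha>) \<in> extensional (Obj C)"
  by (simp_all add: vertical_comp_def)

lemma id_trafo_simps [simp]:
  "Src (id_trafo C D F) = F" "Tgt (id_trafo C D F) = F"
  "X \<in> Obj C \<Longrightarrow> Comp (id_trafo C D F) X = Ide D (FOb F X)"
  "Comp (id_trafo C D F) \<in> extensional (Obj C)"
  by (simp_all add: id_trafo_def)

lemma hcomp_simps [simp]:
  "Src (hcomp C E \<beta> \<alpha>) = comp_functor C (Src \<beta>) (Src \<alpha>)" "Tgt (hcomp C E \<beta> \<alpha>) = comp_functor C (Tgt \<beta>) (Tgt \<alpha>)"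
  "X \<in> Obj C \<Longrightarrow> Comp (hcomp C E \<beta> \<alpha>) X = Comp \<beta> (FOb (Tgt \<alpha>) X) \<cdot>\<^bsub>E\<^esub> FAr (Src \<beta>) (Comp \<alpha> X)"
  "Comp (hcomp C E \<beta> \<alpha>) \<in> extensional (Obj C)"
  by (simp_all add: hcomp_def)

lemma vertical_comp_ide:
  assumes n: "natural C D \<alpha>" and D: "category D"
  shows "vertical_comp C D (id_trafo C D (Tgt \<alpha>)) \<alpha> = \<alpha>" "vertical_comp C D \<alpha> (id_trafo C D (Src \<alpha>)) = \<alpha>"
  by (rule trafo_eqI [where A = "Obj C"]; use natural_simps [OF n] D in \<open>simp add: category.cat_simps\<close>)+

lemma vertical_comp_assoc:
  assumes a: "natural C D \<alpha>" and b: "natural C D \<beta>" and c: "natural C D \<gamma>" and "Tgt \<alpha> = Src \<beta>" "Tgt \<beta> = Src \<gamma>" and D: "category D"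
  shows "vertical_comp C D (vertical_comp C D \<gamma> \<beta>) \<alpha> = vertical_comp C D \<gamma> (vertical_comp C D \<beta> \<alpha>)"
  by (rule trafo_eqI [where A = "Obj C"])
    (use assms natural_simps [OF a] natural_simps [OF b] natural_simps [OF c] in \<open>simp_all add: category.assoc [OF D]\<close>)

lemma equivalence_functor: "equivalence_of_cats C D F \<Longrightarrow> is_functor C D F"
  by (simp add: equivalence_of_cats_def)

lemma hcomp_interchange:
  fixes E (structure)
  assumes nat: "natural C D \<alpha>" "natural C D \<alpha>'" "natural D E \<beta>" "natural D E \<beta>'"
    and eq: "Tgt \<alpha> = Src \<alpha>'" "Tgt \<beta> = Src \<beta>'" and C: "category C" and D: "category D" and E: "category E"
  shows "hcomp C E (vertical_comp D E \<beta>' \<beta>) (vertical_comp C D \<alpha>' \<alpha>)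
    = vertical_comp C E (hcomp C E \<beta>' \<alpha>') (hcomp C E \<beta> \<alpha>)"
proof (rule trafo_eqI [where A = "Obj C"])
  interpret C: category C by fact
  interpret D: category D by fact
  interpret E: category E by fact
  note s = natural_simps [OF nat(1)] natural_simps [OF nat(2)] natural_simps [OF nat(3)] natural_simps [OF nat(4)]
  note f = functor_simps [OF s(1)] functor_simps [OF s(2)] functor_simps [OF s(8)] functor_simps [OF s(9)]
    functor_simps [OF s(15)] functor_simps [OF s(16)] functor_simps [OF s(22)] functor_simps [OF s(23)]
  fix X assume X: "X \<in> Obj C"
  let ?F2 = "FOb (Tgt \<alpha>') X" and ?F1 = "FOb (Tgt \<alpha>) X" and ?G = "Src \<beta>" and ?G' = "Src \<beta>'"
  have n: "Comp \<beta> ?F2 \<cdot> FAr ?G (Comp \<alpha>' X) = FAr ?G' (Comp \<alpha>' X) \<cdot> Comp \<beta> ?F1"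
    using natural_simps(7) [OF nat(3), of "Comp \<alpha>' X"] X eq by (simp add: s)
  have "Comp (hcomp C E (vertical_comp D E \<beta>' \<beta>) (vertical_comp C D \<alpha>' \<alpha>)) X
     = Comp \<beta>' ?F2 \<cdot> ((Comp \<beta> ?F2 \<cdot> FAr ?G (Comp \<alpha>' X)) \<cdot> FAr ?G (Comp \<alpha> X))"
    using X eq by (simp add: s f E.assoc E.cat_simps)
  also have "\<dots> = Comp (vertical_comp C E (hcomp C E \<beta>' \<alpha>') (hcomp C E \<beta> \<alpha>)) X"
    unfolding n using X eq by (simp add: s f E.assoc E.cat_simps)
  finally show "Comp (hcomp C E (vertical_comp D E \<beta>' \<beta>) (vertical_comp C D \<alpha>' \<alpha>)) X
    = Comp (vertical_comp C E (hcomp C E \<beta>' \<alpha>') (hcomp C E \<beta> \<alpha>)) X" .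
qed simp_all

lemma hcomp_assoc:
  assumes nat: "natural A B \<alpha>" "natural B C \<beta>" "natural C D \<gamma>" and cat: "category B" "category C" "category D"
  shows "hcomp A D (hcomp B D \<gamma> \<beta>) \<alpha> = hcomp A D \<gamma> (hcomp A C \<beta> \<alpha>)"
proof (rule trafo_eqI [where A = "Obj A"])
  note s = natural_simps [OF nat(1)] natural_simps [OF nat(2)] natural_simps [OF nat(3)]
  note f = functor_simps [OF s(1)] functor_simps [OF s(2)] functor_simps [OF s(8)] functor_simps [OF s(9)]
    functor_simps [OF s(15)] functor_simps [OF s(16)]
  fix X assume X: "X \<in> Obj A"
  show "Comp (hcomp A D (hcomp B D \<gamma> \<beta>) \<alpha>) X = Comp (hcomp A D \<gamma> (hcomp A C \<beta> \<alpha>)) X"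
    using X by (simp add: s f comp_functor_simps category.cat_simps [OF cat(2)] category.assoc [OF cat(3)])
qed (use natural_simps [OF nat(1)] comp_functor_assoc in \<open>auto simp: \<close>)

lemma hcomp_ide:
  assumes F: "is_functor C D F" and G: "is_functor D E G" and cat: "category C" "category D" "category E"
  shows "hcomp C E (id_trafo D E G) (id_trafo C D F) = id_trafo C E (comp_functor C G F)"
  by (rule trafo_eqI [where A = "Obj C"])
    (use functor_simps [OF F] functor_simps [OF G] in \<open>simp_all add: comp_functor_simps category.cat_simps [OF cat(3)]\<close>)

lemma hcomp_unit:
  fixes \<alpha> :: "(('o, 'm, 'p, 'k) ftor, 'o, 'k) trafo"
  assumes nat: "natural C D \<alpha>" and C: "category C" and D: "category D"
  shows "hcomp C D (id_trafo D D (id_functor D)) \<alpha> = \<alpha>" "hcomp C D \<alpha> (id_trafo C C (id_functor C)) = \<alpha>"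
proof -
  note s = natural_simps [OF nat]
  note f = functor_simps [OF s(1)] functor_simps [OF s(2)]
  show "hcomp C D (id_trafo D D (id_functor D)) \<alpha> = \<alpha>"
    by (rule trafo_eqI [where A = "Obj C"])
      (simp_all add: s f comp_functor_id [OF s(1)] comp_functor_id [OF s(2)] id_functor_simps category.cat_simps [OF D])
  show "hcomp C D \<alpha> (id_trafo C C (id_functor C)) = \<alpha>"
    by (rule trafo_eqI [where A = "Obj C"])
      (simp_all add: s f comp_functor_id [OF s(1)] comp_functor_id [OF s(2)] id_functor_simps category.cat_simps [OF D])
qed

theorem strict_monoidal_Aut:
  assumes C: "category C"
  shows "strict_monoidal (Aut C)"
proof -
  have nat: "natural C C \<theta>" if "natural_iso C C \<theta>" for \<theta> :: "(('a, 'b, 'a, 'b) ftor, 'a, 'b) trafo"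
    using that by (simp add: natural_iso_def)
  show ?thesis
  proof (unfold_locales, goal_cases)
    case 1 then show ?case by (simp add: Aut_simps)
  next
    case 2 then show ?case by (simp add: Aut_simps)
  next
    case 3 then show ?case using natural_iso_id [OF equivalence_functor C C] by (simp add: Aut_simps Hom_iff)
  next
    case 4 then show ?case by (auto simp: Aut_simps Hom_iff intro!: natural_iso_vertical C)
  next
    case 5 then show ?case using vertical_comp_ide(1) [OF nat C] by (auto simp: Aut_simps Hom_iff)
  next
    case 6 then show ?case using vertical_comp_ide(2) [OF nat C] by (auto simp: Aut_simps Hom_iff)
  next
    case 7 then show ?case using vertical_comp_assoc [OF nat nat nat _ _ C] by (auto simp: Aut_simps Hom_iff)
  next
    case 8 show ?case using equivalence_id [OF C] by (simp add: Aut_simps)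
  next
    case 9 then show ?case using equivalence_comp by (auto simp: Aut_simps)
  next
    case 10 then show ?case using natural_iso_hcomp [OF _ _ C C C] equivalence_comp by (auto simp: Aut_simps Hom_iff)
  next
    case 11 then show ?case using hcomp_ide [OF equivalence_functor equivalence_functor C C C] by (auto simp: Aut_simps)
  next
    case 12 then show ?case using hcomp_interchange [OF nat nat nat nat _ _ C C C] by (auto simp: Aut_simps Hom_iff)
  next
    case 13 then show ?case using comp_functor_assoc [OF equivalence_functor] by (auto simp: Aut_simps)
  next
    case 14 then show ?case using hcomp_assoc [OF nat nat nat C C C] by (auto simp: Aut_simps)
  next
    case 15 then show ?case using comp_functor_id [OF equivalence_functor] by (auto simp: Aut_simps)
  next
    case 16 then show ?case using hcomp_unit [OF nat C C] by (auto simp: Aut_simps)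
  qed
qed

section \<open>Categories of monoidal functors\<close>

context strict_monoidal
begin

lemma tensor_arr:
  assumes "f \<in> Arr M" "g \<in> Arr M"
  shows "f \<star> g \<in> Arr M" "Dom M (f \<star> g) = Dom M f \<odot> Dom M g" "Cod M (f \<star> g) = Cod M f \<odot> Cod M g"
  using tensor_in [OF in_Hom [OF assms(1)] in_Hom [OF assms(2)]] by (auto simp: Hom_iff)

lemma tensor_comp:
  assumes "f \<in> Arr M" "f' \<in> Arr M" "g \<in> Arr M" "g' \<in> Arr M" "Dom M f' = Cod M f" "Dom M g' = Cod M g"
  shows "(f' \<star> g') \<cdot> (f \<star> g) = (f' \<cdot> f) \<star> (g' \<cdot> g)"
  using interchange [of f "Dom M f" "Cod M f" f' "Cod M f'" g "Dom M g" "Cod M g" g' "Cod M g'"] assms by (simp add: Hom_iff)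

lemma whisker_comp:
  assumes "f \<in> Arr M" "f' \<in> Arr M" "Dom M f' = Cod M f" "X \<in> Obj M"
  shows "(f' \<cdot> f) \<star> Ide M X = (f' \<star> Ide M X) \<cdot> (f \<star> Ide M X)"
    "Ide M X \<star> (f' \<cdot> f) = (Ide M X \<star> f') \<cdot> (Ide M X \<star> f)"
  using assms by (simp_all add: tensor_comp ide_arr ide_comp)

lemmas mon_simps = cat_simps tensor_arr tensor_ob_in unit_in

end

lemma monoidal_functorD:
  assumes "monoidal_functor M N F"
  shows "is_functor M N F" "Mu F \<in> extensional (Obj M \<times> Obj M)"
    "X \<in> Obj M \<Longrightarrow> Y \<in> Obj M \<Longrightarrow> Mu F (X, Y) \<in> Arr N"
    "X \<in> Obj M \<Longrightarrow> Y \<in> Obj M \<Longrightarrow> Dom N (Mu F (X, Y)) = FOb F X \<odot>\<^bsub>N\<^esub> FOb F Y"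
    "X \<in> Obj M \<Longrightarrow> Y \<in> Obj M \<Longrightarrow> Cod N (Mu F (X, Y)) = FOb F (X \<odot>\<^bsub>M\<^esub> Y)"
    "X \<in> Obj M \<Longrightarrow> Y \<in> Obj M \<Longrightarrow> iso_arrow N (Mu F (X, Y))"
    "Eps F \<in> Arr N" "Dom N (Eps F) = Unit N" "Cod N (Eps F) = FOb F (Unit M)" "iso_arrow N (Eps F)"
  using assms by (auto simp: monoidal_functor_def Hom_iff)

lemma monoidal_functor_natural:
  fixes N (structure)
  assumes "monoidal_functor M N F" "f \<in> Arr M" "g \<in> Arr M" "Dom M f = X" "Cod M f = X'" "Dom M g = Y" "Cod M g = Y'"
  shows "Mu F (X', Y') \<cdot> (FAr F f \<star> FAr F g) = FAr F (f \<star>\<^bsub>M\<^esub> g) \<cdot> Mu F (X, Y)"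
  using assms by (auto simp: monoidal_functor_def)

lemma monoidal_functor_assoc:
  fixes N (structure)
  assumes "monoidal_functor M N F" "X \<in> Obj M" "Y \<in> Obj M" "Z \<in> Obj M"
  shows "Mu F (X \<odot>\<^bsub>M\<^esub> Y, Z) \<cdot> (Mu F (X, Y) \<star> Ide N (FOb F Z))
          = Mu F (X, Y \<odot>\<^bsub>M\<^esub> Z) \<cdot> (Ide N (FOb F X) \<star> Mu F (Y, Z))"
  using assms by (simp add: monoidal_functor_def)

lemma monoidal_functor_unit:
  fixes N (structure)
  assumes "monoidal_functor M N F" "X \<in> Obj M"
  shows "Mu F (Unit M, X) \<cdot> (Eps F \<star> Ide N (FOb F X)) = Ide N (FOb F X)"
    "Mu F (X, Unit M) \<cdot> (Ide N (FOb F X) \<star> Eps F) = Ide N (FOb F X)"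
  using assms by (simp_all add: monoidal_functor_def)

lemma monoidal_trafoD:
  fixes N (structure)
  assumes "monoidal_trafo M N \<theta>"
  shows "monoidal_functor M N (Src \<theta>)" "monoidal_functor M N (Tgt \<theta>)" "natural M N \<theta>"
    "X \<in> Obj M \<Longrightarrow> Y \<in> Obj M \<Longrightarrow> Comp \<theta> (X \<odot>\<^bsub>M\<^esub> Y) \<cdot> Mu (Src \<theta>) (X, Y)
          = Mu (Tgt \<theta>) (X, Y) \<cdot> (Comp \<theta> X \<star> Comp \<theta> Y)"
    "Comp \<theta> (Unit M) \<cdot> Eps (Src \<theta>) = Eps (Tgt \<theta>)"
  using assms by (simp_all add: monoidal_trafo_def)

lemma monoidal_functors_simps:
  "Obj (monoidal_functors M N) = {F. monoidal_functor M N F}" "Arr (monoidal_functors M N) = {\<theta>. monoidal_trafo M N \<theta>}"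
  "Dom (monoidal_functors M N) = Src" "Cod (monoidal_functors M N) = Tgt"
  "Ide (monoidal_functors M N) = id_trafo M N" "Cmp (monoidal_functors M N) = vertical_comp M N"
  by (simp_all add: monoidal_functors_def)

lemma mftor_eqI:
  fixes F G :: "('o, 'm, 'p, 'k) mftor"
  assumes "FOb F \<in> extensional A" "FOb G \<in> extensional A" "FAr F \<in> extensional B" "FAr G \<in> extensional B"
    "Mu F \<in> extensional (A \<times> A)" "Mu G \<in> extensional (A \<times> A)"
    "\<And>X. X \<in> A \<Longrightarrow> FOb F X = FOb G X" "\<And>f. f \<in> B \<Longrightarrow> FAr F f = FAr G f"
    "\<And>X Y. X \<in> A \<Longrightarrow> Y \<in> A \<Longrightarrow> Mu F (X, Y) = Mu G (X, Y)" "Eps F = Eps G"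
  shows "F = G"
proof -
  have "FOb F = FOb G" "FAr F = FAr G" using assms by (auto intro: extensionalityI)
  moreover have "Mu F = Mu G" by (rule extensionalityI [OF assms(5,6)]) (use assms(9) in auto)
  ultimately show ?thesis using assms(10) by (cases F; cases G) simp
qed

lemma monoidal_id_trafo:
  assumes F: "monoidal_functor M N F" and M: "strict_monoidal M" and N: "strict_monoidal N"
  shows "monoidal_trafo M N (id_trafo M N F)"
proof -
  interpret M: strict_monoidal M by fact
  interpret N: strict_monoidal N by fact
  note s = monoidal_functorD [OF F]
  show ?thesis unfolding monoidal_trafo_def
    using natural_id [OF s(1) M.category_axioms N.category_axioms] F
    by (simp add: M.mon_simps N.mon_simps s functor_simps [OF s(1)] N.tensor_ide)
qed

lemma monoidal_vertical_comp:
  fixes N (structure)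
  assumes a: "monoidal_trafo M N \<alpha>" and b: "monoidal_trafo M N \<beta>" and eq: "Tgt \<alpha> = Src \<beta>"
    and M: "strict_monoidal M" and N: "strict_monoidal N"
  shows "monoidal_trafo M N (vertical_comp M N \<beta> \<alpha>)"
proof -
  interpret M: strict_monoidal M by fact
  interpret N: strict_monoidal N by fact
  note A = monoidal_trafoD [OF a] and B = monoidal_trafoD [OF b]
  note s = natural_simps(1-6) [OF A(3)] natural_simps(1-6) [OF B(3)] monoidal_functorD [OF A(1)] monoidal_functorD [OF A(2)] monoidal_functorD [OF B(2)]
    monoidal_functorD [OF B(1)]
  note f = functor_simps [OF monoidal_functorD(1) [OF A(1)]] functor_simps [OF monoidal_functorD(1) [OF A(2)]] functor_simps [OF monoidal_functorD(1) [OF B(2)]]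
     functor_simps [OF monoidal_functorD(1) [OF B(1)]]
  have "(Comp \<beta> (X \<odot>\<^bsub>M\<^esub> Y) \<cdot> Comp \<alpha> (X \<odot>\<^bsub>M\<^esub> Y)) \<cdot> Mu (Src \<alpha>) (X, Y)
     = Mu (Tgt \<beta>) (X, Y) \<cdot> ((Comp \<beta> X \<cdot> Comp \<alpha> X) \<star> (Comp \<beta> Y \<cdot> Comp \<alpha> Y))"
    if X: "X \<in> Obj M" and Y: "Y \<in> Obj M" for X Y
  proof -
    have "(Comp \<beta> (X \<odot>\<^bsub>M\<^esub> Y) \<cdot> Comp \<alpha> (X \<odot>\<^bsub>M\<^esub> Y)) \<cdot> Mu (Src \<alpha>) (X, Y)
       = Comp \<beta> (X \<odot>\<^bsub>M\<^esub> Y) \<cdot> (Mu (Tgt \<alpha>) (X, Y) \<cdot> (Comp \<alpha> X \<star> Comp \<alpha> Y))"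
      unfolding A(4) [OF X Y, symmetric] by (rule N.assoc) (use X Y eq in \<open>simp_all add: s f M.mon_simps\<close>)
    also have "\<dots> = (Comp \<beta> (X \<odot>\<^bsub>M\<^esub> Y) \<cdot> Mu (Src \<beta>) (X, Y)) \<cdot> (Comp \<alpha> X \<star> Comp \<alpha> Y)"
      unfolding eq by (rule N.assoc [symmetric]) (use X Y eq in \<open>simp_all add: s f M.mon_simps N.mon_simps\<close>)
    also have "\<dots> = Mu (Tgt \<beta>) (X, Y) \<cdot> ((Comp \<beta> X \<star> Comp \<beta> Y) \<cdot> (Comp \<alpha> X \<star> Comp \<alpha> Y))"
      unfolding B(4) [OF X Y] by (rule N.assoc) (use X Y eq in \<open>simp_all add: s f M.mon_simps N.mon_simps\<close>)
    finally show ?thesis using X Y eq by (simp add: N.tensor_comp s)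
  qed
  moreover have "(Comp \<beta> (Unit M) \<cdot> Comp \<alpha> (Unit M)) \<cdot> Eps (Src \<alpha>) = Eps (Tgt \<beta>)"
  proof -
    have "(Comp \<beta> (Unit M) \<cdot> Comp \<alpha> (Unit M)) \<cdot> Eps (Src \<alpha>) = Comp \<beta> (Unit M) \<cdot> (Comp \<alpha> (Unit M) \<cdot> Eps (Src \<alpha>))"
      by (rule N.assoc) (use eq in \<open>simp_all add: s M.mon_simps\<close>)
    then show ?thesis unfolding A(5) eq B(5) .
  qed
  ultimately show ?thesis unfolding monoidal_trafo_def
    using natural_vertical [OF A(3) B(3) eq M.category_axioms N.category_axioms] A(1) B(2) by (simp add: M.mon_simps)
qed

lemma category_monoidal_functors:
  assumes M: "strict_monoidal M" and N: "strict_monoidal N"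
  shows "category (monoidal_functors M N)"
proof -
  interpret N: strict_monoidal N by fact
  show ?thesis
    by unfold_locales
      (auto simp: monoidal_functors_simps Hom_iff monoidal_id_trafo [OF _ M N] dest: monoidal_trafoD
        intro!: monoidal_vertical_comp M N vertical_comp_ide(1) vertical_comp_ide(2) vertical_comp_assoc N.category_axioms)
qed

text \<open>The pointwise inverses satisfy the equations of a monoidal transformation: each of them
  arises from an equation of the given transformation, a commutative square, by inverting two opposite
  sides of the square.\<close>

lemma monoidal_trafo_iso:
  fixes N (structure) and \<theta> :: "(('o, 'm, 'p, 'k) mftor, 'o, 'k) trafo"
  assumes t: "monoidal_trafo M N \<theta>" and M: "strict_monoidal M" and N: "strict_monoidal N"
    and inv: "\<And>X. X \<in> Obj M \<Longrightarrow> iso_arrow N (Comp \<theta> X)"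
  shows "iso_arrow (monoidal_functors M N) \<theta>"
proof -
  interpret M: strict_monoidal M by fact
  interpret N: strict_monoidal N by fact
  let ?F = "Src \<theta>" and ?G = "Tgt \<theta>"
  note T = monoidal_trafoD [OF t]
  note s = natural_simps(1-6) [OF T(3)] monoidal_functorD [OF T(1)] monoidal_functorD [OF T(2)]
  note f = functor_simps [OF monoidal_functorD(1) [OF T(1)]] functor_simps [OF monoidal_functorD(1) [OF T(2)]]
  have "\<forall>X \<in> Obj M. \<exists>g \<in> Hom N (FOb ?G X) (FOb ?F X). g \<cdot> Comp \<theta> X = Ide N (FOb ?F X) \<and> Comp \<theta> X \<cdot> g = Ide N (FOb ?G X)"
    using inv unfolding iso_arrow_def by (auto simp: s)
  then obtain h where h: "\<And>X. X \<in> Obj M \<Longrightarrow> h X \<in> Hom N (FOb ?G X) (FOb ?F X)"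
    "\<And>X. X \<in> Obj M \<Longrightarrow> h X \<cdot> Comp \<theta> X = Ide N (FOb ?F X)"
    "\<And>X. X \<in> Obj M \<Longrightarrow> Comp \<theta> X \<cdot> h X = Ide N (FOb ?G X)"
    by metis
  have hs: "X \<in> Obj M \<Longrightarrow> h X \<in> Arr N" "X \<in> Obj M \<Longrightarrow> Dom N (h X) = FOb ?G X" "X \<in> Obj M \<Longrightarrow> Cod N (h X) = FOb ?F X" for X
    using h(1) [of X] by (auto simp: Hom_iff)
  have move: "h Y \<cdot> b = a \<cdot> g"
    if ab: "a \<in> Arr N" "b \<in> Arr N" "c \<in> Arr N" "g \<in> Arr N" "Cod N b = FOb ?G Y" "Cod N a = FOb ?F Y"
      and dom: "Dom N b = Cod N c" "Dom N a = Dom N c" "Dom N g = Cod N c" "Cod N g = Dom N c"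
      and eq: "Comp \<theta> Y \<cdot> a = b \<cdot> c" "c \<cdot> g = Ide N (Cod N c)" and Y: "Y \<in> Obj M" for a b c g Y
  proof -
    have "h Y \<cdot> b = h Y \<cdot> (b \<cdot> (c \<cdot> g))" using ab dom eq(2) by (simp add: N.cat_simps)
    also have "b \<cdot> (c \<cdot> g) = (b \<cdot> c) \<cdot> g" by (rule N.assoc [symmetric]) (use ab dom in simp_all)
    also have "\<dots> = Comp \<theta> Y \<cdot> (a \<cdot> g)" unfolding eq(1) [symmetric] by (rule N.assoc) (use ab dom Y in \<open>simp_all add: s\<close>)
    also have "h Y \<cdot> (Comp \<theta> Y \<cdot> (a \<cdot> g)) = (h Y \<cdot> Comp \<theta> Y) \<cdot> (a \<cdot> g)"
      by (rule N.assoc [symmetric]) (use ab dom Y in \<open>simp_all add: s hs N.cat_simps\<close>)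
    finally show ?thesis using ab dom Y by (simp add: h(2) N.cat_simps)
  qed
  let ?\<psi> = "\<lparr>Src = ?G, Tgt = ?F, Comp = (\<lambda>X \<in> Obj M. h X)\<rparr>"
  have "natural M N ?\<psi>" unfolding natural_def
  proof (simp add: s h(1) M.cat_simps, intro ballI)
    fix a assume a: "a \<in> Arr M"
    show "h (Cod M a) \<cdot> FAr ?G a = FAr ?F a \<cdot> h (Dom M a)"
      by (rule move [where c = "Comp \<theta> (Dom M a)"]) (use a natural_simps(7) [OF T(3) a] in \<open>simp_all add: s f hs h M.cat_simps\<close>)
  qed
  moreover have "h (X \<odot>\<^bsub>M\<^esub> Y) \<cdot> Mu ?G (X, Y) = Mu ?F (X, Y) \<cdot> (h X \<star> h Y)"
    if X: "X \<in> Obj M" and Y: "Y \<in> Obj M" for X Y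
    by (rule move [where c = "Comp \<theta> X \<star> Comp \<theta> Y"])
      (use X Y T(4) [OF X Y] in \<open>simp_all add: s f hs h M.mon_simps N.mon_simps N.tensor_comp N.tensor_ide\<close>)
  moreover have "h (Unit M) \<cdot> Eps ?G = Eps ?F"
  proof -
    have "h (Unit M) \<cdot> Eps ?G = Eps ?F \<cdot> Ide N (Unit N)"
      by (rule move [where c = "Ide N (Unit N)"]) (use T(5) in \<open>simp_all add: s hs M.mon_simps N.mon_simps\<close>)
    then show ?thesis by (simp add: N.mon_simps s)
  qed
  ultimately have \<psi>: "monoidal_trafo M N ?\<psi>" unfolding monoidal_trafo_def using T(1,2) by (simp add: M.mon_simps)
  have "vertical_comp M N ?\<psi> \<theta> = id_trafo M N ?F" "vertical_comp M N \<theta> ?\<psi> = id_trafo M N ?G"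
    by (rule trafo_eqI [where A = "Obj M"]; simp add: h)+
  then show ?thesis unfolding iso_arrow_def
    using t \<psi> by (auto simp: monoidal_functors_simps Hom_iff intro!: bexI [of _ ?\<psi>])
qed

section \<open>Restriction along a monoidal functor\<close>

lemma comp_mftor_simps:
  "X \<in> Obj L \<Longrightarrow> FOb (comp_mftor L N F P) X = FOb F (FOb P X)"
  "f \<in> Arr L \<Longrightarrow> FAr (comp_mftor L N F P) f = FAr F (FAr P f)"
  "X \<in> Obj L \<Longrightarrow> Y \<in> Obj L \<Longrightarrow> Mu (comp_mftor L N F P) (X, Y) = FAr F (Mu P (X, Y)) \<cdot>\<^bsub>N\<^esub> Mu F (FOb P X, FOb P Y)"
  "Eps (comp_mftor L N F P) = FAr F (Eps P) \<cdot>\<^bsub>N\<^esub> Eps F"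
  "FOb (comp_mftor L N F P) \<in> extensional (Obj L)" "FAr (comp_mftor L N F P) \<in> extensional (Arr L)"
  "Mu (comp_mftor L N F P) \<in> extensional (Obj L \<times> Obj L)"
  by (simp_all add: comp_mftor_def)

text \<open>The structure isomorphisms of \<open>F\<close> are natural, so that images under \<open>F\<close> can be collected on the left. There
  the equations of \<open>P\<close> apply, and the equations of \<open>F\<close> apply to what remains on the right.\<close>

lemma monoidal_comp_mftor:
  fixes N (structure)
  assumes P: "monoidal_functor L M P" and F: "monoidal_functor M N F"
    and L: "strict_monoidal L" and M: "strict_monoidal M" and N: "strict_monoidal N"
  shows "monoidal_functor L N (comp_mftor L N F P)"
proof -
  interpret L: strict_monoidal L by fact
  interpret M: strict_monoidal M by fact
  interpret N: strict_monoidal N by fact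
  note s = monoidal_functorD [OF P] monoidal_functorD [OF F]
  note p = functor_simps [OF monoidal_functorD(1) [OF P]] and f = functor_simps [OF monoidal_functorD(1) [OF F]]
  let ?mu = "\<lambda>X Y. FAr F (Mu P (X, Y)) \<cdot> Mu F (FOb P X, FOb P Y)"
  note all = s p f L.mon_simps M.mon_simps N.mon_simps
  have mu: "?mu X Y \<in> Hom N (FOb F (FOb P X) \<odot> FOb F (FOb P Y)) (FOb F (FOb P (X \<odot>\<^bsub>L\<^esub> Y))) \<and> iso_arrow N (?mu X Y)"
    if "X \<in> Obj L" "Y \<in> Obj L" for X Y
  proof
    show "?mu X Y \<in> Hom N (FOb F (FOb P X) \<odot> FOb F (FOb P Y)) (FOb F (FOb P (X \<odot>\<^bsub>L\<^esub> Y)))"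
      using that by (simp add: Hom_iff all)
    show "iso_arrow N (?mu X Y)"
      by (rule N.iso_comp [OF s(16) functor_iso [OF s(11) M.category_axioms s(6)]]) (use that in \<open>simp_all add: all\<close>)
  qed
  have eps: "FAr F (Eps P) \<cdot> Eps F \<in> Hom N (Unit N) (FOb F (FOb P (Unit L))) \<and> iso_arrow N (FAr F (Eps P) \<cdot> Eps F)"
  proof
    show "FAr F (Eps P) \<cdot> Eps F \<in> Hom N (Unit N) (FOb F (FOb P (Unit L)))"
      by (simp add: Hom_iff all)
    show "iso_arrow N (FAr F (Eps P) \<cdot> Eps F)"
      by (rule N.iso_comp [OF s(20) functor_iso [OF s(11) M.category_axioms s(10)]]) (simp add: all)
  qed
  have natural: "FAr F (FAr P (a \<star>\<^bsub>L\<^esub> b)) \<cdot> ?mu (Dom L a) (Dom L b)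
      = ?mu (Cod L a) (Cod L b) \<cdot> (FAr F (FAr P a) \<star> FAr F (FAr P b))" if ab: "a \<in> Arr L" "b \<in> Arr L" for a b
  proof -
    have "?mu (Cod L a) (Cod L b) \<cdot> (FAr F (FAr P a) \<star> FAr F (FAr P b))
      = FAr F (Mu P (Cod L a, Cod L b)) \<cdot> (FAr F (FAr P a \<star>\<^bsub>M\<^esub> FAr P b) \<cdot> Mu F (FOb P (Dom L a), FOb P (Dom L b)))"
      unfolding monoidal_functor_natural [OF F p(2) [OF ab(1)] p(2) [OF ab(2)] HOL.refl HOL.refl HOL.refl HOL.refl, unfolded p(3,4) [OF ab(1)] p(3,4) [OF ab(2)], symmetric]
      by (rule N.assoc) (use ab in \<open>simp_all add: all\<close>)
    also have "\<dots> = FAr F (Mu P (Cod L a, Cod L b) \<cdot>\<^bsub>M\<^esub> (FAr P a \<star>\<^bsub>M\<^esub> FAr P b)) \<cdot> Mu F (FOb P (Dom L a), FOb P (Dom L b))"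
      using ab by (simp add: all N.assoc)
    also have "\<dots> = FAr F (FAr P (a \<star>\<^bsub>L\<^esub> b)) \<cdot> ?mu (Dom L a) (Dom L b)"
      unfolding monoidal_functor_natural [OF P ab HOL.refl HOL.refl HOL.refl HOL.refl] using ab by (simp add: all N.assoc)
    finally show ?thesis ..
  qed
  have half: "FAr F g \<cdot> (Mu F (A, B) \<cdot> ((FAr F a \<star> FAr F b) \<cdot> c))
      = FAr F (g \<cdot>\<^bsub>M\<^esub> (a \<star>\<^bsub>M\<^esub> b)) \<cdot> (Mu F (Dom M a, Dom M b) \<cdot> c)"
    if "g \<in> Arr M" "a \<in> Arr M" "b \<in> Arr M" "c \<in> Arr N" "Cod M a = A" "Cod M b = B" "Dom M g = A \<odot>\<^bsub>M\<^esub> B"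
      "Cod N c = FOb F (Dom M a) \<odot> FOb F (Dom M b)" for g a b c A B
  proof -
    have AB: "A \<in> Obj M" "B \<in> Obj M" using that M.cod_in by auto
    have "Mu F (A, B) \<cdot> ((FAr F a \<star> FAr F b) \<cdot> c) = (Mu F (A, B) \<cdot> (FAr F a \<star> FAr F b)) \<cdot> c"
      by (rule N.assoc [symmetric]) (use that AB in \<open>simp_all add: all\<close>)
    also have "\<dots> = (FAr F (a \<star>\<^bsub>M\<^esub> b) \<cdot> Mu F (Dom M a, Dom M b)) \<cdot> c"
      by (simp add: monoidal_functor_natural [OF F that(2,3) HOL.refl that(5) HOL.refl that(6)])
    finally show ?thesis using that AB by (simp add: all N.assoc)
  qed
  have assoc: "?mu (X \<odot>\<^bsub>L\<^esub> Y) Z \<cdot> (?mu X Y \<star> Ide N (FOb F (FOb P Z)))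
      = ?mu X (Y \<odot>\<^bsub>L\<^esub> Z) \<cdot> (Ide N (FOb F (FOb P X)) \<star> ?mu Y Z)"
    if XYZ: "X \<in> Obj L" "Y \<in> Obj L" "Z \<in> Obj L" for X Y Z
  proof -
    let ?X = "FOb P X" and ?Y = "FOb P Y" and ?Z = "FOb P Z"
    have "?mu (X \<odot>\<^bsub>L\<^esub> Y) Z \<cdot> (?mu X Y \<star> Ide N (FOb F ?Z))
        = FAr F (Mu P (X \<odot>\<^bsub>L\<^esub> Y, Z)) \<cdot> (Mu F (FOb P (X \<odot>\<^bsub>L\<^esub> Y), ?Z) \<cdot>
          ((FAr F (Mu P (X, Y)) \<star> FAr F (Ide M ?Z)) \<cdot> (Mu F (?X, ?Y) \<star> Ide N (FOb F ?Z))))"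
      using XYZ by (simp add: all N.assoc N.whisker_comp)
    also have "\<dots> = FAr F (Mu P (X \<odot>\<^bsub>L\<^esub> Y, Z) \<cdot>\<^bsub>M\<^esub> (Mu P (X, Y) \<star>\<^bsub>M\<^esub> Ide M ?Z)) \<cdot>
        (Mu F (?X \<odot>\<^bsub>M\<^esub> ?Y, ?Z) \<cdot> (Mu F (?X, ?Y) \<star> Ide N (FOb F ?Z)))"
      by (subst half) (use XYZ in \<open>simp_all add: all\<close>)
    also have "\<dots> = FAr F (Mu P (X, Y \<odot>\<^bsub>L\<^esub> Z) \<cdot>\<^bsub>M\<^esub> (Ide M ?X \<star>\<^bsub>M\<^esub> Mu P (Y, Z))) \<cdot>
        (Mu F (?X, ?Y \<odot>\<^bsub>M\<^esub> ?Z) \<cdot> (Ide N (FOb F ?X) \<star> Mu F (?Y, ?Z)))"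
      unfolding monoidal_functor_assoc [OF P XYZ] monoidal_functor_assoc [OF F p(1) [OF XYZ(1)] p(1) [OF XYZ(2)] p(1) [OF XYZ(3)]] ..
    also have "\<dots> = FAr F (Mu P (X, Y \<odot>\<^bsub>L\<^esub> Z)) \<cdot> (Mu F (?X, FOb P (Y \<odot>\<^bsub>L\<^esub> Z)) \<cdot>
          ((FAr F (Ide M ?X) \<star> FAr F (Mu P (Y, Z))) \<cdot> (Ide N (FOb F ?X) \<star> Mu F (?Y, ?Z))))"
      by (subst half) (use XYZ in \<open>simp_all add: all\<close>)
    also have "\<dots> = ?mu X (Y \<odot>\<^bsub>L\<^esub> Z) \<cdot> (Ide N (FOb F ?X) \<star> ?mu Y Z)"
      using XYZ by (simp add: all N.assoc N.whisker_comp)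
    finally show ?thesis .
  qed
  have unit: "?mu (Unit L) X \<cdot> ((FAr F (Eps P) \<cdot> Eps F) \<star> Ide N (FOb F (FOb P X))) = Ide N (FOb F (FOb P X))"
    "?mu X (Unit L) \<cdot> (Ide N (FOb F (FOb P X)) \<star> (FAr F (Eps P) \<cdot> Eps F)) = Ide N (FOb F (FOb P X))"
    if X: "X \<in> Obj L" for X
  proof -
    let ?X = "FOb P X"
    have "?mu (Unit L) X \<cdot> ((FAr F (Eps P) \<cdot> Eps F) \<star> Ide N (FOb F ?X))
        = FAr F (Mu P (Unit L, X)) \<cdot> (Mu F (FOb P (Unit L), ?X) \<cdot>
          ((FAr F (Eps P) \<star> FAr F (Ide M ?X)) \<cdot> (Eps F \<star> Ide N (FOb F ?X))))"
      using X by (simp add: all N.assoc N.whisker_comp)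
    also have "\<dots> = FAr F (Mu P (Unit L, X) \<cdot>\<^bsub>M\<^esub> (Eps P \<star>\<^bsub>M\<^esub> Ide M ?X)) \<cdot>
        (Mu F (Unit M, ?X) \<cdot> (Eps F \<star> Ide N (FOb F ?X)))"
      by (subst half) (use X in \<open>simp_all add: all\<close>)
    also have "\<dots> = Ide N (FOb F ?X)"
      unfolding monoidal_functor_unit [OF P X] monoidal_functor_unit [OF F p(1) [OF X]] using X by (simp add: all)
    finally show "?mu (Unit L) X \<cdot> ((FAr F (Eps P) \<cdot> Eps F) \<star> Ide N (FOb F ?X)) = Ide N (FOb F ?X)" .
    have "?mu X (Unit L) \<cdot> (Ide N (FOb F ?X) \<star> (FAr F (Eps P) \<cdot> Eps F))
        = FAr F (Mu P (X, Unit L)) \<cdot> (Mu F (?X, FOb P (Unit L)) \<cdot>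
          ((FAr F (Ide M ?X) \<star> FAr F (Eps P)) \<cdot> (Ide N (FOb F ?X) \<star> Eps F)))"
      using X by (simp add: all N.assoc N.whisker_comp)
    also have "\<dots> = FAr F (Mu P (X, Unit L) \<cdot>\<^bsub>M\<^esub> (Ide M ?X \<star>\<^bsub>M\<^esub> Eps P)) \<cdot>
        (Mu F (?X, Unit M) \<cdot> (Ide N (FOb F ?X) \<star> Eps F))"
      by (subst half) (use X in \<open>simp_all add: all\<close>)
    also have "\<dots> = Ide N (FOb F ?X)"
      unfolding monoidal_functor_unit [OF P X] monoidal_functor_unit [OF F p(1) [OF X]] using X by (simp add: all)
    finally show "?mu X (Unit L) \<cdot> (Ide N (FOb F ?X) \<star> (FAr F (Eps P) \<cdot> Eps F)) = Ide N (FOb F ?X)" .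
  qed
  have "is_functor L N (comp_mftor L N F P)"
    unfolding is_functor_def comp_mftor_def by (simp add: all)
  then show ?thesis unfolding monoidal_functor_def
    using mu eps natural assoc unit by (simp add: comp_mftor_simps L.mon_simps)
qed

lemma monoidal_restrict_trafo:
  fixes N (structure)
  assumes P: "monoidal_functor L M P" and t: "monoidal_trafo M N \<theta>"
    and L: "strict_monoidal L" and M: "strict_monoidal M" and N: "strict_monoidal N"
  shows "monoidal_trafo L N \<lparr>Src = comp_mftor L N (Src \<theta>) P, Tgt = comp_mftor L N (Tgt \<theta>) P,
         Comp = (\<lambda>X \<in> Obj L. Comp \<theta> (FOb P X))\<rparr>"
proof -
  interpret L: strict_monoidal L by fact
  interpret M: strict_monoidal M by fact
  interpret N: strict_monoidal N by fact
  note T = monoidal_trafoD [OF t]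
  let ?F = "Src \<theta>" and ?G = "Tgt \<theta>"
  note s = monoidal_functorD [OF P] monoidal_functorD [OF T(1)] monoidal_functorD [OF T(2)] natural_simps(1-6) [OF T(3)]
  note f = functor_simps [OF monoidal_functorD(1) [OF P]] functor_simps [OF monoidal_functorD(1) [OF T(1)]] functor_simps [OF monoidal_functorD(1) [OF T(2)]]
  note all = s f L.mon_simps M.mon_simps N.mon_simps
  note mon = monoidal_comp_mftor [OF P T(1) L M N] monoidal_comp_mftor [OF P T(2) L M N]
  have slide: "Comp \<theta> (Cod M a) \<cdot> (FAr ?F a \<cdot> b) = FAr ?G a \<cdot> (Comp \<theta> (Dom M a) \<cdot> b)"
    if "a \<in> Arr M" "b \<in> Arr N" "Cod N b = FOb ?F (Dom M a)" for a b
  proof -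
    have "Comp \<theta> (Cod M a) \<cdot> (FAr ?F a \<cdot> b) = (Comp \<theta> (Cod M a) \<cdot> FAr ?F a) \<cdot> b"
      by (rule N.assoc [symmetric]) (use that in \<open>simp_all add: all\<close>)
    also have "\<dots> = FAr ?G a \<cdot> (Comp \<theta> (Dom M a) \<cdot> b)"
      unfolding natural_simps(7) [OF T(3) that(1)] by (rule N.assoc) (use that in \<open>simp_all add: all\<close>)
    finally show ?thesis .
  qed
  have "Comp \<theta> (FOb P (X \<odot>\<^bsub>L\<^esub> Y)) \<cdot> (FAr ?F (Mu P (X, Y)) \<cdot> Mu ?F (FOb P X, FOb P Y))
     = (FAr ?G (Mu P (X, Y)) \<cdot> Mu ?G (FOb P X, FOb P Y)) \<cdot> (Comp \<theta> (FOb P X) \<star> Comp \<theta> (FOb P Y))"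
    if X: "X \<in> Obj L" and Y: "Y \<in> Obj L" for X Y
    using slide [of "Mu P (X, Y)" "Mu ?F (FOb P X, FOb P Y)"] X Y T(4) [of "FOb P X" "FOb P Y"] by (simp add: all N.assoc)
  moreover have "Comp \<theta> (FOb P (Unit L)) \<cdot> (FAr ?F (Eps P) \<cdot> Eps ?F) = FAr ?G (Eps P) \<cdot> Eps ?G"
    using slide [of "Eps P" "Eps ?F"] T(5) by (simp add: all)
  moreover have "Comp \<theta> (FOb P (Cod L a)) \<cdot> FAr ?F (FAr P a) = FAr ?G (FAr P a) \<cdot> Comp \<theta> (FOb P (Dom L a))"
    if "a \<in> Arr L" for a
    using natural_simps(7) [OF T(3), of "FAr P a"] that by (simp add: f)
  then have "natural L N \<lparr>Src = comp_mftor L N ?F P, Tgt = comp_mftor L N ?G P, Comp = (\<lambda>X \<in> Obj L. Comp \<theta> (FOb P X))\<rparr>"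
    unfolding natural_def using monoidal_functorD(1) [OF mon(1)] monoidal_functorD(1) [OF mon(2)]
    by (simp add: comp_mftor_simps all Hom_iff)
  ultimately show ?thesis unfolding monoidal_trafo_def using mon by (simp add: comp_mftor_simps L.mon_simps)
qed

lemma restriction_simps:
  "monoidal_functor M N F \<Longrightarrow> FOb (restriction L M N P) F = comp_mftor L N F P"
  "monoidal_trafo M N \<theta> \<Longrightarrow> FAr (restriction L M N P) \<theta> = \<lparr>Src = comp_mftor L N (Src \<theta>) P, Tgt = comp_mftor L N (Tgt \<theta>) P,
         Comp = (\<lambda>X \<in> Obj L. Comp \<theta> (FOb P X))\<rparr>"
  "FOb (restriction L M N P) \<in> extensional {F. monoidal_functor M N F}"
  "FAr (restriction L M N P) \<in> extensional {\<theta>. monoidal_trafo M N \<theta>}"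
  by (simp_all add: restriction_def monoidal_functors_simps)

lemma functor_restriction:
  assumes P: "monoidal_functor L M P" and L: "strict_monoidal L" and M: "strict_monoidal M" and N: "strict_monoidal N"
  shows "is_functor (monoidal_functors M N) (monoidal_functors L N) (restriction L M N P)"
proof -
  interpret L: strict_monoidal L by fact
  interpret M: strict_monoidal M by fact
  note p = functor_simps [OF monoidal_functorD(1) [OF P]]
  have 1: "FAr (restriction L M N P) (id_trafo M N F) = id_trafo L N (comp_mftor L N F P)" if F: "monoidal_functor M N F" for F
    unfolding restriction_simps(2) [OF monoidal_id_trafo [OF F M N]]
    by (rule trafo_eqI [where A = "Obj L"]) (simp_all add: p comp_mftor_simps)
  have 2: "FAr (restriction L M N P) (vertical_comp M N \<beta> \<alpha>)
      = vertical_comp L N (FAr (restriction L M N P) \<beta>) (FAr (restriction L M N P) \<alpha>)"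
    if a: "monoidal_trafo M N \<alpha>" and b: "monoidal_trafo M N \<beta>" and eq: "Src \<beta> = Tgt \<alpha>" for \<alpha> \<beta>
    unfolding restriction_simps(2) [OF monoidal_vertical_comp [OF a b eq [symmetric] M N]] restriction_simps(2) [OF a] restriction_simps(2) [OF b]
    by (rule trafo_eqI [where A = "Obj L"]) (simp_all add: p)
  show ?thesis unfolding is_functor_def
    using monoidal_comp_mftor [OF P _ L M N] monoidal_restrict_trafo [OF P _ L M N] 1 2
    by (auto simp: monoidal_functors_simps restriction_simps PiE_iff dest: monoidal_trafoD)
qed

section \<open>The braid cobordism category is discrete\<close>

lemma braid_equiv_words: "braid_equiv n u v \<Longrightarrow> u \<in> words n \<and> v \<in> words n"
  by (induction rule: braid_equiv.induct) (auto simp: Pos_letters)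

lemma braid_equiv_iff_movie: "braid_equiv n u v \<longleftrightarrow> (\<exists>p. movie n u p v)"
proof
  assume "braid_equiv n u v"
  then show "\<exists>p. movie n u p v"
  proof (induction rule: braid_equiv.induct)
    case (refl w)
    then show ?case by (auto intro: exI [of _ "[]"])
  next
    case (sym v w)
    then show ?case using movie_inv by blast
  next
    case (trans u v w)
    then show ?case using movie_appendI by blast
  next
    case (inverse a b x)
    then have "movie n (a @ [x, bar x] @ b) [(a, Cancel x, b)] (a @ b)"
      using movie_step [of n a "Cancel x" b] by simp
    then show ?case by blast
  next
    case (commutation a b i j)
    then have "movie n (a @ [Pos i, Pos j] @ b) [(a, Exch i j, b)] (a @ [Pos j, Pos i] @ b)"
      using movie_step [of n a "Exch i j" b] by simp
    then show ?case by blast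
  next
    case (braid a b i j)
    then have "movie n (a @ [Pos i, Pos j, Pos i] @ b) [(a, RIII i j, b)] (a @ [Pos j, Pos i, Pos j] @ b)"
      using movie_step [of n a "RIII i j" b] by simp
    then show ?case by blast
  qed
next
  have step: "braid_equiv n (a @ move_src m @ b) (a @ move_tgt m @ b)" if "a \<in> words n" "b \<in> words n" "valid_move n m" for n a m b
  proof (cases m)
    case (Create x)
    then show ?thesis using braid_equiv.sym [OF braid_equiv.inverse [of a n b x]] that by simp
  next
    case (Cancel x)
    then show ?thesis using braid_equiv.inverse [of a n b x] that by simp
  next
    case (Exch i j)
    then show ?thesis using braid_equiv.commutation [of a n b i j] that by simp
  next
    case (RIII i j)
    then show ?thesis using braid_equiv.braid [of a n b i j] that by simp
  qed
  assume "\<exists>p. movie n u p v"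
  then obtain p where "movie n u p v" by blast
  then show "braid_equiv n u v"
  proof (induction n u p v rule: movie.induct)
    case (2 n u a m b p v)
    then have w: "a \<in> words n" "b \<in> words n" "valid_move n m" and u: "u = a @ move_src m @ b"
      and IH: "braid_equiv n (a @ move_tgt m @ b) v" by simp_all
    show ?case unfolding u by (rule braid_equiv.trans [OF step [OF w] IH])
  qed (auto intro: braid_equiv.refl)
qed

lemma braid_equiv_append:
  assumes "braid_equiv n u u'" "braid_equiv n v v'"
  shows "braid_equiv n (u @ v) (u' @ v')"
proof -
  obtain p q where p: "movie n u p u'" and q: "movie n v q v'" using assms braid_equiv_iff_movie by blast
  have "movie n (u @ v) (whisker [] p v @ whisker u' q []) (u' @ v')"
    by (rule movie_appendI [OF movie_whisker_right [OF p] movie_whisker_left [OF q]]) (use movie_ends [OF p] movie_ends [OF q] in auto)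
  then show ?thesis using braid_equiv_iff_movie by blast
qed

text \<open>By coherence an arrow is determined by its ends; its class consists of all movies between them.\<close>

definition arrow :: "nat \<Rightarrow> word \<Rightarrow> word \<Rightarrow> cobordism" where
  "arrow n u v = (u, {p. movie n u p v}, v)"

lemma movie_class_arrow: "movie n u p v \<Longrightarrow> movie_class n u p v = arrow n u v"
  unfolding movie_class_def arrow_def using coherence equiv_movie by blast

lemma arrow_inject [simp]: "arrow n u v = arrow n u' v' \<longleftrightarrow> u = u' \<and> v = v'"
  by (auto simp: arrow_def)

lemma cob_Arr: "f \<in> Arr (braid_cob n) \<longleftrightarrow> (\<exists>u v. braid_equiv n u v \<and> f = arrow n u v)"
proof -
  have "Arr (braid_cob n) = {movie_class n u p v | u p v. movie n u p v}" by (simp add: braid_cob_def)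
  then show ?thesis using movie_class_arrow braid_equiv_iff_movie by fastforce
qed

lemma cob_Arr_ball: "(\<forall>f \<in> Arr (braid_cob n). P f) \<longleftrightarrow> (\<forall>u v. braid_equiv n u v \<longrightarrow> P (arrow n u v))"
  by (auto simp: cob_Arr)

lemma cob_simps:
  "Obj (braid_cob n) = words n" "Dom (braid_cob n) (arrow n u v) = u" "Cod (braid_cob n) (arrow n u v) = v"
  "u \<in> words n \<Longrightarrow> Ide (braid_cob n) u = arrow n u u"
  "TOb (braid_cob n) = (@)" "Unit (braid_cob n) = []"
  using movie_class_arrow [of n u "[]" u] by (simp_all add: braid_cob_def arrow_def)

lemma cob_Cmp:
  assumes "braid_equiv n u v" "braid_equiv n v w"
  shows "arrow n v w \<cdot>\<^bsub>braid_cob n\<^esub> arrow n u v = arrow n u w"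
proof -
  obtain p q where p: "movie n u p v" and q: "movie n v q w" using assms braid_equiv_iff_movie by blast
  have "{r. \<exists>p \<in> {p. movie n u p v}. \<exists>q \<in> {q. movie n v q w}. movie_equiv n u w (p @ q) r} = {r. movie n u r w}"
    using p q movie_appendI [OF p q] coherence equiv_movie by blast
  then show ?thesis by (simp add: braid_cob_def arrow_def)
qed

lemma cob_TAr:
  assumes "braid_equiv n u u'" "braid_equiv n v v'"
  shows "arrow n u u' \<star>\<^bsub>braid_cob n\<^esub> arrow n v v' = arrow n (u @ v) (u' @ v')"
proof -
  obtain p q where p: "movie n u p u'" and q: "movie n v q v'" using assms braid_equiv_iff_movie by blast
  have m: "movie n (u @ v) (whisker [] p v @ whisker u' q []) (u' @ v')"
    by (rule movie_appendI [OF movie_whisker_right [OF p] movie_whisker_left [OF q]]) (use movie_ends [OF p] movie_ends [OF q] in auto)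
  have "{r. \<exists>p \<in> {p. movie n u p u'}. \<exists>q \<in> {q. movie n v q v'}.
      movie_equiv n (u @ v) (u' @ v') (whisker [] p v @ whisker u' q []) r} = {r. movie n (u @ v) r (u' @ v')}"
    using p q m coherence equiv_movie by blast
  then show ?thesis by (simp add: braid_cob_def arrow_def)
qed

lemma cob_Hom: "f \<in> Hom (braid_cob n) u v \<longleftrightarrow> braid_equiv n u v \<and> f = arrow n u v"
  by (auto simp: Hom_iff cob_Arr cob_simps)

lemma strict_monoidal_braid_cob: "strict_monoidal (braid_cob n)"
proof -
  have ArrD: "\<exists>u v. braid_equiv n u v \<and> u \<in> words n \<and> v \<in> words n \<and> f = arrow n u v" if "f \<in> Arr (braid_cob n)" for f
    using that braid_equiv_words unfolding cob_Arr by blast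
  have nil: "braid_equiv n [] []" by (simp add: braid_equiv.refl)
  show ?thesis
  proof (unfold_locales, goal_cases)
    case 1 then show ?case by (auto simp: cob_Arr cob_simps dest: braid_equiv_words)
  next
    case 2 then show ?case by (auto simp: cob_Arr cob_simps dest: braid_equiv_words)
  next
    case 3 then show ?case by (auto simp: cob_Hom cob_simps intro: braid_equiv.refl)
  next
    case 4 then show ?case by (auto simp: cob_Hom cob_Cmp intro: braid_equiv.trans)
  next
    case (5 f u v)
    then show ?case
      using braid_equiv_words [of n u v] braid_equiv.refl [of u n] braid_equiv.refl [of v n]
      by (simp add: cob_Hom cob_simps cob_Cmp)
  next
    case (6 f u v)
    then show ?case
      using braid_equiv_words [of n u v] braid_equiv.refl [of u n] braid_equiv.refl [of v n]
      by (simp add: cob_Hom cob_simps cob_Cmp)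
  next
    case (7 f u v g w h x)
    then show ?case using braid_equiv.trans [of n u v w] braid_equiv.trans [of n v w x] by (simp add: cob_Hom cob_Cmp)
  next
    case 8 then show ?case by (simp add: cob_simps)
  next
    case 9 then show ?case by (simp add: cob_simps)
  next
    case 10 then show ?case by (auto simp: cob_Hom cob_TAr cob_simps intro: braid_equiv_append)
  next
    case 11 then show ?case by (simp add: cob_simps cob_TAr braid_equiv.refl)
  next
    case (12 f u u' f' u'' g v v' g' v'')
    then show ?case
      using braid_equiv.trans [of n u u' u''] braid_equiv.trans [of n v v' v''] by (simp add: cob_Hom cob_TAr cob_Cmp braid_equiv_append)
  next
    case 13 then show ?case by (simp add: cob_simps)
  next
    case (14 f g h)
    then show ?case by (auto simp: cob_Arr cob_TAr braid_equiv_append)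
  next
    case 15 then show ?case by (simp add: cob_simps)
  next
    case (16 f)
    then show ?case using nil by (auto simp: cob_Arr cob_simps cob_TAr)
  qed
qed

lemma cob_iso: "braid_equiv n u v \<Longrightarrow> iso_arrow (braid_cob n) (arrow n u v)"
  unfolding iso_arrow_def
  using braid_equiv.sym [of n u v] braid_equiv_words [of n u v]
  by (intro conjI bexI [of _ "arrow n v u"]) (auto simp: cob_simps cob_Cmp cob_Hom cob_Arr)

section \<open>The braid group\<close>

lemma braid_class_eq: "u \<in> words n \<Longrightarrow> braid_class n u = braid_class n v \<longleftrightarrow> braid_equiv n u v"
proof -
  assume u: "u \<in> words n"
  have "w \<in> braid_class n u \<longleftrightarrow> w \<in> braid_class n v" if "braid_equiv n u v" for w
    using braid_equiv.trans [OF that] braid_equiv.trans [OF braid_equiv.sym [OF that]] by (auto simp: braid_class_def)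
  moreover have "braid_equiv n u v" if "braid_class n u = braid_class n v"
  proof -
    have "u \<in> braid_class n v" using braid_equiv.refl [OF u] that by (auto simp: braid_class_def)
    then show ?thesis by (auto simp: braid_class_def intro: braid_equiv.sym)
  qed
  ultimately show ?thesis by blast
qed

lemma braid_group_simps:
  "carrier (braid_group n) = braid_class n ` words n" "one (braid_group n) = braid_class n []"
  by (simp_all add: braid_group_def)

lemma braid_group_mult:
  assumes "u \<in> words n" "v \<in> words n"
  shows "mult (braid_group n) (braid_class n u) (braid_class n v) = braid_class n (u @ v)"
proof -
  have uv: "u @ v \<in> words n" using assms by simp
  have "braid_class n (a @ b) = braid_class n (u @ v)" if "a \<in> braid_class n u" "b \<in> braid_class n v" for a b
  proof -
    have "braid_equiv n (u @ v) (a @ b)" using that by (intro braid_equiv_append) (simp_all add: braid_class_def)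
    then show ?thesis using braid_class_eq [OF uv, of "a @ b"] by simp
  qed
  then have "mult (braid_group n) (braid_class n u) (braid_class n v) = (\<Union>a \<in> braid_class n u. \<Union>b \<in> braid_class n v. braid_class n (u @ v))"
    by (simp add: braid_group_def)
  moreover have "u \<in> braid_class n u" "v \<in> braid_class n v"
    using assms by (simp_all add: braid_class_def braid_equiv.refl)
  ultimately show ?thesis by blast
qed

lemma Omega_simps:
  "Obj (Omega G) = carrier G" "Arr (Omega G) = carrier G" "Dom (Omega G) = (\<lambda>g. g)" "Cod (Omega G) = (\<lambda>g. g)"
  "Ide (Omega G) = (\<lambda>g. g)" "Cmp (Omega G) = (\<lambda>h g. g)" "TOb (Omega G) = mult G" "TAr (Omega G) = mult G" "Unit (Omega G) = one G"
  by (simp_all add: Omega_def)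

lemma strict_monoidal_Omega:
  "strict_monoidal (Omega (braid_group n))"
proof -
  have "mult (braid_group n) g h \<in> carrier (braid_group n)" if "g \<in> carrier (braid_group n)" "h \<in> carrier (braid_group n)" for g h
    using that unfolding braid_group_simps by (elim imageE) (simp add: braid_group_mult)
  moreover have "mult (braid_group n) (mult (braid_group n) f g) h = mult (braid_group n) f (mult (braid_group n) g h)"
    if "f \<in> carrier (braid_group n)" "g \<in> carrier (braid_group n)" "h \<in> carrier (braid_group n)" for f g h
    using that unfolding braid_group_simps by (elim imageE) (simp add: braid_group_mult)
  moreover have "mult (braid_group n) (one (braid_group n)) g = g" "mult (braid_group n) g (one (braid_group n)) = g"
    if "g \<in> carrier (braid_group n)" for g
    using that unfolding braid_group_simps by (elim imageE; simp add: braid_group_mult)+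
  moreover have "one (braid_group n) \<in> carrier (braid_group n)" by (simp add: braid_group_simps)
  ultimately show ?thesis by unfold_locales (auto simp: Omega_simps Hom_iff)
qed

lemma projection_simps:
  "w \<in> words n \<Longrightarrow> FOb (projection n) w = braid_class n w"
  "braid_equiv n u v \<Longrightarrow> FAr (projection n) (arrow n u v) = braid_class n u"
  "u \<in> words n \<Longrightarrow> v \<in> words n \<Longrightarrow> Mu (projection n) (u, v) = braid_class n (u @ v)"
  "Eps (projection n) = braid_class n []"
  "FOb (projection n) \<in> extensional (words n)" "FAr (projection n) \<in> extensional (Arr (braid_cob n))"
  "Mu (projection n) \<in> extensional (words n \<times> words n)"
  by (simp_all add: projection_def cob_simps cob_Arr)

lemma Omega_iso: "g \<in> carrier G \<Longrightarrow> iso_arrow (Omega G) g"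
  by (auto simp: iso_arrow_def Omega_simps Hom_iff)

lemma monoidal_projection: "monoidal_functor (braid_cob n) (Omega (braid_group n)) (projection n)"
proof -
  have eq: "braid_class n u = braid_class n v" if "braid_equiv n u v" for u v
    using that braid_class_eq braid_equiv_words by blast
  have w: "u \<in> words n" "v \<in> words n" if "braid_equiv n u v" for u v using braid_equiv_words that by auto
  have "is_functor (braid_cob n) (Omega (braid_group n)) (projection n)"
    unfolding is_functor_def PiE_iff cob_Arr_ball
    by (simp add: cob_simps projection_simps Omega_simps braid_group_simps cob_Cmp braid_equiv.refl w)
      (metis eq projection_simps(2) braid_equiv.trans)
  then show ?thesis unfolding monoidal_functor_def cob_Arr_ball
    by (simp add: cob_simps projection_simps Omega_simps braid_group_simps braid_group_mult Hom_iff
        cob_TAr braid_equiv_append Omega_iso w)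
qed

section \<open>A quasi-inverse of the projection\<close>

definition some_word :: "nat \<Rightarrow> word set \<Rightarrow> word" where
  "some_word n g = (SOME w. w \<in> words n \<and> braid_class n w = g)"

lemma some_word: "g \<in> carrier (braid_group n) \<Longrightarrow> some_word n g \<in> words n \<and> braid_class n (some_word n g) = g"
  unfolding some_word_def braid_group_simps by (rule someI_ex) auto

lemma some_word_class: "w \<in> words n \<Longrightarrow> braid_equiv n (some_word n (braid_class n w)) w"
proof -
  assume w: "w \<in> words n"
  then have "braid_class n w \<in> carrier (braid_group n)" by (simp add: braid_group_simps)
  from some_word [OF this] show ?thesis using braid_class_eq [of "some_word n (braid_class n w)" n w] by blast
qed

text \<open>The quasi-inverse of the projection. Its structure isomorphisms are the unique arrows between words of
  the same braid.\<close>

definition lift :: "nat \<Rightarrow> (word set, word set, word, cobordism) mftor" where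
  "lift n =
     \<lparr>FOb = (\<lambda>g \<in> carrier (braid_group n). some_word n g),
      FAr = (\<lambda>g \<in> carrier (braid_group n). arrow n (some_word n g) (some_word n g)),
      Mu = (\<lambda>(g, h) \<in> carrier (braid_group n) \<times> carrier (braid_group n).
        arrow n (some_word n g @ some_word n h) (some_word n (mult (braid_group n) g h))),
      Eps = arrow n [] (some_word n (one (braid_group n)))\<rparr>"

lemma lift_simps:
  "g \<in> carrier (braid_group n) \<Longrightarrow> FOb (lift n) g = some_word n g"
  "g \<in> carrier (braid_group n) \<Longrightarrow> FAr (lift n) g = arrow n (some_word n g) (some_word n g)"
  "g \<in> carrier (braid_group n) \<Longrightarrow> h \<in> carrier (braid_group n) \<Longrightarrow>
     Mu (lift n) (g, h) = arrow n (some_word n g @ some_word n h) (some_word n (mult (braid_group n) g h))"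
  "Eps (lift n) = arrow n [] (some_word n (one (braid_group n)))"
  "FOb (lift n) \<in> extensional (carrier (braid_group n))" "FAr (lift n) \<in> extensional (carrier (braid_group n))"
  "Mu (lift n) \<in> extensional (carrier (braid_group n) \<times> carrier (braid_group n))"
  by (auto simp: lift_def)

lemma monoidal_lift: "monoidal_functor (Omega (braid_group n)) (braid_cob n) (lift n)"
proof -
  interpret M: strict_monoidal "Omega (braid_group n)" by (rule strict_monoidal_Omega)
  let ?G = "braid_group n" and ?s = "some_word n"
  have s: "?s g \<in> words n" if "g \<in> carrier ?G" for g using some_word that by blast
  have closed: "mult ?G g h \<in> carrier ?G" if "g \<in> carrier ?G" "h \<in> carrier ?G" for g h
    using M.tensor_ob_in that by (simp add: Omega_simps)
  have mu: "braid_equiv n (?s g @ ?s h) (?s (mult ?G g h))" if g: "g \<in> carrier ?G" and h: "h \<in> carrier ?G" for g h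
  proof -
    have "mult ?G g h = braid_class n (?s g @ ?s h)"
      using braid_group_mult [of "?s g" n "?s h"] some_word g h by simp
    then show ?thesis using some_word_class [of "?s g @ ?s h" n, THEN braid_equiv.sym] s g h by simp
  qed
  have one: "one ?G \<in> carrier ?G" using M.unit_in by (simp add: Omega_simps)
  have eps: "braid_equiv n [] (?s (one ?G))"
    using some_word_class [of "[]" n, THEN braid_equiv.sym] by (simp add: braid_group_simps)
  have id: "braid_equiv n (?s g) (?s g)" if "g \<in> carrier ?G" for g using s [OF that] by (rule braid_equiv.refl)
  have "is_functor (Omega ?G) (braid_cob n) (lift n)"
    unfolding is_functor_def by (auto simp: Omega_simps lift_simps cob_simps cob_Cmp cob_Arr id s PiE_iff)
  moreover have "mult ?G (mult ?G f g) h = mult ?G f (mult ?G g h)" if "f \<in> carrier ?G" "g \<in> carrier ?G" "h \<in> carrier ?G" for f g h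
    using M.tensor_ob_assoc [of f g h] that by (simp add: Omega_simps)
  moreover have "mult ?G (one ?G) g = g" "mult ?G g (one ?G) = g" if "g \<in> carrier ?G" for g
    using M.tensor_ob_unit [of g] that by (simp_all add: Omega_simps)
  moreover have "braid_equiv n (?s g @ ?s h) (?s g @ ?s h)" if "g \<in> carrier ?G" "h \<in> carrier ?G" for g h
    using braid_equiv_append id that by blast
  moreover have "braid_equiv n (?s f @ ?s g @ ?s h) (?s (mult ?G f g) @ ?s h)"
    "braid_equiv n (?s f @ ?s g @ ?s h) (?s f @ ?s (mult ?G g h))"
    if "f \<in> carrier ?G" "g \<in> carrier ?G" "h \<in> carrier ?G" for f g h
    using braid_equiv_append [OF mu id, of f g h] braid_equiv_append [OF id mu, of f g h] that by simp_all
  moreover have "braid_equiv n (?s (mult ?G f g) @ ?s h) (?s (mult ?G f (mult ?G g h)))"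
    if "f \<in> carrier ?G" "g \<in> carrier ?G" "h \<in> carrier ?G" for f g h
    using mu [OF closed, of f g h] M.tensor_ob_assoc [of f g h] that by (simp add: Omega_simps)
  moreover have "braid_equiv n (?s g) (?s (one ?G) @ ?s g)" "braid_equiv n (?s g) (?s g @ ?s (one ?G))"
    "braid_equiv n (?s (one ?G) @ ?s g) (?s g)" "braid_equiv n (?s g @ ?s (one ?G)) (?s g)" if "g \<in> carrier ?G" for g
    using braid_equiv_append [OF eps id [OF that]] braid_equiv_append [OF id [OF that] eps] braid_equiv.sym by simp_all
  ultimately show ?thesis
    unfolding monoidal_functor_def
    by (simp add: Omega_simps lift_simps cob_simps cob_Hom cob_Cmp cob_TAr cob_iso s id mu eps closed one)
qed

section \<open>Equivalence of the categories of actions\<close>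

text \<open>The arrows of \<open>Omega\<close> are identities, so that restricting twice inserts identities only and gives back the
  same functor.\<close>

lemma restrict_lift_projection:
  assumes F: "monoidal_functor (Omega (braid_group n)) N F" and N: "strict_monoidal N"
  shows "comp_mftor (Omega (braid_group n)) N (comp_mftor (braid_cob n) N F (projection n)) (lift n) = F"
proof -
  let ?G = "braid_group n"
  interpret M: strict_monoidal "Omega ?G" by (rule strict_monoidal_Omega)
  interpret N: strict_monoidal N by fact
  note f = functor_simps [OF monoidal_functorD(1) [OF F]] monoidal_functorD [OF F]
  note l = functor_simps [OF monoidal_functorD(1) [OF monoidal_lift [of n]]] monoidal_functorD [OF monoidal_lift [of n]]
  have s: "some_word n g \<in> words n" "braid_class n (some_word n g) = g" if "g \<in> carrier ?G" for g using some_word that by auto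
  have id: "FAr F g = Ide N (FOb F g)" if "g \<in> carrier ?G" for g
    using f(5) [of g] that by (simp add: Omega_simps)
  have closed: "mult ?G g h \<in> carrier ?G" if "g \<in> carrier ?G" "h \<in> carrier ?G" for g h
    using M.tensor_ob_in that by (simp add: Omega_simps)
  have one: "one ?G \<in> carrier ?G" using M.unit_in by (simp add: Omega_simps)
  have equiv: "braid_equiv n (some_word n g) (some_word n g)" if "g \<in> carrier ?G" for g
    using s(1) [OF that] by (rule braid_equiv.refl)
  have mu: "braid_equiv n (some_word n g @ some_word n h) (some_word n (mult ?G g h))"
    if g: "g \<in> carrier ?G" and h: "h \<in> carrier ?G" for g h
    using l(11) [of g h] g h by (auto simp: Omega_simps lift_simps cob_Arr)
  have eps: "braid_equiv n [] (some_word n (one ?G))"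
    using l(15) by (auto simp: Omega_simps lift_simps cob_Arr)
  have cls: "braid_class n (some_word n g @ some_word n h) = mult ?G g h" if "g \<in> carrier ?G" "h \<in> carrier ?G" for g h
    using braid_group_mult [of "some_word n g" n "some_word n h"] s that by simp
  show ?thesis
    by (rule mftor_eqI [where A = "carrier ?G" and B = "carrier ?G"])
      (use f(7,8,10) one comp_mftor_simps(5-7) [of "Omega ?G" N] in \<open>simp_all add: comp_mftor_simps Omega_simps lift_simps cob_simps
        cob_Arr equiv mu eps projection_simps s id cls closed braid_group_simps(2) [symmetric] f N.cat_simps\<close>)
qed

text \<open>The monoidal isomorphism from the twofold restriction of \<open>F\<close> to \<open>F\<close>: the image of the unique arrow from
  the chosen word of a braid to a given word.\<close>

definition counit :: "nat \<Rightarrow> ('p, 'k, 'y) moncat_scheme \<Rightarrow> (word, cobordism, 'p, 'k) mftor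
    \<Rightarrow> ((word, cobordism, 'p, 'k) mftor, word, 'k) trafo" where
  "counit n N F =
     \<lparr>Src = comp_mftor (braid_cob n) N (comp_mftor (Omega (braid_group n)) N F (lift n)) (projection n), Tgt = F,
      Comp = (\<lambda>w \<in> words n. FAr F (arrow n (some_word n (braid_class n w)) w))\<rparr>"

lemma functor_arrows:
  assumes F: "is_functor (braid_cob n) N F" and "braid_equiv n u v" "braid_equiv n v w"
  shows "FAr F (arrow n v w) \<cdot>\<^bsub>N\<^esub> FAr F (arrow n u v) = FAr F (arrow n u w)"
  using functor_simps(6) [OF F, of "arrow n u v" "arrow n v w"] assms by (simp add: cob_Arr cob_simps cob_Cmp)

lemma functor_arrow_arr:
  assumes F: "is_functor (braid_cob n) N F" and "braid_equiv n u v"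
  shows "FAr F (arrow n u v) \<in> Arr N" "Dom N (FAr F (arrow n u v)) = FOb F u" "Cod N (FAr F (arrow n u v)) = FOb F v"
  using functor_simps(2-4) [OF F, of "arrow n u v"] assms by (auto simp: cob_Arr cob_simps)

lemma monoidal_counit:
  fixes N (structure)
  assumes F: "monoidal_functor (braid_cob n) N F" and N: "strict_monoidal N"
  shows "monoidal_trafo (braid_cob n) N (counit n N F)"
proof -
  let ?L = "braid_cob n" and ?M = "Omega (braid_group n)" and ?G = "braid_group n"
  let ?r = "\<lambda>w. some_word n (braid_class n w)"
  let ?FS = "comp_mftor ?M N F (lift n)"
  let ?T = "comp_mftor ?L N ?FS (projection n)"
  interpret L: strict_monoidal ?L by (rule strict_monoidal_braid_cob)
  interpret M: strict_monoidal ?M by (rule strict_monoidal_Omega)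
  interpret N: strict_monoidal N by fact
  have FS: "monoidal_functor ?M N ?FS" by (rule monoidal_comp_mftor [OF monoidal_lift F strict_monoidal_Omega strict_monoidal_braid_cob N])
  have T: "monoidal_functor ?L N ?T" by (rule monoidal_comp_mftor [OF monoidal_projection FS strict_monoidal_braid_cob strict_monoidal_Omega N])
  note F1 = monoidal_functorD(1) [OF F]
  note f = functor_simps [OF F1] monoidal_functorD [OF F]
  have cls: "braid_class n w \<in> carrier ?G" if "w \<in> words n" for w using that by (simp add: braid_group_simps)
  have r: "?r w \<in> words n" "braid_equiv n (?r w) w" "braid_equiv n (?r w) (?r w)" if "w \<in> words n" for w
    using some_word [OF cls [OF that]] some_word_class [OF that] by (auto intro: braid_equiv.refl)
  have TOb: "FOb ?T w = FOb F (?r w)" if "w \<in> words n" for w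
    using that cls by (simp add: comp_mftor_simps cob_simps Omega_simps projection_simps lift_simps)
  have TAr: "FAr ?T (arrow n u v) = FAr F (arrow n (?r u) (?r u))" if "braid_equiv n u v" for u v
    using that cls braid_equiv_words [OF that]
    by (simp add: comp_mftor_simps cob_simps cob_Arr Omega_simps projection_simps lift_simps)
  have r_eq: "?r u = ?r v" if "braid_equiv n u v" for u v using that braid_class_eq braid_equiv_words by metis
  have rr: "braid_equiv n (?r u @ ?r v) (?r (u @ v))" if "u \<in> words n" "v \<in> words n" for u v
    using braid_equiv.trans [OF braid_equiv_append [OF r(2) [OF that(1)] r(2) [OF that(2)]] braid_equiv.sym [OF r(2) [of "u @ v"]]] that by simp
  have TMu: "Mu ?T (u, v) = FAr F (arrow n (?r u @ ?r v) (?r (u @ v))) \<cdot> Mu F (?r u, ?r v)"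
    if uv: "u \<in> words n" "v \<in> words n" for u v
  proof -
    have "Mu ?T (u, v) = FAr F (arrow n (?r (u @ v)) (?r (u @ v))) \<cdot>
        (FAr F (arrow n (?r u @ ?r v) (?r (u @ v))) \<cdot> Mu F (?r u, ?r v))"
      using uv cls by (simp add: comp_mftor_simps cob_simps Omega_simps projection_simps lift_simps braid_group_mult)
    also have "\<dots> = (FAr F (arrow n (?r (u @ v)) (?r (u @ v))) \<cdot> FAr F (arrow n (?r u @ ?r v) (?r (u @ v)))) \<cdot> Mu F (?r u, ?r v)"
      by (rule N.assoc [symmetric]) (use uv r rr in \<open>simp_all add: functor_arrow_arr [OF F1] f cob_simps\<close>)
    also have "\<dots> = FAr F (arrow n (?r u @ ?r v) (?r (u @ v))) \<cdot> Mu F (?r u, ?r v)"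
      using uv by (simp add: functor_arrows [OF F1] rr r)
    finally show ?thesis .
  qed
  have nil: "[] \<in> words n" by simp
  have TEps: "Eps ?T = FAr F (arrow n [] (?r [])) \<cdot> Eps F"
  proof -
    have "Eps ?T = FAr F (arrow n (?r []) (?r [])) \<cdot> (FAr F (arrow n [] (?r [])) \<cdot> Eps F)"
      using cls [OF nil] by (simp add: comp_mftor_simps cob_simps Omega_simps projection_simps lift_simps braid_group_simps)
    also have "\<dots> = (FAr F (arrow n (?r []) (?r [])) \<cdot> FAr F (arrow n [] (?r []))) \<cdot> Eps F"
      by (rule N.assoc [symmetric]) (use r [OF nil] braid_equiv.sym in \<open>simp_all add: functor_arrow_arr [OF F1] f cob_simps\<close>)
    also have "\<dots> = FAr F (arrow n [] (?r [])) \<cdot> Eps F"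
      using r [OF nil] braid_equiv.sym by (simp add: functor_arrows [OF F1])
    finally show ?thesis .
  qed
  let ?\<theta> = "\<lambda>w. FAr F (arrow n (?r w) w)"
  have natural: "?\<theta> v \<cdot> FAr ?T (arrow n u v) = FAr F (arrow n u v) \<cdot> ?\<theta> u" if uv: "braid_equiv n u v" for u v
  proof -
    have w: "u \<in> words n" "v \<in> words n" using braid_equiv_words [OF uv] by auto
    show ?thesis unfolding TAr [OF uv] r_eq [OF uv]
      using functor_arrows [OF F1 r(3) r(2), of v] functor_arrows [OF F1 r(2) uv] w r_eq [OF uv] by simp
  qed
  have mu: "?\<theta> (u @ v) \<cdot> Mu ?T (u, v) = Mu F (u, v) \<cdot> (?\<theta> u \<star> ?\<theta> v)"
    if uv: "u \<in> words n" "v \<in> words n" for u v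
  proof -
    have ruv: "braid_equiv n (?r (u @ v)) (u @ v)" using r(2) [of "u @ v"] uv by simp
    have "?\<theta> (u @ v) \<cdot> Mu ?T (u, v)
        = (?\<theta> (u @ v) \<cdot> FAr F (arrow n (?r u @ ?r v) (?r (u @ v)))) \<cdot> Mu F (?r u, ?r v)"
      unfolding TMu [OF uv]
      by (rule N.assoc [symmetric]) (use uv r rr ruv in \<open>simp_all add: functor_arrow_arr [OF F1] f cob_simps\<close>)
    also have "\<dots> = FAr F (arrow n (?r u @ ?r v) (u @ v)) \<cdot> Mu F (?r u, ?r v)"
      unfolding functor_arrows [OF F1 rr [OF uv] ruv] ..
    also have "arrow n (?r u @ ?r v) (u @ v) = arrow n (?r u) u \<star>\<^bsub>?L\<^esub> arrow n (?r v) v"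
      using uv r by (simp add: cob_TAr)
    also have "FAr F \<dots> \<cdot> Mu F (?r u, ?r v) = Mu F (u, v) \<cdot> (?\<theta> u \<star> ?\<theta> v)"
      by (rule monoidal_functor_natural [OF F, symmetric]) (use uv r in \<open>auto simp: cob_Arr cob_simps\<close>)
    finally show ?thesis .
  qed
  have eps: "?\<theta> [] \<cdot> Eps ?T = Eps F"
  proof -
    have e: "braid_equiv n [] (?r [])" "braid_equiv n (?r []) []" "braid_equiv n [] []"
      using r [OF nil] braid_equiv.sym braid_equiv.refl [OF nil] by auto
    have "?\<theta> [] \<cdot> Eps ?T = (?\<theta> [] \<cdot> FAr F (arrow n [] (?r []))) \<cdot> Eps F"
      unfolding TEps by (rule N.assoc [symmetric]) (use e in \<open>simp_all add: functor_arrow_arr [OF F1] f cob_simps\<close>)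
    also have "?\<theta> [] \<cdot> FAr F (arrow n [] (?r [])) = Ide N (FOb F [])"
      unfolding functor_arrows [OF F1 e(1,2)] using f(5) [of "[]"] by (simp add: cob_simps)
    finally show ?thesis by (simp add: N.cat_simps f cob_simps)
  qed
  have "natural ?L N (counit n N F)"
    unfolding natural_def counit_def using monoidal_functorD(1) [OF T] F1 r natural
    by (simp add: cob_simps cob_Arr_ball Hom_iff functor_arrow_arr [OF F1] TOb braid_equiv_words)
  then show ?thesis unfolding monoidal_trafo_def using T F mu eps by (simp add: counit_def cob_simps)
qed

text \<open>This holds for actions on objects of any strict monoidal category \<open>N\<close>, and \<open>N = Aut C\<close> is the case of
  actions on \<open>C\<close>.\<close>

theorem restriction_equivalence:
  fixes N :: "('p, 'k, 'y) moncat_scheme"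
  assumes N: "strict_monoidal N"
  shows "equivalence_of_cats (monoidal_functors (Omega (braid_group n)) N) (monoidal_functors (braid_cob n) N)
    (restriction (braid_cob n) (Omega (braid_group n)) N (projection n))"
proof -
  let ?L = "braid_cob n" and ?M = "Omega (braid_group n)"
  let ?CL = "monoidal_functors ?L N" and ?CM = "monoidal_functors ?M N"
  let ?R = "restriction ?L ?M N (projection n)" and ?S = "restriction ?M ?L N (lift n)"
  interpret N: strict_monoidal N by fact
  note L = strict_monoidal_braid_cob [of n] and M = strict_monoidal_Omega [of n]
  have cat: "category ?CL" "category ?CM" using category_monoidal_functors L M N by auto
  have R: "is_functor ?CM ?CL ?R" by (rule functor_restriction [OF monoidal_projection L M N])
  have S: "is_functor ?CL ?CM ?S" by (rule functor_restriction [OF monoidal_lift M L N])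
  have word: "some_word n g \<in> words n" "braid_class n (some_word n g) = g" if "g \<in> carrier (braid_group n)" for g
    using some_word that by auto
  have "comp_functor ?CM ?S ?R = id_functor ?CM"
  proof (rule functor_eqI [where A = "Obj ?CM" and B = "Arr ?CM"])
    fix F assume "F \<in> Obj ?CM"
    then have F: "monoidal_functor ?M N F" by (simp add: monoidal_functors_simps)
    then show "FOb (comp_functor ?CM ?S ?R) F = FOb (id_functor ?CM) F"
      using monoidal_comp_mftor [OF monoidal_projection F L M N] restrict_lift_projection [OF F N]
      by (simp add: comp_functor_simps id_functor_simps monoidal_functors_simps restriction_simps)
  next
    fix \<theta> assume "\<theta> \<in> Arr ?CM"
    then have t: "monoidal_trafo ?M N \<theta>" by (simp add: monoidal_functors_simps)
    note T = monoidal_trafoD [OF t]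
    have "FAr ?S (FAr ?R \<theta>) = \<theta>"
      unfolding restriction_simps(2) [OF t] restriction_simps(2) [OF monoidal_restrict_trafo [OF monoidal_projection t L M N]]
      by (rule trafo_eqI [where A = "carrier (braid_group n)"])
        (use natural_simps(3) [OF T(3)] restrict_lift_projection [OF T(1) N] restrict_lift_projection [OF T(2) N]
          in \<open>simp_all add: Omega_simps cob_simps lift_simps projection_simps word\<close>)
    then show "FAr (comp_functor ?CM ?S ?R) \<theta> = FAr (id_functor ?CM) \<theta>"
      using t by (simp add: comp_functor_simps id_functor_simps monoidal_functors_simps)
  qed (simp_all add: comp_functor_simps id_functor_simps)
  then have 1: "isomorphic_functors ?CM ?CM (comp_functor ?CM ?S ?R) (id_functor ?CM)"
    using isomorphic_functors_refl [OF id_functor [OF cat(2)] cat(2,2)] by simp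
  let ?C = "\<lparr>Src = comp_functor ?CL ?R ?S, Tgt = id_functor ?CL, Comp = (\<lambda>F \<in> Obj ?CL. counit n N F)\<rparr>"
  have RS: "FOb ?R (FOb ?S F) = Src (counit n N F)" if F: "monoidal_functor ?L N F" for F
    using monoidal_comp_mftor [OF monoidal_lift F M L N] F by (simp add: restriction_simps counit_def)
  have "natural ?CL ?CL ?C"
    unfolding natural_def
  proof (intro conjI ballI)
    show "is_functor ?CL ?CL (Src ?C)" "is_functor ?CL ?CL (Tgt ?C)"
      using comp_functor [OF S R cat(1)] id_functor [OF cat(1)] by simp_all
    show "Comp ?C \<in> extensional (Obj ?CL)" by simp
    show "Comp ?C F \<in> Hom ?CL (FOb (Src ?C) F) (FOb (Tgt ?C) F)" if "F \<in> Obj ?CL" for F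
      using that monoidal_counit [OF _ N] RS
      by (simp add: comp_functor_simps id_functor_simps monoidal_functors_simps Hom_iff) (simp add: counit_def)
    fix \<sigma> assume s: "\<sigma> \<in> Arr ?CL"
    then have t: "monoidal_trafo ?L N \<sigma>" by (simp add: monoidal_functors_simps)
    note T = monoidal_trafoD [OF t]
    have RS\<sigma>: "FAr ?R (FAr ?S \<sigma>) = \<lparr>Src = Src (counit n N (Src \<sigma>)), Tgt = Src (counit n N (Tgt \<sigma>)),
        Comp = (\<lambda>w \<in> words n. Comp \<sigma> (some_word n (braid_class n w)))\<rparr>"
      unfolding restriction_simps(2) [OF t] restriction_simps(2) [OF monoidal_restrict_trafo [OF monoidal_lift t M L N]]
      by (rule trafo_eqI [where A = "words n"])
        (simp_all add: counit_def cob_simps Omega_simps projection_simps lift_simps braid_group_simps)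
    have "vertical_comp ?L N (counit n N (Tgt \<sigma>)) (FAr ?R (FAr ?S \<sigma>)) = vertical_comp ?L N \<sigma> (counit n N (Src \<sigma>))"
    proof (rule trafo_eqI [where A = "words n"])
      fix w assume w: "w \<in> words n"
      let ?a = "arrow n (some_word n (braid_class n w)) w"
      have a: "?a \<in> Arr ?L" using some_word_class [OF w] by (auto simp: cob_Arr)
      show "Comp (vertical_comp ?L N (counit n N (Tgt \<sigma>)) (FAr ?R (FAr ?S \<sigma>))) w = Comp (vertical_comp ?L N \<sigma> (counit n N (Src \<sigma>))) w"
        unfolding RS\<sigma> using natural_simps(7) [OF T(3) a] w by (simp add: cob_simps counit_def)
    qed (use vertical_comp_simps(4) [of ?L N] in \<open>simp_all add: RS\<sigma> cob_simps counit_def\<close>)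
    then show "Comp ?C (Cod ?CL \<sigma>) \<cdot>\<^bsub>?CL\<^esub> FAr (Src ?C) \<sigma> = FAr (Tgt ?C) \<sigma> \<cdot>\<^bsub>?CL\<^esub> Comp ?C (Dom ?CL \<sigma>)"
      using t T by (simp add: comp_functor_simps id_functor_simps monoidal_functors_simps)
  qed
  moreover have "iso_arrow ?CL (Comp ?C F)" if "F \<in> Obj ?CL" for F
  proof -
    have F: "monoidal_functor ?L N F" using that by (simp add: monoidal_functors_simps)
    have "iso_arrow N (FAr F (arrow n (some_word n (braid_class n w)) w))" if "w \<in> words n" for w
      by (rule functor_iso [OF monoidal_functorD(1) [OF F] strict_monoidal.axioms(1) [OF L] cob_iso [OF some_word_class [OF that]]])
    then have "iso_arrow ?CL (counit n N F)"
      by (intro monoidal_trafo_iso [OF monoidal_counit [OF F N] L N]) (simp add: counit_def cob_simps)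
    then show ?thesis using that by simp
  qed
  ultimately have "isomorphic_functors ?CL ?CL (comp_functor ?CL ?R ?S) (id_functor ?CL)"
    unfolding isomorphic_functors_def natural_iso_def by (intro exI [of _ ?C]) simp
  then show ?thesis unfolding equivalence_of_cats_def using cat R S 1 by blast
qed

theorem corollary1p21:
  fixes n :: nat and C :: "('o, 'm) cat"
  assumes "n \<ge> 1" and "category C"
  shows "equivalence_of_cats (strict_actions (braid_group n) C) (actions (braid_cob n) C)
           (restriction (braid_cob n) (Omega (braid_group n)) (Aut C) (projection n))"
  by (rule restriction_equivalence [OF strict_monoidal_Aut [OF assms(2)]])

end
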